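(* Suppose that each edge $e_i$ is homeomorphic to $[0,l_i]$ for some positive real number $l_i$. Then for each $i\in\{1,2,\dots,N\}$, $$\lim_{t\to\infty}\frac{T_i(t)}{t}=\frac{\alpha_i\,m_i([0,l_i])}{\sum_{j=1}^N\alpha_j\,m_j([0,l_j])}\quad\text{a.s.},$$ where $m_i$ is the speed measure of the process $Y_i$ on the interval $[0,l_i]$, i.e. $$m_i([0,l_i])=\int_0^{l_i}\frac{2}{\sigma_i^2(x)}\exp\left(\int_0^x\frac{2b_i(y)}{\sigma_i^2(y)}\,dy\right)dx .$$
   Context: **Setting.** $\Gamma$ is a star shaped metric graph with one internal vertex $v$ and edges $e_1,\dots,e_N$; each $e_i$ is homeomorphic via a coordinate function $C_i$ with $C_i(v)=0$ to an interval $I_i$ (here $I_i=[0,l_i]$). The functions $b_i,\sigma_i:I_i\to\mathbb{R}$ are bounded and Lipschitz continuous and $\sigma_1^2,\dots,\sigma_N^2$ are uniformly strictly positive. $\alpha_1,\dots,\alpha_N>0$ are constants with $\sum_i\alpha_i=1$. A starting point $x^0\in\Gamma$ is fixed; $y_i^0=C_i(x^0)$ if $x^0\in e_i$ and $y_i^0=0$ if $x^0\notin e_i$. $Y_1,\dots,Y_N$ are independent; $Y_i$ is a reflecting diffusion on $I_i$ with generator $\mathcal{L}_if=\frac12\sigma_i^2f''+b_if'$, reflected at the end points of $I_i$, with $Y_i(0)=y_i^0$. $L^i(\cdot)$ is the semimartingale local time of $Y_i$ at $0$ (normalization of Revuz–Yor, Chapter VI). **Time change.** Define for $l\ge 0$,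 $t\ge0$ $$h_i(l)=\inf\{t\ge0:\tfrac1{\alpha_i}L^i(t)\ge l\},\quad h(l)=\sum_{i=1}^Nh_i(l),\quad L(t)=\inf\{l\ge0:h(l)\ge t\},\quad \Delta h_i(l)=h_i(l+)-h_i(l),$$ $$T_i(t)=h_i(L(t))+\mathbf{1}_{\{\Delta h_i(L(t))>0\}}\,(t-h(L(t))),\qquad i=1,\dots,N.$$ ($T_i(t)$ is the occupation time on edge $e_i$ up to time $t$ of the Walsh diffusion $X(t)=(Y_1(T_1(t)),\dots,Y_N(T_N(t)))$.) *)

theory Defs
  imports "HOL-Probability.Probability"
begin

section \<open>Continuous semimartingales\<close>

text \<open>
  Processes are functions \<open>real \<Rightarrow> 'a \<Rightarrow> real\<close> of which only the values at times \<open>t \<ge> 0\<close> matter.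
  Filtrations are indexed by \<open>real\<close> as well, so that the library notions apply; the
  \<open>\<sigma>\<close>-algebras at negative times carry no information beyond monotonicity and may be taken
  equal to that at time \<open>0\<close>.
\<close>

definition usual_filtration :: "'a measure \<Rightarrow> (real \<Rightarrow> 'a measure) \<Rightarrow> bool" where
  "usual_filtration M F \<longleftrightarrow>
     filtration (space M) F \<and>
     (\<forall>t. subalgebra M (F t)) \<and>
     (\<forall>t\<ge>0. sets (F t) = (\<Inter>u\<in>{t<..}. sets (F u))) \<and>
     (\<forall>A\<in>null_sets M. \<forall>B. B \<subseteq> A \<longrightarrow> B \<in> sets (F 0))"

definition adapted_process :: "(real \<Rightarrow> 'a measure) \<Rightarrow> (real \<Rightarrow> 'a \<Rightarrow> real) \<Rightarrow> bool" where
  "adapted_process F X \<longleftrightarrow> (\<forall>t\<ge>0. X t \<in> borel_measurable (F t))"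

definition continuous_paths :: "'a measure \<Rightarrow> (real \<Rightarrow> 'a \<Rightarrow> real) \<Rightarrow> bool" where
  "continuous_paths M X \<longleftrightarrow> (\<forall>\<omega>\<in>space M. continuous_on {0..} (\<lambda>t. X t \<omega>))"

definition martingale :: "'a measure \<Rightarrow> (real \<Rightarrow> 'a measure) \<Rightarrow> (real \<Rightarrow> 'a \<Rightarrow> real) \<Rightarrow> bool" where
  "martingale M F X \<longleftrightarrow>
     adapted_process F X \<and>
     (\<forall>t\<ge>0. integrable M (X t)) \<and>
     (\<forall>s\<ge>0. \<forall>t\<ge>s. AE \<omega> in M. real_cond_exp M (F s) (X t) \<omega> = X s \<omega>)"

text \<open>
  The stopping times of a localizing sequence are finite valued, which is no restriction:
  \<open>T n\<close> may be replaced by the minimum of \<open>T n\<close> and \<open>n\<close>; the same replacement makes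
  a requirement of uniform integrability of the stopped martingales superfluous.
\<close>

definition continuous_local_martingale ::
  "'a measure \<Rightarrow> (real \<Rightarrow> 'a measure) \<Rightarrow> (real \<Rightarrow> 'a \<Rightarrow> real) \<Rightarrow> bool" where
  "continuous_local_martingale M F X \<longleftrightarrow>
     adapted_process F X \<and> continuous_paths M X \<and>
     (\<exists>T :: nat \<Rightarrow> 'a \<Rightarrow> real.
        (\<forall>n. stopping_time F (T n)) \<and>
        (\<forall>n. \<forall>\<omega>\<in>space M. 0 \<le> T n \<omega> \<and> T n \<omega> \<le> T (Suc n) \<omega>) \<and>
        (AE \<omega> in M. filterlim (\<lambda>n. T n \<omega>) at_top sequentially) \<and>
        (\<forall>n. martingale M F (\<lambda>t \<omega>. if 0 < T n \<omega> then X (min t (T n \<omega>)) \<omega> else 0)))"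

text \<open>
  A continuous function on \<open>[0,\<infinity>)\<close> has finite variation on compact intervals iff it is the
  difference of two continuous nondecreasing functions; these are extended to the whole line
  so that \<open>interval_measure\<close> applies.
\<close>

definition jordan_pair :: "(real \<Rightarrow> real) \<Rightarrow> (real \<Rightarrow> real) \<Rightarrow> (real \<Rightarrow> real) \<Rightarrow> bool" where
  "jordan_pair v p q \<longleftrightarrow>
     mono p \<and> mono q \<and> continuous_on UNIV p \<and> continuous_on UNIV q \<and> (\<forall>t\<ge>0. v t = p t - q t)"

definition continuous_fv_process ::
  "'a measure \<Rightarrow> (real \<Rightarrow> 'a measure) \<Rightarrow> (real \<Rightarrow> 'a \<Rightarrow> real) \<Rightarrow> bool" where
  "continuous_fv_process M F V \<longleftrightarrow>
     adapted_process F V \<and> continuous_paths M V \<and>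
     (\<forall>\<omega>\<in>space M. V 0 \<omega> = 0 \<and> (\<exists>p q. jordan_pair (\<lambda>t. V t \<omega>) p q))"

text \<open>
  Lebesgue--Stieltjes integral: \<open>j t\<close> is the integral of \<open>k\<close> over \<open>[0,t]\<close> with respect to
  \<open>dv\<close>, for every \<open>t \<ge> 0\<close>. The value does not depend on the choice of the pair \<open>p\<close>, \<open>q\<close>.
\<close>

definition stieltjes_integral ::
  "(real \<Rightarrow> real) \<Rightarrow> (real \<Rightarrow> real) \<Rightarrow> (real \<Rightarrow> real) \<Rightarrow> bool" where
  "stieltjes_integral k v j \<longleftrightarrow>
     (\<exists>p q. jordan_pair v p q \<and>
        (\<forall>t\<ge>0. set_integrable (interval_measure p) {0<..t} k \<and>
               set_integrable (interval_measure q) {0<..t} k \<and>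
               j t = (LINT s:{0<..t}|interval_measure p. k s)
                   - (LINT s:{0<..t}|interval_measure q. k s)))"

text \<open>The bracket \<open>\<langle>X,N\<rangle>\<close> of two continuous local martingales.\<close>

definition bracket ::
  "'a measure \<Rightarrow> (real \<Rightarrow> 'a measure) \<Rightarrow> (real \<Rightarrow> 'a \<Rightarrow> real) \<Rightarrow> (real \<Rightarrow> 'a \<Rightarrow> real)
     \<Rightarrow> (real \<Rightarrow> 'a \<Rightarrow> real) \<Rightarrow> bool" where
  "bracket M F X N A \<longleftrightarrow>
     continuous_fv_process M F A \<and>
     continuous_local_martingale M F (\<lambda>t \<omega>. X t \<omega> * N t \<omega> - A t \<omega>)"

text \<open>
  The stochastic integral of \<open>K\<close> with respect to a continuous local martingale \<open>X\<close>, as in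
  Revuz--Yor, Chapter IV: the continuous local martingale \<open>I\<close> vanishing at \<open>0\<close> whose bracket
  with any continuous local martingale \<open>N\<close> is the pathwise integral of \<open>K\<close> with respect to
  \<open>\<langle>X,N\<rangle>\<close>. It is unique up to indistinguishability.
\<close>

definition stochastic_integral ::
  "'a measure \<Rightarrow> (real \<Rightarrow> 'a measure) \<Rightarrow> (real \<Rightarrow> 'a \<Rightarrow> real) \<Rightarrow> (real \<Rightarrow> 'a \<Rightarrow> real)
     \<Rightarrow> (real \<Rightarrow> 'a \<Rightarrow> real) \<Rightarrow> bool" where
  "stochastic_integral M F K X I \<longleftrightarrow>
     continuous_local_martingale M F I \<and> (\<forall>\<omega>\<in>space M. I 0 \<omega> = 0) \<and>
     (\<forall>N. continuous_local_martingale M F N \<longrightarrow>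
        (\<exists>A B. bracket M F X N A \<and> bracket M F I N B \<and>
           (AE \<omega> in M. stieltjes_integral (\<lambda>t. K t \<omega>) (\<lambda>t. A t \<omega>) (\<lambda>t. B t \<omega>))))"

text \<open>
  \<open>L\<close> is the semimartingale local time of \<open>X\<close> at level \<open>a\<close> in the normalization of Revuz--Yor,
  Chapter VI: the continuous nondecreasing process in Tanaka's formula
  \<open>|X(t) - a| = |X(0) - a| + \<integral> sgn(X - a) dX + L(t)\<close>, with the left continuous sign function
  \<open>sgn 0 = -1\<close>. The process \<open>X = Z + V\<close> is split into its continuous local martingale part
  \<open>Z\<close> and its finite variation part \<open>V\<close>; the integral with respect to \<open>X\<close> is \<open>I + J\<close>.
\<close>

definition sgn_left :: "real \<Rightarrow> real" where
  "sgn_left x = (if 0 < x then 1 else -1)"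

definition semimartingale_local_time ::
  "'a measure \<Rightarrow> (real \<Rightarrow> 'a measure) \<Rightarrow> (real \<Rightarrow> 'a \<Rightarrow> real) \<Rightarrow> real
     \<Rightarrow> (real \<Rightarrow> 'a \<Rightarrow> real) \<Rightarrow> bool" where
  "semimartingale_local_time M F X a L \<longleftrightarrow>
     adapted_process F L \<and> continuous_paths M L \<and>
     (\<forall>\<omega>\<in>space M. L 0 \<omega> = 0 \<and> mono_on {0..} (\<lambda>t. L t \<omega>)) \<and>
     (\<exists>Z V I J.
        continuous_local_martingale M F Z \<and>
        continuous_fv_process M F V \<and>
        (\<forall>\<omega>\<in>space M. \<forall>t\<ge>0. X t \<omega> = Z t \<omega> + V t \<omega>) \<and>
        stochastic_integral M F (\<lambda>t \<omega>. sgn_left (X t \<omega> - a)) Z I \<and>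
        (AE \<omega> in M. stieltjes_integral (\<lambda>t. sgn_left (X t \<omega> - a)) (\<lambda>t. V t \<omega>) (\<lambda>t. J t \<omega>)) \<and>
        (AE \<omega> in M. \<forall>t\<ge>0.
           \<bar>X t \<omega> - a\<bar> = \<bar>X 0 \<omega> - a\<bar> + I t \<omega> + J t \<omega> + L t \<omega>))"


section \<open>Reflecting diffusions on a compact interval\<close>

text \<open>
  A function \<open>f\<close> of class \<open>C\<^sup>2\<close> on \<open>[0,l]\<close> (one-sided derivatives at the end points), given with
  its first two derivatives \<open>f1\<close>, \<open>f2\<close>, which satisfies the Neumann conditions that encode
  reflection at both end points.
\<close>

definition neumann_C2 ::
  "real \<Rightarrow> (real \<Rightarrow> real) \<Rightarrow> (real \<Rightarrow> real) \<Rightarrow> (real \<Rightarrow> real) \<Rightarrow> bool" where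
  "neumann_C2 l f f1 f2 \<longleftrightarrow>
     (\<forall>x\<in>{0..l}. (f has_real_derivative f1 x) (at x within {0..l})) \<and>
     (\<forall>x\<in>{0..l}. (f1 has_real_derivative f2 x) (at x within {0..l})) \<and>
     continuous_on {0..l} f2 \<and> f1 0 = 0 \<and> f1 l = 0"

text \<open>
  The diffusion with generator \<open>\<L>f = \<sigma>\<^sup>2 f''/2 + b f'\<close> on \<open>[0,l]\<close>, reflected at \<open>0\<close> and \<open>l\<close> and
  started at \<open>y\<close>: a continuous adapted process with values in \<open>[0,l]\<close> such that
  \<open>f(Y(t)) - f(Y(0)) - \<integral>\<^sub>0\<^sup>t \<L>f(Y(s)) ds\<close> is a martingale for all \<open>f\<close> in the domain of the generator.
\<close>

definition reflecting_diffusion ::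
  "'a measure \<Rightarrow> (real \<Rightarrow> 'a measure) \<Rightarrow> (real \<Rightarrow> real) \<Rightarrow> (real \<Rightarrow> real) \<Rightarrow> real \<Rightarrow> real
     \<Rightarrow> (real \<Rightarrow> 'a \<Rightarrow> real) \<Rightarrow> bool" where
  "reflecting_diffusion M F \<sigma> b l y Y \<longleftrightarrow>
     adapted_process F Y \<and> continuous_paths M Y \<and>
     (\<forall>\<omega>\<in>space M. \<forall>t\<ge>0. Y t \<omega> \<in> {0..l}) \<and>
     (AE \<omega> in M. Y 0 \<omega> = y) \<and>
     (\<forall>f f1 f2. neumann_C2 l f f1 f2 \<longrightarrow>
        martingale M F (\<lambda>t \<omega>. f (Y t \<omega>) - f (Y 0 \<omega>)
          - (LINT s:{0..t}|lborel. (\<sigma> (Y s \<omega>))\<^sup>2 / 2 * f2 (Y s \<omega>) + b (Y s \<omega>) * f1 (Y s \<omega>))))"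

text \<open>The total mass \<open>m([0,l])\<close> of the speed measure.\<close>

definition speed_mass :: "(real \<Rightarrow> real) \<Rightarrow> (real \<Rightarrow> real) \<Rightarrow> real \<Rightarrow> real" where
  "speed_mass \<sigma> b l =
     (LINT x:{0..l}|lborel. 2 / (\<sigma> x)\<^sup>2 * exp (LINT y:{0..x}|lborel. 2 * b y / (\<sigma> y)\<^sup>2))"

definition independent_processes ::
  "'a measure \<Rightarrow> (nat \<Rightarrow> real \<Rightarrow> 'a \<Rightarrow> real) \<Rightarrow> nat set \<Rightarrow> bool" where
  "independent_processes M Y J \<longleftrightarrow>
     prob_space.indep_vars M (\<lambda>_. Pi\<^sub>M {0..} (\<lambda>_. borel)) (\<lambda>i \<omega>. \<lambda>t\<in>{0..}. Y i t \<omega>) J"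


section \<open>Star shaped graphs and the time change\<close>

definition star_graph ::
  "nat \<Rightarrow> (nat \<Rightarrow> real) \<Rightarrow> 'p::metric_space \<Rightarrow> (nat \<Rightarrow> 'p set) \<Rightarrow> (nat \<Rightarrow> 'p \<Rightarrow> real) \<Rightarrow> bool" where
  "star_graph N len v e C \<longleftrightarrow>
     (\<forall>i\<in>{1..N}. 0 < len i \<and> v \<in> e i \<and> C i v = 0 \<and> (\<exists>D. homeomorphism (e i) {0..len i} (C i) D)) \<and>
     (\<forall>i\<in>{1..N}. \<forall>j\<in>{1..N}. i \<noteq> j \<longrightarrow> e i \<inter> e j = {v})"

definition edge_start :: "('p set) \<Rightarrow> ('p \<Rightarrow> real) \<Rightarrow> 'p \<Rightarrow> real" where
  "edge_start E c x = (if x \<in> E then c x else 0)"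

text \<open>
  In the following, \<open>lt i\<close> is a path of the local time on the \<open>i\<close>-th edge. The infima are real
  valued; the sets are nonempty for all arguments whenever every \<open>lt i\<close> is unbounded.
\<close>

definition local_time_inverse :: "(nat \<Rightarrow> real) \<Rightarrow> (nat \<Rightarrow> real \<Rightarrow> real) \<Rightarrow> nat \<Rightarrow> real \<Rightarrow> real" where
  "local_time_inverse \<alpha> lt i u = Inf {t. 0 \<le> t \<and> u \<le> 1 / \<alpha> i * lt i t}"

definition total_inverse :: "nat \<Rightarrow> (nat \<Rightarrow> real) \<Rightarrow> (nat \<Rightarrow> real \<Rightarrow> real) \<Rightarrow> real \<Rightarrow> real" where
  "total_inverse N \<alpha> lt u = (\<Sum>i=1..N. local_time_inverse \<alpha> lt i u)"

definition vertex_clock :: "nat \<Rightarrow> (nat \<Rightarrow> real) \<Rightarrow> (nat \<Rightarrow> real \<Rightarrow> real) \<Rightarrow> real \<Rightarrow> real" where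
  "vertex_clock N \<alpha> lt t = Inf {u. 0 \<le> u \<and> t \<le> total_inverse N \<alpha> lt u}"

definition right_jump :: "(real \<Rightarrow> real) \<Rightarrow> real \<Rightarrow> real" where
  "right_jump h u = Lim (at_right u) h - h u"

definition occupation_time ::
  "nat \<Rightarrow> (nat \<Rightarrow> real) \<Rightarrow> (nat \<Rightarrow> real \<Rightarrow> real) \<Rightarrow> nat \<Rightarrow> real \<Rightarrow> real" where
  "occupation_time N \<alpha> lt i t =
     (let u = vertex_clock N \<alpha> lt t in
        local_time_inverse \<alpha> lt i u
        + (if right_jump (local_time_inverse \<alpha> lt i) u > 0 then t - total_inverse N \<alpha> lt u else 0))"

end

theory Submission
  imports Defs
begin

text \<open>
  Only the asymptotics of the local times matter. If \<open>L j t / t\<close> tends to \<open>2 / m j\<close> for every edge,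
  where \<open>m j\<close> is the mass of the speed measure, then the inverse local time at \<open>u\<close> is asymptotic
  to \<open>\<alpha> j * m j / 2 * u\<close>. The time \<open>t\<close> lies between the values of the total inverse just below and
  just above the vertex clock, so the jump term is negligible and the limit follows.

  For a single reflecting diffusion \<open>Y\<close> with generator \<open>\<L>\<close>, fix a function \<open>f\<close> (the ramp) which is the identity
  near \<open>0\<close> and flat at \<open>l\<close>. Solving an ordinary differential equation yields a Neumann function \<open>p\<close>
  with \<open>\<L>p = 1 + m * \<L>f\<close>, and the law of large numbers for its martingale shows that the time average
  of \<open>\<L>f(Y)\<close> tends to \<open>- 1 / m\<close>. It remains to see that \<open>f(Y) - f(Y 0) - L / 2\<close> minus the integral of \<open>\<L>f(Y)\<close>
  has second moments of linear growth. As \<open>f\<close> is not in the domain of the generator, this process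
  is exhibited as a limit of discrete martingale transforms: near \<open>0\<close> the increments are those of
  the local martingales in the decomposition of \<open>Y\<close> and in Tanaka's formula, away from \<open>0\<close> they are those
  of the martingale problem for a Neumann function which differs from \<open>f\<close> only near \<open>0\<close>. The
  transforms differ from \<open>f(Y)\<close> by paths of finite variation, so their quadratic variation is that
  of \<open>f(Y)\<close>, whose mean is controlled by the martingale problem.
\<close>

section \<open>The time change\<close>

text \<open>The difficulty is the slope \<open>1\<close> of the ramp at \<open>0\<close>: the
  martingale problem speaks only of Neumann functions, whereas the local time is tied to
  \<open>Y\<close> through Tanaka's formula, whose local martingales come without moment bounds.
  Pathwise sums bridge the two. With a cutoff \<open>chi\<close> near \<open>0\<close>, the
  increments \<open>(chi - 1/2) dZ + (1/2) dI + (1 - chi) dN\<close> reproduce those of the ramp up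
  to \<open>- chi dV + (dV - dJ - dL) / 2\<close> and a drift. For nonnegative paths the indicator
  of \<open>0\<close> is \<open>(1 - sgn_left) / 2\<close>, so as the cutoff shrinks
  \<open>chi dV\<close> becomes \<open>(dV - dJ) / 2\<close> and exactly \<open>- dL / 2\<close>
  survives: the semimartingale local time counts the push at the boundary twice, whence the rate
  \<open>2 / m\<close>. Limits are taken in the mesh, in the width of the cutoff and in the
  localization. Fatou's lemma suffices each time, because the bound, a mean of squared increments of
  the ramp, is uniform in all three. Second moments of linear growth are summable after division
  along the squares of the integers, and monotonicity of the local time fills the gaps.\<close>

lemma local_time_inverse_asymp:
  fixes lt :: "nat \<Rightarrow> real \<Rightarrow> real"
  assumes mono: "mono_on {0..} (lt i)" and a: "\<alpha> i > 0" and r: "r > 0"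
    and lim: "((\<lambda>t. lt i t / t) \<longlongrightarrow> r) at_top"
  shows "((\<lambda>u. local_time_inverse \<alpha> lt i u / u) \<longlongrightarrow> \<alpha> i / r) at_top"
proof -
  define S where "S u = {t. 0 \<le> t \<and> u \<le> 1 / \<alpha> i * lt i t}" for u
  have h: "local_time_inverse \<alpha> lt i u = Inf (S u)" for u
    by (simp add: local_time_inverse_def S_def)
  have bdd: "bdd_below (S u)" for u
    by (auto simp: S_def intro: bdd_belowI[of _ 0])
  have up: "\<forall>\<^sub>F u in at_top. local_time_inverse \<alpha> lt i u / u \<le> \<alpha> i / r'" if r': "0 < r'" "r' < r" for r'
  proof -
    from order_tendstoD(1)[OF lim r'(2)] obtain T where T: "\<And>t. t \<ge> T \<Longrightarrow> r' < lt i t / t"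
      by (auto simp: eventually_at_top_linorder)
    show ?thesis unfolding eventually_at_top_linorder
    proof (intro exI allI impI)
      fix u :: real assume u: "max 1 (r' * T / \<alpha> i) \<le> u"
      \<comment> \<open>\<open>t\<close> is where the line of slope \<open>r'\<close> reaches the
        level \<open>\<alpha> i * u\<close>; the local time lies above that line, so it has reached
        the level by then.\<close>
      define t where "t = \<alpha> i * u / r'"
      have tp: "t > 0" using u a r' by (auto simp: t_def)
      have "t \<ge> T" using u a r' by (auto simp: t_def field_simps)
      from T[OF this] have "r' * t < lt i t" using tp by (simp add: field_simps)
      then have "t \<in> S u" using a r' tp by (auto simp: S_def t_def field_simps)
      then have "Inf (S u) \<le> t" using bdd by (intro cInf_lower)
      then show "local_time_inverse \<alpha> lt i u / u \<le> \<alpha> i / r'"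
        using u r' by (simp add: h t_def field_simps)
    qed
  qed
  have lo: "\<forall>\<^sub>F u in at_top. \<alpha> i / r' \<le> local_time_inverse \<alpha> lt i u / u" if r': "r < r'" for r'
  proof -
    have r'p: "r' > 0" using r r' by simp
    from order_tendstoD(2)[OF lim r'] obtain T0 where T0: "\<And>t. t \<ge> T0 \<Longrightarrow> lt i t / t < r'"
      by (auto simp: eventually_at_top_linorder)
    define T where "T = max T0 1"
    have T: "lt i t \<le> r' * t" if "t \<ge> T" for t
      using T0[of t] that by (auto simp: T_def field_simps)
    from order_tendstoD(1)[OF lim, of "r/2"] r obtain T1 where T1: "\<And>t. t \<ge> T1 \<Longrightarrow> r/2 < lt i t / t"
      by (auto simp: eventually_at_top_linorder)
    show ?thesis unfolding eventually_at_top_linorder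
    proof (intro exI allI impI)
      fix u :: real assume u: "max 1 ((\<bar>lt i T\<bar> + 1) / \<alpha> i) \<le> u"
      \<comment> \<open>The linear upper bound holds only from \<open>T\<close> on. For such large
        \<open>u\<close> the local time has not reached its level at \<open>T\<close>, and
        monotonicity excludes all earlier times.\<close>
      have uT: "lt i T < \<alpha> i * u" using u a by (auto simp: field_simps)
      have "S u \<noteq> {}"
      proof -
        define t where "t = max 1 (max T1 (2 * \<alpha> i * u / r))"
        have t1: "t \<ge> 1" "t \<ge> T1" "t \<ge> 2 * \<alpha> i * u / r" by (auto simp: t_def)
        have "r/2 * t < lt i t" using T1[of t] t1 by (simp add: field_simps)
        moreover have "\<alpha> i * u \<le> r/2 * t" using t1 r by (simp add: field_simps)
        ultimately have "t \<in> S u" using t1 a by (simp add: S_def field_simps)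
        then show ?thesis by auto
      qed
      moreover have "\<alpha> i * u / r' \<le> t" if "t \<in> S u" for t
      proof -
        have t: "0 \<le> t" "\<alpha> i * u \<le> lt i t" using that a by (auto simp: S_def field_simps)
        have "t \<ge> T"
        proof (rule ccontr)
          assume "\<not> t \<ge> T"
          then have "lt i t \<le> lt i T" using t by (intro mono_onD[OF mono]) auto
          with t uT show False by simp
        qed
        from T[OF this] t r'p show ?thesis by (simp add: field_simps)
      qed
      ultimately have "\<alpha> i * u / r' \<le> Inf (S u)" by (intro cInf_greatest)
      then show "\<alpha> i / r' \<le> local_time_inverse \<alpha> lt i u / u"
        using u r'p by (simp add: h field_simps)
    qed
  qed
  show ?thesis
  proof (rule order_tendstoI)
    fix y assume y: "y < \<alpha> i / r"
    have "\<exists>r'. r < r' \<and> y < \<alpha> i / r'"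
    proof (cases "y \<le> 0")
      case True
      then have "y < \<alpha> i / (2 * r)" using a r by (intro le_less_trans[OF True]) simp
      then show ?thesis using r by (intro exI[of _ "2 * r"]) simp
    next
      case False
      then have "r < \<alpha> i / y" using y r by (simp add: field_simps)
      then obtain r' where r': "r < r'" "r' < \<alpha> i / y" using dense by blast
      then have "y < \<alpha> i / r'" using False r by (simp add: field_simps)
      with r' show ?thesis by blast
    qed
    then obtain r' where "r < r'" "y < \<alpha> i / r'" by blast
    from lo[OF this(1)] show "\<forall>\<^sub>F u in at_top. y < local_time_inverse \<alpha> lt i u / u"
      by eventually_elim (use \<open>y < \<alpha> i / r'\<close> in linarith)
  next
    fix y assume y: "y > \<alpha> i / r"
    have yp: "y > 0" using y a r by (smt (verit) divide_pos_pos)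
    have "\<alpha> i / y < r" using y r yp by (simp add: field_simps)
    then obtain r' where r': "\<alpha> i / y < r'" "r' < r" using dense by blast
    have "0 < r'" using r'(1) a yp by (smt (verit) divide_pos_pos)
    then have "\<alpha> i / r' < y" using r' yp by (simp add: field_simps)
    from up[OF \<open>0 < r'\<close> \<open>r' < r\<close>] show "\<forall>\<^sub>F u in at_top. local_time_inverse \<alpha> lt i u / u < y"
      by eventually_elim (use \<open>\<alpha> i / r' < y\<close> in linarith)
  qed
qed

text \<open>Divergence of the local time keeps the smaller of the two sets nonempty; on the reals
  the infimum of the empty set would carry no information.\<close>

lemma local_time_inverse_mono:
  assumes a: "\<alpha> i > 0" and lim: "filterlim (lt i) at_top at_top" and uv: "u \<le> v"
  shows "local_time_inverse \<alpha> lt i u \<le> local_time_inverse \<alpha> lt i v"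
  unfolding local_time_inverse_def
proof (rule cInf_superset_mono)
  from lim have "\<forall>\<^sub>F t in at_top. \<alpha> i * v \<le> lt i t" by (simp add: filterlim_at_top)
  with eventually_ge_at_top[of "0::real"] have "\<forall>\<^sub>F t in at_top. 0 \<le> t \<and> \<alpha> i * v \<le> lt i t" by eventually_elim auto
  then obtain t where "0 \<le> t" "\<alpha> i * v \<le> lt i t" unfolding eventually_at_top_linorder by blast
  then show "{t. 0 \<le> t \<and> v \<le> 1 / \<alpha> i * lt i t} \<noteq> {}" using a by (auto simp: field_simps)
  show "bdd_below {t. 0 \<le> t \<and> u \<le> 1 / \<alpha> i * lt i t}" by (auto intro: bdd_belowI[of _ 0])
qed (use uv in auto)

text \<open>Serves to evaluate the total inverse one unit below and one unit above the vertex
  clock.\<close>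

lemma asymp_shift:
  fixes h :: "real \<Rightarrow> real"
  assumes lim: "((\<lambda>u. h u / u) \<longlongrightarrow> H) at_top"
  shows "((\<lambda>u. h (u + a) / u) \<longlongrightarrow> H) at_top"
proof (rule Lim_transform_eventually)
  have sh: "filterlim (\<lambda>u::real. u + a) at_top at_top"
    by (subst add.commute, rule filterlim_tendsto_add_at_top[OF tendsto_const filterlim_ident])
  have inv: "((\<lambda>u::real. 1 / u) \<longlongrightarrow> 0) at_top"
    by (intro tendsto_divide_0[OF tendsto_const] filterlim_at_top_imp_at_infinity filterlim_ident)
  show "((\<lambda>u. h (u + a) / (u + a) * (1 + a * (1 / u))) \<longlongrightarrow> H) at_top"
    using tendsto_mult[OF filterlim_compose[OF lim sh]
        tendsto_add[OF tendsto_const[of 1] tendsto_mult[OF tendsto_const[of a] inv]]] by simp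
  show "\<forall>\<^sub>F u in at_top. h (u + a) / (u + a) * (1 + a * (1 / u)) = h (u + a) / u"
    using eventually_gt_at_top[of "\<bar>a\<bar>"]
  proof eventually_elim
    case (elim u)
    then have "u > 0" "u + a > 0" by linarith+
    moreover have "1 + a * (1 / u) = (u + a) / u" using \<open>u > 0\<close> by (simp add: add_divide_distrib)
    ultimately show ?case by simp
  qed
qed

text \<open>With \<open>c\<close> the clock and \<open>h\<close> the total inverse, the infimum
  gives \<open>h u < t\<close> for \<open>u < c t\<close> and \<open>t \<le> h u\<close> for
  \<open>u > c t\<close>, but says nothing at \<open>c t\<close> itself, where \<open>h\<close> may
  jump. Moving the argument by one unit in each direction brackets \<open>t\<close> between values
  of \<open>h\<close>, at a cost that disappears after division by \<open>c t\<close>.\<close>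

lemma vertex_clock_asymp:
  assumes mono: "\<And>u v. 0 \<le> u \<Longrightarrow> u \<le> v \<Longrightarrow> total_inverse N \<alpha> lt u \<le> total_inverse N \<alpha> lt v"
    and lim: "((\<lambda>u. total_inverse N \<alpha> lt u / u) \<longlongrightarrow> H) at_top" and H: "H > 0"
  shows "filterlim (vertex_clock N \<alpha> lt) at_top at_top"
    and "((\<lambda>t. t / vertex_clock N \<alpha> lt t) \<longlongrightarrow> H) at_top"
proof -
  define h where "h = total_inverse N \<alpha> lt"
  define K where "K t = {u. 0 \<le> u \<and> t \<le> h u}" for t
  define c where "c = vertex_clock N \<alpha> lt"
  have c: "c t = Inf (K t)" for t by (simp add: c_def vertex_clock_def K_def h_def)
  have bdd: "bdd_below (K t)" for t by (auto simp: K_def intro: bdd_belowI[of _ 0])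
  have "filterlim (\<lambda>u. h u / u * u) at_top at_top"
    by (rule filterlim_tendsto_pos_mult_at_top[OF lim[folded h_def] H filterlim_ident])
  then have hinf: "filterlim h at_top at_top"
    by (rule filterlim_mono_eventually[OF _ order_refl order_refl])
       (use eventually_gt_at_top[of "0::real"] in \<open>eventually_elim, auto\<close>)
  have ne: "K t \<noteq> {}" for t
  proof -
    from hinf have "\<forall>\<^sub>F u in at_top. t \<le> h u" by (simp add: filterlim_at_top)
    with eventually_ge_at_top[of "0::real"] have "\<forall>\<^sub>F u in at_top. 0 \<le> u \<and> t \<le> h u" by eventually_elim auto
    then show ?thesis unfolding K_def eventually_at_top_linorder by blast
  qed
  have c0: "c t \<ge> 0" for t unfolding c using ne by (intro cInf_greatest) (auto simp: K_def)
  have below: "h u < t" if "0 \<le> u" "u < c t" for u t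
  proof (rule ccontr)
    assume "\<not> h u < t"
    then have "u \<in> K t" using that by (auto simp: K_def)
    then have "c t \<le> u" unfolding c using bdd by (intro cInf_lower)
    with that show False by simp
  qed
  have above: "t \<le> h u" if "c t < u" for u t
  proof -
    from that ne bdd obtain w where "w \<in> K t" "w < u" unfolding c by (meson cInf_lessD)
    then show ?thesis using mono[of w u] by (auto simp: K_def h_def)
  qed
  show cinf: "filterlim (vertex_clock N \<alpha> lt) at_top at_top"
    unfolding filterlim_at_top_ge[of _ _ 0] c_def[symmetric]
  proof (intro allI impI)
    fix Z :: real assume "0 \<le> Z"
    show "\<forall>\<^sub>F t in at_top. Z \<le> c t"
      using eventually_gt_at_top[of "h (Z+1)"]
    proof eventually_elim
      case (elim t)
      show ?case
      proof (rule ccontr)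
        assume "\<not> Z \<le> c t" then have "t \<le> h (Z+1)" by (intro above) simp
        with elim show False by simp
      qed
    qed
  qed
  note l1 = asymp_shift[OF lim[folded h_def], of 1] and l2 = asymp_shift[OF lim[folded h_def], of "-1"]
  show "((\<lambda>t. t / vertex_clock N \<alpha> lt t) \<longlongrightarrow> H) at_top"
    unfolding c_def[symmetric]
  proof (rule tendsto_sandwich)
    show "((\<lambda>t. h (c t + -1) / c t) \<longlongrightarrow> H) at_top"
      by (rule filterlim_compose[OF l2 cinf[folded c_def]])
    show "((\<lambda>t. h (c t + 1) / c t) \<longlongrightarrow> H) at_top"
      by (rule filterlim_compose[OF l1 cinf[folded c_def]])
    have ev: "\<forall>\<^sub>F t in at_top. 1 < c t" using cinf by (simp add: filterlim_at_top_dense c_def)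
    show "\<forall>\<^sub>F t in at_top. h (c t + -1) / c t \<le> t / c t"
      using ev by eventually_elim (auto intro!: divide_right_mono less_imp_le[OF below])
    show "\<forall>\<^sub>F t in at_top. t / c t \<le> h (c t + 1) / c t"
      using ev by eventually_elim (auto intro!: divide_right_mono above)
  qed
qed

lemma occupation_time_asymp:
  fixes lt :: "nat \<Rightarrow> real \<Rightarrow> real"
  assumes mono: "\<And>j. j \<in> {1..N} \<Longrightarrow> mono_on {0..} (lt j)"
    and a: "\<And>j. j \<in> {1..N} \<Longrightarrow> \<alpha> j > 0" and r: "\<And>j. j \<in> {1..N} \<Longrightarrow> r j > 0"
    and lim: "\<And>j. j \<in> {1..N} \<Longrightarrow> ((\<lambda>t. lt j t / t) \<longlongrightarrow> r j) at_top"
    and i: "i \<in> {1..N}"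
  shows "((\<lambda>t. occupation_time N \<alpha> lt i t / t) \<longlongrightarrow> (\<alpha> i / r i) / (\<Sum>j=1..N. \<alpha> j / r j)) at_top"
proof -
  define H where "H = (\<Sum>j=1..N. \<alpha> j / r j)"
  define c where "c = vertex_clock N \<alpha> lt"
  have H: "H > 0" unfolding H_def using a r i by (intro sum_pos) auto
  have li: "((\<lambda>u. local_time_inverse \<alpha> lt j u / u) \<longlongrightarrow> \<alpha> j / r j) at_top" if "j \<in> {1..N}" for j
    by (rule local_time_inverse_asymp) (use that mono a r lim in auto)
  have lh: "((\<lambda>u. total_inverse N \<alpha> lt u / u) \<longlongrightarrow> H) at_top"
    unfolding total_inverse_def H_def sum_divide_distrib by (intro tendsto_sum li)
  have ltinf: "filterlim (lt j) at_top at_top" if j: "j \<in> {1..N}" for j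
  proof -
    have "filterlim (\<lambda>u. lt j u / u * u) at_top at_top"
      by (rule filterlim_tendsto_pos_mult_at_top[OF lim[OF j] r[OF j] filterlim_ident])
    then show ?thesis
      by (rule filterlim_mono_eventually[OF _ order_refl order_refl])
         (use eventually_gt_at_top[of "0::real"] in \<open>eventually_elim, auto\<close>)
  qed
  have hm: "total_inverse N \<alpha> lt u \<le> total_inverse N \<alpha> lt v" if "u \<le> v" for u v
    unfolding total_inverse_def using that a ltinf by (intro sum_mono local_time_inverse_mono) auto
  note clk = vertex_clock_asymp[OF hm lh H, folded c_def]
  have ct: "((\<lambda>t. c t / t) \<longlongrightarrow> 1 / H) at_top"
    using tendsto_divide[OF tendsto_const[of 1] clk(2)] H by (simp add: field_simps)
  have ev: "\<forall>\<^sub>F t in at_top. 0 < c t \<and> 0 < t"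
    using clk(1) eventually_gt_at_top[of "0::real"] by (auto simp: filterlim_at_top_dense intro: eventually_conj)
  have 1: "((\<lambda>t. local_time_inverse \<alpha> lt i (c t) / t) \<longlongrightarrow> \<alpha> i / r i * (1 / H)) at_top"
  proof (rule Lim_transform_eventually)
    show "((\<lambda>t. local_time_inverse \<alpha> lt i (c t) / c t * (c t / t)) \<longlongrightarrow> \<alpha> i / r i * (1 / H)) at_top"
      by (intro tendsto_mult ct filterlim_compose[OF li[OF i] clk(1)])
  qed (use ev in \<open>eventually_elim, auto\<close>)
  have 2: "((\<lambda>t. 1 - total_inverse N \<alpha> lt (c t) / c t * (c t / t)) \<longlongrightarrow> 1 - H * (1 / H)) at_top"
    by (intro tendsto_intros ct filterlim_compose[OF lh clk(1)])
  \<comment> \<open>Whatever the right limit is, the jump condition is a factor in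
    \<open>{0, 1}\<close>. It multiplies the relative gap between \<open>t\<close> and the total
    inverse at the clock, which tends to \<open>0\<close>.\<close>
  define J where "J t = (if right_jump (local_time_inverse \<alpha> lt i) (c t) > 0 then 1 else 0::real)" for t
  have 3: "((\<lambda>t. J t * (1 - total_inverse N \<alpha> lt (c t) / c t * (c t / t))) \<longlongrightarrow> 0) at_top"
  proof (rule tendsto_0_le[where K=1])
    show "((\<lambda>t. 1 - total_inverse N \<alpha> lt (c t) / c t * (c t / t)) \<longlongrightarrow> 0) at_top" using 2 H by simp
  qed (auto simp: J_def)
  show ?thesis
    unfolding H_def[symmetric]
  proof (rule Lim_transform_eventually)
    show "((\<lambda>t. local_time_inverse \<alpha> lt i (c t) / t + J t * (1 - total_inverse N \<alpha> lt (c t) / c t * (c t / t))) \<longlongrightarrow> (\<alpha> i / r i) / H) at_top"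
      using tendsto_add[OF 1 3] by simp
    show "\<forall>\<^sub>F t in at_top. local_time_inverse \<alpha> lt i (c t) / t + J t * (1 - total_inverse N \<alpha> lt (c t) / c t * (c t / t)) = occupation_time N \<alpha> lt i t / t"
      using ev by eventually_elim (auto simp: occupation_time_def Let_def J_def c_def field_simps)
  qed
qed

section \<open>Optional stopping and truncated martingale transforms\<close>

text \<open>The sum telescopes and stops at the first grid point that is not before
  \<open>\<tau>\<close>, or at \<open>t\<close>. This is at most one mesh width beyond
  \<open>max s (min t \<tau>)\<close>, and continuity removes the overshoot.\<close>

lemma grid_stop_sum:
  fixes x :: "real \<Rightarrow> real"
  assumes x: "continuous_on {0..} x" and st: "0 \<le> s" "s \<le> t"
  shows "(\<lambda>n. \<Sum>j<n. if s + (t - s) * real j / real n < \<tau>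
            then x (s + (t - s) * real (Suc j) / real n) - x (s + (t - s) * real j / real n) else 0)
         \<longlonglongrightarrow> x (max s (min t \<tau>)) - x s"
    (is "?S \<longlonglongrightarrow> _")
proof -
  define m where "m = max s (min t \<tau>)"
  have mt: "s \<le> m" "m \<le> t" using st by (auto simp: m_def)
  have "\<exists>q. ?S n = x q - x s \<and> m \<le> q \<and> q \<le> m + (t - s) / real n" if n: "n > 0" for n
  proof -
    define g where "g j = s + (t - s) * real j / real n" for j
    define h where "h = (t - s) / real n"
    have h: "h \<ge> 0" using st by (simp add: h_def)
    have g0: "g 0 = s" by (simp add: g_def)
    have gS: "g (Suc j) = g j + h" for j by (simp add: g_def h_def ring_distribs add_divide_distrib)
    have gn: "g n = t" using n by (simp add: g_def)
    have gs: "s \<le> g j" for j using st by (simp add: g_def)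
    have gt: "g j \<le> t" if "j \<le> n" for j
    proof -
      have "(t - s) * real j \<le> (t - s) * real n" using that st by (intro mult_left_mono) auto
      then have "(t - s) * real j / real n \<le> t - s" using n by (simp add: divide_le_eq)
      then show ?thesis by (simp add: g_def)
    qed
    \<comment> \<open>\<open>q\<close> is the point at which the partial sum is frozen. The last
      conjunct, by which it is the current grid point as long as this lies before
      \<open>\<tau>\<close>, carries the induction.\<close>
    have "\<exists>q. (\<Sum>j<k. if g j < \<tau> then x (g (Suc j)) - x (g j) else 0) = x q - x s \<and>
            min (g k) m \<le> q \<and> q \<le> min (g k) (m + h) \<and> (g k < \<tau> \<longrightarrow> q = g k)" if "k \<le> n" for k
      using that
    proof (induction k)
      case 0
      show ?case using mt h by (intro exI[of _ s]) (auto simp: g0)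
    next
      case (Suc k)
      then obtain q where q: "(\<Sum>j<k. if g j < \<tau> then x (g (Suc j)) - x (g j) else 0) = x q - x s"
        "min (g k) m \<le> q" "q \<le> min (g k) (m + h)" "g k < \<tau> \<longrightarrow> q = g k" by auto
      show ?case
      proof (cases "g k < \<tau>")
        case True
        have "g k \<le> m" using True gt[of k] Suc.prems by (auto simp: m_def)
        then show ?thesis using q True by (intro exI[of _ "g (Suc k)"]) (auto simp: gS)
      next
        case False
        have "m \<le> g k" using False gs[of k] by (auto simp: m_def)
        then show ?thesis using q False h by (intro exI[of _ q]) (auto simp: gS)
      qed
    qed
    from this[OF order_refl] obtain q where
      "(\<Sum>j<n. if g j < \<tau> then x (g (Suc j)) - x (g j) else 0) = x q - x s" "m \<le> q" "q \<le> m + h"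
      using mt by (auto simp: gn)
    then show ?thesis unfolding g_def h_def by blast
  qed
  then have "\<forall>n. \<exists>q. n > 0 \<longrightarrow> ?S n = x q - x s \<and> m \<le> q \<and> q \<le> m + (t - s) / real n" by blast
  from choice[OF this] obtain q where
    q': "\<forall>n. n > 0 \<longrightarrow> ?S n = x (q n) - x s \<and> m \<le> q n \<and> q n \<le> m + (t - s) / real n"
    by (elim exE)
  have q: "?S n = x (q n) - x s \<and> m \<le> q n \<and> q n \<le> m + (t - s) / real n" if "n > 0" for n
    using q' that by blast
  have qm: "q \<longlonglongrightarrow> m"
  proof (rule tendsto_sandwich)
    show "(\<lambda>n. m) \<longlonglongrightarrow> m" by simp
    show "(\<lambda>n. m + (t - s) / real n) \<longlonglongrightarrow> m"
      using tendsto_add[OF tendsto_const[of m] lim_const_over_n[of "t - s"]] by simp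
  qed (use q in \<open>auto simp: eventually_sequentially intro!: exI[of _ 1]\<close>)
  have "\<forall>\<^sub>F n in sequentially. q n \<in> {0..}"
    using eventually_gt_at_top[of 0]
  proof eventually_elim
    case (elim n)
    from q[OF this] mt st show ?case by simp
  qed
  then have "(\<lambda>n. x (q n)) \<longlonglongrightarrow> x m"
    by (intro continuous_on_tendsto_compose[OF x qm]) (use mt st in auto)
  then have "(\<lambda>n. x (q n) - x s) \<longlonglongrightarrow> x m - x s" by (intro tendsto_intros)
  then show ?thesis unfolding m_def[symmetric]
    by (rule Lim_transform_eventually) (use q in \<open>auto simp: eventually_sequentially intro!: exI[of _ 1]\<close>)
qed

section \<open>Martingale increments in a filtered probability space\<close>

locale usual_prob_space = prob_space M for M :: "'a measure" +
  fixes F :: "real \<Rightarrow> 'a measure"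
  assumes usual: "usual_filtration M F"
begin

lemma space_F [simp]: "space (F t) = space M"
  using usual by (auto simp: usual_filtration_def subalgebra_def)

lemma sets_F_mono: "s \<le> t \<Longrightarrow> sets (F s) \<subseteq> sets (F t)"
  using usual filtration.sets_F_mono[of "space M" F s t] by (auto simp: usual_filtration_def)

lemma subalgebra_F: "subalgebra M (F t)"
  using usual by (auto simp: usual_filtration_def)

lemma sets_F_M: "A \<in> sets (F t) \<Longrightarrow> A \<in> sets M"
  using subalgebra_F[of t] by (auto simp: subalgebra_def)

lemma measurable_F_mono: "f \<in> measurable (F s) N \<Longrightarrow> s \<le> t \<Longrightarrow> f \<in> measurable (F t) N"
  using sets_F_mono[of s t] by (auto simp: measurable_def)

lemma measurable_F_M: "f \<in> measurable (F s) N \<Longrightarrow> f \<in> measurable M N"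
  by (rule measurable_from_subalg[OF subalgebra_F])

lemma integrable_bounded:
  fixes f :: "'a \<Rightarrow> real"
  assumes "f \<in> borel_measurable M" "\<And>\<omega>. \<omega> \<in> space M \<Longrightarrow> \<bar>f \<omega>\<bar> \<le> K"
  shows "integrable M f"
  using assms by (intro integrable_const_bound[where B=K]) auto

lemma integrable_bounded_mult:
  fixes f g :: "'a \<Rightarrow> real"
  assumes "f \<in> borel_measurable M" "\<And>\<omega>. \<omega> \<in> space M \<Longrightarrow> \<bar>f \<omega>\<bar> \<le> K" "integrable M g"
  shows "integrable M (\<lambda>\<omega>. f \<omega> * g \<omega>)"
proof (rule Bochner_Integration.integrable_bound)
  show "integrable M (\<lambda>\<omega>. K * g \<omega>)" using assms by simp
  show "AE \<omega> in M. norm (f \<omega> * g \<omega>) \<le> norm (K * g \<omega>)"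
  proof (rule AE_I2)
    fix \<omega> assume "\<omega> \<in> space M"
    from assms(2)[OF this] have "\<bar>f \<omega>\<bar> \<le> \<bar>K\<bar>" by linarith
    then show "norm (f \<omega> * g \<omega>) \<le> norm (K * g \<omega>)" by (simp add: abs_mult mult_right_mono)
  qed
qed (use assms in auto)

text \<open>The form in which the martingale property is used throughout: an increment tested
  against a bounded weight known at its left end. Conditional expectations enter the argument only
  here.\<close>

lemma martingale_increment:
  assumes X: "martingale M F X" and st: "0 \<le> s" "s \<le> t"
    and \<eta>: "\<eta> \<in> borel_measurable (F s)" "\<And>\<omega>. \<omega> \<in> space M \<Longrightarrow> \<bar>\<eta> \<omega>\<bar> \<le> K"
  shows "integrable M (\<lambda>\<omega>. \<eta> \<omega> * (X t \<omega> - X s \<omega>))" "(\<integral>\<omega>. \<eta> \<omega> * (X t \<omega> - X s \<omega>) \<partial>M) = 0"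
proof -
  interpret sub: finite_measure_subalgebra M "F s"
    using subalgebra_F by unfold_locales
  have int: "integrable M (X t)" "integrable M (X s)" using X st by (auto simp: martingale_def)
  have \<eta>M: "\<eta> \<in> borel_measurable M" using \<eta>(1) by (rule measurable_F_M)
  have i1: "integrable M (\<lambda>\<omega>. \<eta> \<omega> * X t \<omega>)" "integrable M (\<lambda>\<omega>. \<eta> \<omega> * X s \<omega>)"
    by (rule integrable_bounded_mult[OF \<eta>M \<eta>(2)]; use int in simp)+
  show "integrable M (\<lambda>\<omega>. \<eta> \<omega> * (X t \<omega> - X s \<omega>))"
    using Bochner_Integration.integrable_diff[OF i1] by (simp add: algebra_simps)
  have "(\<integral>\<omega>. \<eta> \<omega> * X t \<omega> \<partial>M) = (\<integral>\<omega>. \<eta> \<omega> * real_cond_exp M (F s) (X t) \<omega> \<partial>M)"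
    using sub.real_cond_exp_intg(2)[OF i1(1) \<eta>(1)] int by auto
  also have "\<dots> = (\<integral>\<omega>. \<eta> \<omega> * X s \<omega> \<partial>M)"
  proof (rule integral_cong_AE)
    have "AE \<omega> in M. real_cond_exp M (F s) (X t) \<omega> = X s \<omega>" using X st by (simp add: martingale_def)
    then show "AE \<omega> in M. \<eta> \<omega> * real_cond_exp M (F s) (X t) \<omega> = \<eta> \<omega> * X s \<omega>" by eventually_elim simp
  qed (use \<eta>M int in auto)
  finally show "(\<integral>\<omega>. \<eta> \<omega> * (X t \<omega> - X s \<omega>) \<partial>M) = 0"
    using i1 by (simp add: right_diff_distrib)
qed

text \<open>Only events \<open>u < \<tau>\<close> at grid times \<open>u \<le> t\<close> enter the
  stopped sums of \<open>grid_stop_sum\<close>, so these sums are known at time \<open>t\<close>,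
  and so is their limit.\<close>

lemma stopped_measurable:
  assumes X: "adapted_process F X" "continuous_paths M X"
    and \<tau>: "\<And>u. 0 \<le> u \<Longrightarrow> {\<omega>\<in>space M. u < \<tau> \<omega>} \<in> sets (F u)"
    and \<tau>0: "\<And>\<omega>. \<omega> \<in> space M \<Longrightarrow> 0 \<le> \<tau> \<omega>" and t: "0 \<le> t"
  shows "(\<lambda>\<omega>. X (min t (\<tau> \<omega>)) \<omega>) \<in> borel_measurable (F t)"
proof -
  have Xm: "X u \<in> borel_measurable (F t)" if "0 \<le> u" "u \<le> t" for u
    using X(1) that by (auto simp: adapted_process_def intro: measurable_F_mono)
  let ?g = "\<lambda>n j. 0 + (t - 0) * real j / real n"
  have gt: "0 \<le> ?g n j" "?g n j \<le> t" if "j \<le> n" for n j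
  proof -
    show "0 \<le> ?g n j" using t by simp
    have "t * real j \<le> t * real n" using that t by (intro mult_left_mono) auto
    then show "?g n j \<le> t" using t by (auto simp: divide_le_eq)
  qed
  let ?S = "\<lambda>n \<omega>. \<Sum>j<n. if ?g n j < \<tau> \<omega> then X (?g n (Suc j)) \<omega> - X (?g n j) \<omega> else 0"
  have 1: "?S n \<in> borel_measurable (F t)" for n
  proof (rule borel_measurable_sum)
    fix j assume j: "j \<in> {..<n}"
    have "{\<omega> \<in> space (F t). ?g n j < \<tau> \<omega>} \<in> sets (F t)"
      using \<tau>[OF gt(1), of j n] sets_F_mono[OF gt(2), of j n] j by auto
    then show "(\<lambda>\<omega>. if ?g n j < \<tau> \<omega> then X (?g n (Suc j)) \<omega> - X (?g n j) \<omega> else 0) \<in> borel_measurable (F t)"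
      using j gt[of j n] gt[of "Suc j" n]
      by (intro measurable_If borel_measurable_diff Xm borel_measurable_const) auto
  qed
  have 2: "(\<lambda>n. ?S n \<omega>) \<longlonglongrightarrow> X (min t (\<tau> \<omega>)) \<omega> - X 0 \<omega>" if "\<omega> \<in> space M" for \<omega>
  proof -
    have c: "continuous_on {0..} (\<lambda>u. X u \<omega>)" using X(2) that by (auto simp: continuous_paths_def)
    have "max 0 (min t (\<tau> \<omega>)) = min t (\<tau> \<omega>)" using t \<tau>0[OF that] by simp
    then show ?thesis using grid_stop_sum[OF c order_refl t, of "\<tau> \<omega>"] by simp
  qed
  have "(\<lambda>\<omega>. X (min t (\<tau> \<omega>)) \<omega> - X 0 \<omega>) \<in> borel_measurable (F t)"
    by (rule borel_measurable_LIMSEQ_real[of "F t" ?S, OF _ 1]) (simp only: space_F 2)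
  from borel_measurable_add[OF this Xm[of 0]] show ?thesis using t by simp
qed

text \<open>The overshoot of the discretised stopping is controlled by testing the increment
  \<open>X t - X s\<close> itself against the event that the discretely stopped increment exceeds a level
  which the continuously stopped one does not reach.\<close>

lemma optional_stopping:
  assumes X: "martingale M F X" "continuous_paths M X"
    and \<tau>: "\<And>u. 0 \<le> u \<Longrightarrow> {\<omega>\<in>space M. u < \<tau> \<omega>} \<in> sets (F u)"
    and \<tau>0: "\<And>\<omega>. \<omega> \<in> space M \<Longrightarrow> 0 \<le> \<tau> \<omega>"
    and bound: "\<And>\<omega> u. \<omega> \<in> space M \<Longrightarrow> 0 \<le> u \<Longrightarrow> \<bar>X (min u (\<tau> \<omega>)) \<omega> - X 0 \<omega>\<bar> \<le> K"
    and st: "0 \<le> s" "s \<le> t"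
    and \<eta>: "\<eta> \<in> borel_measurable (F s)" "\<And>\<omega>. \<omega> \<in> space M \<Longrightarrow> \<bar>\<eta> \<omega>\<bar> \<le> C"
  shows "(\<integral>\<omega>. \<eta> \<omega> * (X (min t (\<tau> \<omega>)) \<omega> - X (min s (\<tau> \<omega>)) \<omega>) \<partial>M) = 0"
proof -
  define g where "g n j = s + (t - s) * real j / real n" for n j :: nat
  have gs: "s \<le> g n j" for n j using st by (simp add: g_def)
  have g0: "0 \<le> g n j" for n j using gs[of n j] st by simp
  have gt: "g n j \<le> t" if "j \<le> n" for n j
  proof -
    have "(t - s) * real j \<le> (t - s) * real n" using that st by (intro mult_left_mono) auto
    then have "(t - s) * real j / real n \<le> t - s" using st by (auto simp add: divide_le_eq)
    then show ?thesis by (simp add: g_def)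
  qed
  have gmono: "g n i \<le> g n j" if "i \<le> j" for i j n
    using that st by (auto simp: g_def intro!: divide_right_mono mult_left_mono)
  define d where "d n j \<omega> = X (g n (Suc j)) \<omega> - X (g n j) \<omega>" for n j \<omega>
  define a where "a n j \<omega> = (if g n j < \<tau> \<omega> then 1 else 0::real)" for n j \<omega>
  define \<xi> where "\<xi> n k \<omega> = (\<Sum>j<k. a n j \<omega> * d n j \<omega>)" for n k \<omega>
  define \<zeta> where "\<zeta> \<omega> = X (min t (\<tau> \<omega>)) \<omega> - X (min s (\<tau> \<omega>)) \<omega>" for \<omega>
  define P where "P \<omega> = X t \<omega> - X s \<omega>" for \<omega>
  \<comment> \<open>Both stopped values lie within \<open>K\<close> of the start, so they differ by
    at most \<open>2 * K\<close>. The added \<open>1\<close> makes the inequality strict, so that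
    the convergent discrete sums eventually stay below the level.\<close>
  define c where "c = 2 * K + 1"
  have am: "a n j \<in> borel_measurable (F u)" if "g n j \<le> u" for n j u
    using \<tau>[OF g0[of n j]] sets_F_mono[OF that] unfolding a_def
    by (intro measurable_If) auto
  have Xm: "X u \<in> borel_measurable (F v)" if "0 \<le> u" "u \<le> v" for u v
    using X(1) that by (auto simp: adapted_process_def martingale_def intro: measurable_F_mono)
  have dm: "d n j \<in> borel_measurable (F u)" if "g n (Suc j) \<le> u" for n j u
    unfolding d_def using that gmono[of j "Suc j" n] by (intro borel_measurable_diff Xm g0) auto
  have \<xi>m: "\<xi> n k \<in> borel_measurable (F u)" if "g n k \<le> u" for n k u
    unfolding \<xi>_def
  proof (intro borel_measurable_sum borel_measurable_times am dm)
    fix j assume "j \<in> {..<k}"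
    then show "g n j \<le> u" "g n (Suc j) \<le> u" using gmono[of j k n] gmono[of "Suc j" k n] that by auto
  qed
  have Xint: "integrable M (X u)" if "0 \<le> u" for u using X(1) that by (auto simp: martingale_def)
  have dint: "integrable M (d n j)" for n j unfolding d_def by (intro Bochner_Integration.integrable_diff Xint g0)
  have a01: "\<bar>a n j \<omega>\<bar> \<le> 1" for n j \<omega> by (simp add: a_def)
  have orth: "(\<integral>\<omega>. \<eta>' \<omega> * d n j \<omega> \<partial>M) = 0" "integrable M (\<lambda>\<omega>. \<eta>' \<omega> * d n j \<omega>)"
    if "\<eta>' \<in> borel_measurable (F (g n j))" "\<And>\<omega>. \<omega> \<in> space M \<Longrightarrow> \<bar>\<eta>' \<omega>\<bar> \<le> C" for \<eta>' n j
    unfolding d_def using gmono[of j "Suc j" n]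
    by (intro martingale_increment[OF X(1) g0 _ that]; simp)+
  have C0: "0 \<le> C" using \<eta>(2) not_empty by (meson abs_ge_zero all_not_in_conv order_trans)
  have \<eta>m: "\<eta> \<in> borel_measurable (F (g n j))" for n j by (rule measurable_F_mono[OF \<eta>(1) gs])
  have \<eta>M: "\<eta> \<in> borel_measurable M" by (rule measurable_F_M[OF \<eta>(1)])
  have \<xi>M: "\<xi> n k \<in> borel_measurable M" for n k by (rule measurable_F_M[OF \<xi>m[OF order_refl]])
  have prodbound: "\<bar>\<eta> \<omega> * b\<bar> \<le> C" if "\<omega> \<in> space M" "\<bar>b\<bar> \<le> 1" for b \<omega>
    using mult_mono[OF \<eta>(2)[OF that(1)] that(2)] C0 by (simp add: abs_mult)
  have \<xi>conv: "(\<lambda>n. \<xi> n n \<omega>) \<longlonglongrightarrow> \<zeta> \<omega>" if \<omega>: "\<omega> \<in> space M" for \<omega>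
  proof -
    have c: "continuous_on {0..} (\<lambda>u. X u \<omega>)" using X(2) that by (auto simp: continuous_paths_def)
    have "X (max s (min t (\<tau> \<omega>))) \<omega> - X s \<omega> = \<zeta> \<omega>"
    proof (cases "\<tau> \<omega> \<le> s")
      case True then show ?thesis using st by (auto simp: \<zeta>_def min_def max_def)
    next
      case False then show ?thesis using st by (auto simp: \<zeta>_def min_def max_def)
    qed
    with grid_stop_sum[OF c st, of "\<tau> \<omega>"] show ?thesis
      by (simp add: \<xi>_def a_def d_def g_def if_distrib[of "\<lambda>x. x * _"] cong: if_cong)
  qed
  have \<zeta>K: "\<bar>\<zeta> \<omega>\<bar> < c" if "\<omega> \<in> space M" for \<omega>
    using bound[OF that st(1)] bound[OF that, of t] st by (auto simp: \<zeta>_def c_def)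
  have e1: "(\<integral>\<omega>. \<eta> \<omega> * \<xi> n n \<omega> \<partial>M) = 0" "integrable M (\<lambda>\<omega>. \<eta> \<omega> * \<xi> n n \<omega>)" for n
  proof -
    have eq: "\<eta> \<omega> * \<xi> n n \<omega> = (\<Sum>j<n. (\<eta> \<omega> * a n j \<omega>) * d n j \<omega>)" for \<omega>
      by (simp add: \<xi>_def sum_distrib_left mult.assoc)
    have o: "(\<integral>\<omega>. (\<eta> \<omega> * a n j \<omega>) * d n j \<omega> \<partial>M) = 0" "integrable M (\<lambda>\<omega>. (\<eta> \<omega> * a n j \<omega>) * d n j \<omega>)" for j
      by (rule orth; use \<eta>m am prodbound a01 in \<open>auto intro!: borel_measurable_times\<close>)+
    show "(\<integral>\<omega>. \<eta> \<omega> * \<xi> n n \<omega> \<partial>M) = 0" "integrable M (\<lambda>\<omega>. \<eta> \<omega> * \<xi> n n \<omega>)"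
      unfolding eq using o by (simp_all add: Bochner_Integration.integral_sum)
  qed
  define big where "big n \<omega> = (if c < \<bar>\<xi> n n \<omega>\<bar> then 1 else 0::real)" for n \<omega>
  have bigM: "big n \<in> borel_measurable M" for n unfolding big_def using \<xi>M[of n n] by measurable
  have Pint: "integrable M P" unfolding P_def using st by (intro Bochner_Integration.integrable_diff Xint) auto
  have e2: "(\<integral>\<omega>. \<eta> \<omega> * big n \<omega> * \<xi> n n \<omega> \<partial>M) = (\<integral>\<omega>. \<eta> \<omega> * big n \<omega> * P \<omega> \<partial>M)" if n: "n > 0" for n
  proof -
    have Psum: "P \<omega> = (\<Sum>j<n. d n j \<omega>)" for \<omega>
    proof -
      have "(\<Sum>j<n. d n j \<omega>) = X (g n n) \<omega> - X (g n 0) \<omega>"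
        unfolding d_def by (rule sum_lessThan_telescope)
      then show ?thesis using n by (simp add: P_def g_def)
    qed
    define b where "b j \<omega> = (if c < \<bar>\<xi> n j \<omega>\<bar> then 1 else 0::real)" for j \<omega>
    \<comment> \<open>An index \<open>j\<close> with \<open>1 - a n j \<omega>\<close> nonzero lies
      past the stopping, where the sum no longer changes. There the event in \<open>big n\<close> is
      already decided at time \<open>g n j\<close>, so the increment \<open>d n j\<close> integrates
      to \<open>0\<close> against it.\<close>
    have \<xi>stop: "\<xi> n n \<omega> = \<xi> n j \<omega>" if "j \<le> n" "\<not> g n j < \<tau> \<omega>" for j \<omega>
    proof -
      have "a n i \<omega> = 0" if "i \<in> {..<n} - {..<j}" for i
        using gmono[of j i n] that \<open>\<not> g n j < \<tau> \<omega>\<close> by (auto simp: a_def)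
      then show ?thesis unfolding \<xi>_def using \<open>j \<le> n\<close>
        by (intro sum.mono_neutral_right) auto
    qed
    have eq: "\<eta> \<omega> * big n \<omega> * P \<omega> = \<eta> \<omega> * big n \<omega> * \<xi> n n \<omega> + (\<Sum>j<n. (\<eta> \<omega> * (b j \<omega> * (1 - a n j \<omega>))) * d n j \<omega>)" for \<omega>
    proof -
      have "\<eta> \<omega> * big n \<omega> * P \<omega> - \<eta> \<omega> * big n \<omega> * \<xi> n n \<omega> = (\<Sum>j<n. \<eta> \<omega> * big n \<omega> * (1 - a n j \<omega>) * d n j \<omega>)"
        unfolding Psum \<xi>_def by (simp add: sum_distrib_left sum_subtractf[symmetric] algebra_simps)
      also have "\<dots> = (\<Sum>j<n. (\<eta> \<omega> * (b j \<omega> * (1 - a n j \<omega>))) * d n j \<omega>)"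
      proof (rule sum.cong)
        fix j assume "j \<in> {..<n}"
        then have "a n j \<omega> = 1 \<or> big n \<omega> = b j \<omega>"
          using \<xi>stop[of j \<omega>] by (auto simp: a_def big_def b_def)
        then show "\<eta> \<omega> * big n \<omega> * (1 - a n j \<omega>) * d n j \<omega> = \<eta> \<omega> * (b j \<omega> * (1 - a n j \<omega>)) * d n j \<omega>"
          by auto
      qed simp
      finally show ?thesis by simp
    qed
    have o: "(\<integral>\<omega>. (\<eta> \<omega> * (b j \<omega> * (1 - a n j \<omega>))) * d n j \<omega> \<partial>M) = 0"
      "integrable M (\<lambda>\<omega>. (\<eta> \<omega> * (b j \<omega> * (1 - a n j \<omega>))) * d n j \<omega>)" for j
    proof -
      have "b j \<in> borel_measurable (F (g n j))" unfolding b_def using \<xi>m[of n j "g n j"] by measurable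
      then have 1: "(\<lambda>\<omega>. \<eta> \<omega> * (b j \<omega> * (1 - a n j \<omega>))) \<in> borel_measurable (F (g n j))"
        using \<eta>m am[of n j] by (intro borel_measurable_times borel_measurable_diff) auto
      have 2: "\<bar>\<eta> \<omega> * (b j \<omega> * (1 - a n j \<omega>))\<bar> \<le> C" if "\<omega> \<in> space M" for \<omega>
        using that by (intro prodbound) (auto simp: a_def b_def)
      show "(\<integral>\<omega>. (\<eta> \<omega> * (b j \<omega> * (1 - a n j \<omega>))) * d n j \<omega> \<partial>M) = 0"
        "integrable M (\<lambda>\<omega>. (\<eta> \<omega> * (b j \<omega> * (1 - a n j \<omega>))) * d n j \<omega>)"
        by (rule orth[OF 1 2]; assumption)+
    qed
    have i: "integrable M (\<lambda>\<omega>. \<eta> \<omega> * big n \<omega> * \<xi> n n \<omega>)"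
      using integrable_bounded_mult[OF bigM _ e1(2), of n 1 n] by (auto simp: big_def mult_ac)
    show ?thesis unfolding eq using i o by (simp add: Bochner_Integration.integral_sum)
  qed
  have ev_small: "\<forall>\<^sub>F n in sequentially. big n \<omega> = 0" if "\<omega> \<in> space M" for \<omega>
  proof -
    have "(\<lambda>n. \<bar>\<xi> n n \<omega>\<bar>) \<longlonglongrightarrow> \<bar>\<zeta> \<omega>\<bar>" by (intro tendsto_intros \<xi>conv that)
    from order_tendstoD(2)[OF this \<zeta>K[OF that]] show ?thesis by eventually_elim (auto simp: big_def)
  qed
  have ZM: "\<zeta> \<in> borel_measurable M"
    by (rule borel_measurable_LIMSEQ_real[of M "\<lambda>n. \<xi> n n"]) (use \<xi>conv \<xi>M in auto)
  \<comment> \<open>This is the gain from exchanging the stopped sum for \<open>P\<close> on the bad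
    event: one integrable variable dominates for all \<open>n\<close>.\<close>
  have l1: "(\<lambda>n. \<integral>\<omega>. \<eta> \<omega> * big n \<omega> * P \<omega> \<partial>M) \<longlonglongrightarrow> (\<integral>\<omega>. 0 \<partial>M)"
  proof (rule integral_dominated_convergence[where w="\<lambda>\<omega>. C * \<bar>P \<omega>\<bar>"])
    show "AE \<omega> in M. (\<lambda>n. \<eta> \<omega> * big n \<omega> * P \<omega>) \<longlonglongrightarrow> 0"
    proof (rule AE_I2)
      fix \<omega> assume "\<omega> \<in> space M"
      from ev_small[OF this] show "(\<lambda>n. \<eta> \<omega> * big n \<omega> * P \<omega>) \<longlonglongrightarrow> 0"
        by (intro tendsto_eventually) (auto elim: eventually_mono)
    qed
    show "AE \<omega> in M. norm (\<eta> \<omega> * big n \<omega> * P \<omega>) \<le> C * \<bar>P \<omega>\<bar>" for n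
    proof (rule AE_I2)
      fix \<omega> assume "\<omega> \<in> space M"
      then have "\<bar>\<eta> \<omega> * big n \<omega>\<bar> \<le> C" by (rule prodbound) (simp add: big_def)
      then show "norm (\<eta> \<omega> * big n \<omega> * P \<omega>) \<le> C * \<bar>P \<omega>\<bar>"
        by (simp add: abs_mult[of _ "P \<omega>"] mult_right_mono)
    qed
  qed (use Pint \<eta>M bigM in \<open>auto intro!: borel_measurable_times\<close>)
  have l2: "(\<lambda>n. \<integral>\<omega>. \<eta> \<omega> * ((1 - big n \<omega>) * \<xi> n n \<omega>) \<partial>M) \<longlonglongrightarrow> (\<integral>\<omega>. \<eta> \<omega> * \<zeta> \<omega> \<partial>M)"
  proof (rule integral_dominated_convergence[where w="\<lambda>\<omega>. C * \<bar>c\<bar>"])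
    show "AE \<omega> in M. (\<lambda>n. \<eta> \<omega> * ((1 - big n \<omega>) * \<xi> n n \<omega>)) \<longlonglongrightarrow> \<eta> \<omega> * \<zeta> \<omega>"
    proof (rule AE_I2)
      fix \<omega> assume w: "\<omega> \<in> space M"
      have "(\<lambda>n. 1 - big n \<omega>) \<longlonglongrightarrow> 1"
        using ev_small[OF w] by (intro tendsto_eventually) (auto elim: eventually_mono)
      from tendsto_mult[OF tendsto_const tendsto_mult[OF this \<xi>conv[OF w]]]
      show "(\<lambda>n. \<eta> \<omega> * ((1 - big n \<omega>) * \<xi> n n \<omega>)) \<longlonglongrightarrow> \<eta> \<omega> * \<zeta> \<omega>" by simp
    qed
    show "AE \<omega> in M. norm (\<eta> \<omega> * ((1 - big n \<omega>) * \<xi> n n \<omega>)) \<le> C * \<bar>c\<bar>" for n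
      using \<eta>(2) C0 by (intro AE_I2) (auto simp: abs_mult big_def intro!: mult_mono)
  qed (use ZM \<eta>M bigM \<xi>M in \<open>auto intro!: borel_measurable_times borel_measurable_diff\<close>)
  have "(\<integral>\<omega>. \<eta> \<omega> * ((1 - big n \<omega>) * \<xi> n n \<omega>) \<partial>M) = - (\<integral>\<omega>. \<eta> \<omega> * big n \<omega> * P \<omega> \<partial>M)" if "n > 0" for n
  proof -
    have i: "integrable M (\<lambda>\<omega>. \<eta> \<omega> * big n \<omega> * \<xi> n n \<omega>)"
      using integrable_bounded_mult[OF bigM _ e1(2), of n 1 n] by (auto simp: big_def mult_ac)
    have "(\<lambda>\<omega>. \<eta> \<omega> * ((1 - big n \<omega>) * \<xi> n n \<omega>)) = (\<lambda>\<omega>. \<eta> \<omega> * \<xi> n n \<omega> - \<eta> \<omega> * big n \<omega> * \<xi> n n \<omega>)"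
      by (simp add: algebra_simps)
    then show ?thesis using e1[of n] i e2[OF that] by simp
  qed
  then have "(\<lambda>n. \<integral>\<omega>. \<eta> \<omega> * ((1 - big n \<omega>) * \<xi> n n \<omega>) \<partial>M) \<longlonglongrightarrow> - (\<integral>\<omega>. 0 \<partial>M)"
    by (intro Lim_transform_eventually[OF tendsto_minus[OF l1]]) (auto simp: eventually_sequentially intro!: exI[of _ 1])
  with l2 have "(\<integral>\<omega>. \<eta> \<omega> * \<zeta> \<omega> \<partial>M) = - (\<integral>\<omega>. 0 \<partial>M)" by (rule LIMSEQ_unique)
  then show ?thesis by (simp add: \<zeta>_def)
qed

text \<open>The squares of \<open>D\<close> are compared with those of \<open>U\<close> only path by path and on \<open>B\<close>. Switching the
  transform off as soon as the comparison fails costs a single overshoot, which vanishes in the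
  limit, so that Fatou's lemma turns the comparison into one of second moments.\<close>

lemma truncated_transform_bound:
  fixes D U :: "nat \<Rightarrow> nat \<Rightarrow> 'a \<Rightarrow> real" and s :: "nat \<Rightarrow> nat \<Rightarrow> real"
  assumes s_mono: "\<And>n j k. j \<le> k \<Longrightarrow> s n j \<le> s n k"
    and Dm: "\<And>n k. k < n \<Longrightarrow> D n k \<in> borel_measurable (F (s n (Suc k)))"
    and Um: "\<And>n k. k < n \<Longrightarrow> U n k \<in> borel_measurable (F (s n (Suc k)))"
    and DK: "\<And>n k \<omega>. k < n \<Longrightarrow> \<omega> \<in> space M \<Longrightarrow> \<bar>D n k \<omega>\<bar> \<le> K"
    and orth: "\<And>n k \<eta> C. k < n \<Longrightarrow> \<eta> \<in> borel_measurable (F (s n k)) \<Longrightarrow>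
        (\<And>\<omega>. \<omega> \<in> space M \<Longrightarrow> \<bar>\<eta> \<omega>\<bar> \<le> C) \<Longrightarrow> (\<integral>\<omega>. \<eta> \<omega> * D n k \<omega> \<partial>M) = 0"
    and Ui: "\<And>n k. k < n \<Longrightarrow> integrable M (\<lambda>\<omega>. (U n k \<omega>)\<^sup>2)"
    and Uc: "\<And>n. (\<Sum>k<n. \<integral>\<omega>. (U n k \<omega>)\<^sup>2 \<partial>M) \<le> c"
    and small: "\<And>\<omega> \<epsilon>. \<omega> \<in> space M \<Longrightarrow> \<epsilon> > 0 \<Longrightarrow> \<forall>\<^sub>F n in sequentially. \<forall>k<n. \<bar>D n k \<omega>\<bar> \<le> \<epsilon>"
    and B: "AE \<omega> in M. \<omega> \<in> B \<longrightarrow>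
        (\<forall>\<^sub>F n in sequentially. \<forall>k\<le>n. (\<Sum>j<k. (D n j \<omega>)\<^sup>2 - 2 * (U n j \<omega>)\<^sup>2) \<le> 1)"
  shows "(\<integral>\<^sup>+\<omega>. indicator B \<omega> * liminf (\<lambda>n. ennreal ((\<Sum>k<n. D n k \<omega>)\<^sup>2)) \<partial>M) \<le> ennreal (2 * c + 1)"
proof -
  define K' where "K' = \<bar>K\<bar>"
  have K'0: "0 \<le> K'" by (simp add: K'_def)
  have DK': "\<bar>D n k \<omega>\<bar> \<le> K'" if "k < n" "\<omega> \<in> space M" for n k \<omega>
    using DK[OF that] by (simp add: K'_def)
  \<comment> \<open>The switch at step \<open>k\<close> looks only at increments before that step.
    It is therefore known at time \<open>s n k\<close>, and the switched transform keeps its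
    orthogonality.\<close>
  define H where "H n k \<omega> = (if \<forall>m\<le>k. (\<Sum>j<m. (D n j \<omega>)\<^sup>2 - 2 * (U n j \<omega>)\<^sup>2) \<le> 1 then 1 else 0::real)" for n k \<omega>
  define G where "G n m \<omega> = (\<Sum>k<m. H n k \<omega> * D n k \<omega>)" for n m \<omega>
  define mx where "mx n \<omega> = Max ((\<lambda>k. if k < n then \<bar>D n k \<omega>\<bar> else 0) ` {..n})" for n \<omega>
  have H01: "H n k \<omega> = 0 \<or> H n k \<omega> = 1" for n k \<omega> by (simp add: H_def)
  have DmM: "D n k \<in> borel_measurable M" "U n k \<in> borel_measurable M" if "k < n" for n k
    using Dm[OF that] Um[OF that] by (auto intro: measurable_F_M)
  have Dm': "D n j \<in> borel_measurable (F (s n k))" "U n j \<in> borel_measurable (F (s n k))" if "j < k" "k \<le> n" for n j k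
    using Dm[of j n] Um[of j n] that s_mono[of "Suc j" k n] by (auto intro: measurable_F_mono)
  have Hm: "H n k \<in> borel_measurable (F (s n k))" if k: "k \<le> n" for n k
  proof -
    have "(\<lambda>\<omega>. \<Sum>j<m. (D n j \<omega>)\<^sup>2 - 2 * (U n j \<omega>)\<^sup>2) \<in> borel_measurable (F (s n k))" if "m \<le> k" for m
      using that k by (intro borel_measurable_sum borel_measurable_diff borel_measurable_times borel_measurable_power Dm' borel_measurable_const) auto
    then have "Measurable.pred (F (s n k)) (\<lambda>\<omega>. (\<Sum>j<m. (D n j \<omega>)\<^sup>2 - 2 * (U n j \<omega>)\<^sup>2) \<le> 1)" if "m \<le> k" for m
      unfolding pred_def using that by (intro borel_measurable_le borel_measurable_const)
    then have "Measurable.pred (F (s n k)) (\<lambda>\<omega>. \<forall>m\<in>{..k}. (\<Sum>j<m. (D n j \<omega>)\<^sup>2 - 2 * (U n j \<omega>)\<^sup>2) \<le> 1)"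
      by (intro pred_intros_countable_bounded) auto
    then have "{\<omega> \<in> space (F (s n k)). \<forall>m\<le>k. (\<Sum>j<m. (D n j \<omega>)\<^sup>2 - 2 * (U n j \<omega>)\<^sup>2) \<le> 1} \<in> sets (F (s n k))"
      unfolding pred_def Ball_def atMost_iff .
    from measurable_If[OF borel_measurable_const borel_measurable_const this] show ?thesis
      unfolding H_def .
  qed
  have HM: "H n k \<in> borel_measurable M" if "k \<le> n" for n k using Hm[OF that] by (rule measurable_F_M)
  have Gm: "G n m \<in> borel_measurable (F (s n m))" if m: "m \<le> n" for n m
    unfolding G_def
  proof (intro borel_measurable_sum borel_measurable_times)
    fix k assume "k \<in> {..<m}"
    then show "H n k \<in> borel_measurable (F (s n m))" "D n k \<in> borel_measurable (F (s n m))"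
      using Hm[of k n] Dm'[of k m n] m s_mono[of k m n] by (auto intro: measurable_F_mono)
  qed
  have GM: "G n m \<in> borel_measurable M" if "m \<le> n" for n m using Gm[OF that] by (rule measurable_F_M)
  have GK: "\<bar>G n m \<omega>\<bar> \<le> real m * K'" if "m \<le> n" "\<omega> \<in> space M" for n m \<omega>
  proof -
    have "\<bar>G n m \<omega>\<bar> \<le> (\<Sum>k<m. \<bar>H n k \<omega> * D n k \<omega>\<bar>)" unfolding G_def by (rule sum_abs)
    also have "\<dots> \<le> (\<Sum>k<m. K')"
    proof (rule sum_mono)
      fix k assume "k \<in> {..<m}"
      then have "\<bar>D n k \<omega>\<bar> \<le> K'" using DK'[of k n \<omega>] that by auto
      then show "\<bar>H n k \<omega> * D n k \<omega>\<bar> \<le> K'" using H01[of n k \<omega>] K'0 by auto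
    qed
    finally show ?thesis by simp
  qed
  have sqb: "x\<^sup>2 \<le> y\<^sup>2" if "\<bar>x\<bar> \<le> y" for x y :: real using that abs_le_square_iff[of x y] by auto
  have Gi: "integrable M (\<lambda>\<omega>. (G n m \<omega>)\<^sup>2)" if "m \<le> n" for n m
    using GM[OF that] GK[OF that] by (intro integrable_bounded[where K="(real m * K')\<^sup>2"]) (auto intro!: sqb)
  have HDi: "integrable M (\<lambda>\<omega>. H n k \<omega> * (D n k \<omega>)\<^sup>2)" if "k < n" for n k
  proof (rule integrable_bounded[where K="K'\<^sup>2"])
    show "(\<lambda>\<omega>. H n k \<omega> * (D n k \<omega>)\<^sup>2) \<in> borel_measurable M"
      using HM[of k n] DmM[OF that] that by (intro borel_measurable_times borel_measurable_power) auto
    show "\<bar>H n k \<omega> * (D n k \<omega>)\<^sup>2\<bar> \<le> K'\<^sup>2" if "\<omega> \<in> space M" for \<omega>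
      using H01[of n k \<omega>] sqb[OF DK'[OF \<open>k < n\<close> that]] by auto
  qed
  \<comment> \<open>A discrete Ito isometry: the mixed term is an increment tested against the
    bounded, already known weight \<open>2 * G * H\<close>.\<close>
  have EG: "(\<integral>\<omega>. (G n m \<omega>)\<^sup>2 \<partial>M) = (\<integral>\<omega>. (\<Sum>k<m. H n k \<omega> * (D n k \<omega>)\<^sup>2) \<partial>M)" if "m \<le> n" for n m
    using that
  proof (induction m)
    case 0 then show ?case by (simp add: G_def)
  next
    case (Suc m)
    then have m: "m < n" by simp
    have GH: "(\<lambda>\<omega>. 2 * (G n m \<omega> * H n m \<omega>)) \<in> borel_measurable (F (s n m))"
      using Gm[of m n] Hm[of m n] m by (intro borel_measurable_times) auto
    have GHb: "\<bar>2 * (G n m \<omega> * H n m \<omega>)\<bar> \<le> 2 * (real m * K')" if "\<omega> \<in> space M" for \<omega>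
      using GK[of m n \<omega>] H01[of n m \<omega>] m that K'0 by auto
    have o: "(\<integral>\<omega>. 2 * (G n m \<omega> * H n m \<omega>) * D n m \<omega> \<partial>M) = 0" by (rule orth[OF m GH GHb])
    have oi: "integrable M (\<lambda>\<omega>. 2 * (G n m \<omega> * H n m \<omega>) * D n m \<omega>)"
      by (rule integrable_bounded_mult[OF measurable_F_M[OF GH] GHb integrable_bounded[OF DmM(1)[OF m] DK'[OF m]]])
    have sq: "(G n (Suc m) \<omega>)\<^sup>2 = ((G n m \<omega>)\<^sup>2 + 2 * (G n m \<omega> * H n m \<omega>) * D n m \<omega>) + H n m \<omega> * (D n m \<omega>)\<^sup>2" for \<omega>
      using H01[of n m \<omega>] by (auto simp: G_def power2_eq_square algebra_simps)
    have "(\<integral>\<omega>. (G n (Suc m) \<omega>)\<^sup>2 \<partial>M) = (\<integral>\<omega>. (G n m \<omega>)\<^sup>2 \<partial>M) + 0 + (\<integral>\<omega>. H n m \<omega> * (D n m \<omega>)\<^sup>2 \<partial>M)"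
      unfolding sq using oi o HDi[OF m] Gi[of m n] m by simp
    also have "(\<integral>\<omega>. (G n m \<omega>)\<^sup>2 \<partial>M) = (\<integral>\<omega>. (\<Sum>k<m. H n k \<omega> * (D n k \<omega>)\<^sup>2) \<partial>M)" using Suc by simp
    finally have "(\<integral>\<omega>. (G n (Suc m) \<omega>)\<^sup>2 \<partial>M)
        = (\<integral>\<omega>. (\<Sum>k<m. H n k \<omega> * (D n k \<omega>)\<^sup>2) \<partial>M) + (\<integral>\<omega>. H n m \<omega> * (D n m \<omega>)\<^sup>2 \<partial>M)" by simp
    also have "\<dots> = (\<integral>\<omega>. (\<Sum>k<Suc m. H n k \<omega> * (D n k \<omega>)\<^sup>2) \<partial>M)"
      unfolding sum.lessThan_Suc using m HDi
      by (intro Bochner_Integration.integral_add[symmetric] Bochner_Integration.integrable_sum) auto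
    finally show ?case .
  qed
  have mxle: "\<bar>D n k \<omega>\<bar> \<le> mx n \<omega>" if "k < n" for n k \<omega>
    unfolding mx_def by (rule Max_ge) (use that in force)+
  have mx0: "0 \<le> mx n \<omega>" for n \<omega> unfolding mx_def by (rule Max_ge) force+
  have mxup: "mx n \<omega> \<le> e" if "e \<ge> 0" "\<forall>k<n. \<bar>D n k \<omega>\<bar> \<le> e" for n \<omega> e
    unfolding mx_def using that by (subst Max_le_iff) auto
  \<comment> \<open>While the switch is on, all sums before the current step are at most
    \<open>1\<close>. The last active step adds at most one squared increment of \<open>D\<close>,
    and nothing follows it.\<close>
  have path: "(\<Sum>k<m. H n k \<omega> * ((D n k \<omega>)\<^sup>2 - 2 * (U n k \<omega>)\<^sup>2)) \<le> 1 + (mx n \<omega>)\<^sup>2" if "m \<le> n" for n m \<omega>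
    using that
  proof (induction m)
    case (Suc m)
    show ?case
    proof (cases "H n m \<omega> = 0")
      case True then show ?thesis using Suc by simp
    next
      case False
      then have le: "\<forall>l\<le>m. (\<Sum>j<l. (D n j \<omega>)\<^sup>2 - 2 * (U n j \<omega>)\<^sup>2) \<le> 1" by (auto simp: H_def split: if_splits)
      then have H1: "H n k \<omega> = 1" if "k \<le> m" for k using that by (auto simp: H_def)
      have "(\<Sum>k<m. H n k \<omega> * ((D n k \<omega>)\<^sup>2 - 2 * (U n k \<omega>)\<^sup>2)) = (\<Sum>j<m. (D n j \<omega>)\<^sup>2 - 2 * (U n j \<omega>)\<^sup>2)"
        by (rule sum.cong) (auto simp: H1)
      also have "\<dots> \<le> 1" using le by simp
      finally have 1: "(\<Sum>k<m. H n k \<omega> * ((D n k \<omega>)\<^sup>2 - 2 * (U n k \<omega>)\<^sup>2)) \<le> 1" .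
      have "(D n m \<omega>)\<^sup>2 \<le> (mx n \<omega>)\<^sup>2" using mxle[of m n \<omega>] Suc.prems by (intro sqb) auto
      then have "(D n m \<omega>)\<^sup>2 - 2 * (U n m \<omega>)\<^sup>2 \<le> (mx n \<omega>)\<^sup>2" using zero_le_power2[of "U n m \<omega>"] by linarith
      with 1 show ?thesis by (simp add: H1)
    qed
  qed simp
  have mxM: "mx n \<in> borel_measurable M" for n
    unfolding mx_def
  proof (rule borel_measurable_Max)
    fix k show "(\<lambda>\<omega>. if k < n then \<bar>D n k \<omega>\<bar> else 0) \<in> borel_measurable M"
      using DmM(1)[of k n] by (cases "k < n") auto
  qed simp
  have mxK: "mx n \<omega> \<le> K'" if "\<omega> \<in> space M" for n \<omega> using DK' that K'0 by (intro mxup) auto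
  have mxi: "integrable M (\<lambda>\<omega>. (mx n \<omega>)\<^sup>2)" for n
    using mxM mxK mx0 by (intro integrable_bounded[where K="K'\<^sup>2"]) (auto intro!: power_mono)
  have mxlim: "(\<lambda>n. \<integral>\<omega>. (mx n \<omega>)\<^sup>2 \<partial>M) \<longlonglongrightarrow> (\<integral>\<omega>. 0 \<partial>M)"
  proof (rule integral_dominated_convergence[where w="\<lambda>_. K'\<^sup>2"])
    show "AE \<omega> in M. (\<lambda>n. (mx n \<omega>)\<^sup>2) \<longlonglongrightarrow> 0"
    proof (rule AE_I2)
      fix \<omega> assume w: "\<omega> \<in> space M"
      have "(\<lambda>n. mx n \<omega>) \<longlonglongrightarrow> 0"
      proof (rule order_tendstoI)
        fix a :: real assume "a < 0"
        then show "\<forall>\<^sub>F n in sequentially. a < mx n \<omega>" by (intro always_eventually allI less_le_trans[OF _ mx0])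
      next
        fix a :: real assume "0 < a"
        then have "\<forall>\<^sub>F n in sequentially. \<forall>k<n. \<bar>D n k \<omega>\<bar> \<le> a / 2" by (intro small w) simp
        then show "\<forall>\<^sub>F n in sequentially. mx n \<omega> < a"
        proof eventually_elim
          case (elim n)
          then have "mx n \<omega> \<le> a / 2" using \<open>0 < a\<close> by (intro mxup) auto
          then show ?case using \<open>0 < a\<close> by linarith
        qed
      qed
      from tendsto_power[OF this, of 2] show "(\<lambda>n. (mx n \<omega>)\<^sup>2) \<longlonglongrightarrow> 0" by simp
    qed
    show "AE \<omega> in M. norm ((mx n \<omega>)\<^sup>2) \<le> K'\<^sup>2" for n
      using mxK mx0 by (intro AE_I2) (auto intro!: power_mono)
  qed (use mxM in auto)
  \<comment> \<open>The switch is dropped from the squares of \<open>U\<close> before taking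
    expectations, so only their total mean, at most \<open>c\<close>, enters.\<close>
  have EGn: "(\<integral>\<omega>. (G n n \<omega>)\<^sup>2 \<partial>M) \<le> 2 * c + 1 + (\<integral>\<omega>. (mx n \<omega>)\<^sup>2 \<partial>M)" for n
  proof -
    have "(\<Sum>k<n. H n k \<omega> * (D n k \<omega>)\<^sup>2) \<le> 2 * (\<Sum>k<n. (U n k \<omega>)\<^sup>2) + (1 + (mx n \<omega>)\<^sup>2)" for \<omega>
    proof -
      have "(\<Sum>k<n. H n k \<omega> * (D n k \<omega>)\<^sup>2) = (\<Sum>k<n. H n k \<omega> * ((D n k \<omega>)\<^sup>2 - 2 * (U n k \<omega>)\<^sup>2)) + (\<Sum>k<n. H n k \<omega> * (2 * (U n k \<omega>)\<^sup>2))"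
        by (simp add: sum.distrib[symmetric] algebra_simps)
      also have "(\<Sum>k<n. H n k \<omega> * (2 * (U n k \<omega>)\<^sup>2)) \<le> (\<Sum>k<n. 2 * (U n k \<omega>)\<^sup>2)"
      proof (rule sum_mono)
        fix k show "H n k \<omega> * (2 * (U n k \<omega>)\<^sup>2) \<le> 2 * (U n k \<omega>)\<^sup>2"
          using H01[of n k \<omega>] by auto
      qed
      finally show ?thesis using path[of n n \<omega>] by (simp add: sum_distrib_left)
    qed
    then have "(\<integral>\<omega>. (\<Sum>k<n. H n k \<omega> * (D n k \<omega>)\<^sup>2) \<partial>M) \<le> (\<integral>\<omega>. 2 * (\<Sum>k<n. (U n k \<omega>)\<^sup>2) + (1 + (mx n \<omega>)\<^sup>2) \<partial>M)"
      using HDi Ui mxi by (intro integral_mono Bochner_Integration.integrable_sum Bochner_Integration.integrable_add Bochner_Integration.integrable_mult_right) auto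
    also have "\<dots> = 2 * (\<Sum>k<n. \<integral>\<omega>. (U n k \<omega>)\<^sup>2 \<partial>M) + (1 + (\<integral>\<omega>. (mx n \<omega>)\<^sup>2 \<partial>M))"
    proof -
      have i: "integrable M (\<lambda>\<omega>. \<Sum>k<n. (U n k \<omega>)\<^sup>2)" using Ui by (intro Bochner_Integration.integrable_sum) auto
      have "(\<integral>\<omega>. (\<Sum>k<n. (U n k \<omega>)\<^sup>2) \<partial>M) = (\<Sum>k<n. \<integral>\<omega>. (U n k \<omega>)\<^sup>2 \<partial>M)"
        using Ui by (intro Bochner_Integration.integral_sum) auto
      moreover have "(\<integral>\<omega>. 2 * (\<Sum>k<n. (U n k \<omega>)\<^sup>2) + (1 + (mx n \<omega>)\<^sup>2) \<partial>M)
          = (\<integral>\<omega>. 2 * (\<Sum>k<n. (U n k \<omega>)\<^sup>2) \<partial>M) + (\<integral>\<omega>. 1 + (mx n \<omega>)\<^sup>2 \<partial>M)"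
        using i mxi by (intro Bochner_Integration.integral_add) auto
      moreover have "(\<integral>\<omega>. 1 + (mx n \<omega>)\<^sup>2 \<partial>M) = 1 + (\<integral>\<omega>. (mx n \<omega>)\<^sup>2 \<partial>M)"
        using mxi by (simp add: prob_space)
      ultimately show ?thesis by (simp only: integral_mult_right_zero)
    qed
    finally show ?thesis using EG[of n n] Uc[of n] by simp
  qed
  have "(\<integral>\<^sup>+\<omega>. indicator B \<omega> * liminf (\<lambda>n. ennreal ((\<Sum>k<n. D n k \<omega>)\<^sup>2)) \<partial>M)
      \<le> (\<integral>\<^sup>+\<omega>. liminf (\<lambda>n. ennreal ((G n n \<omega>)\<^sup>2)) \<partial>M)"
  proof (rule nn_integral_mono_AE, use B in eventually_elim)
    case (elim \<omega>)
    show ?case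
    proof (cases "\<omega> \<in> B")
      case True
      with elim have "\<forall>\<^sub>F n in sequentially. \<forall>k\<le>n. (\<Sum>j<k. (D n j \<omega>)\<^sup>2 - 2 * (U n j \<omega>)\<^sup>2) \<le> 1" by blast
      then have "\<forall>\<^sub>F n in sequentially. ennreal ((\<Sum>k<n. D n k \<omega>)\<^sup>2) = ennreal ((G n n \<omega>)\<^sup>2)"
      proof eventually_elim
        case (elim n)
        then have "H n k \<omega> = 1" if "k < n" for k using that by (auto simp: H_def)
        then show ?case by (simp add: G_def)
      qed
      from Liminf_eq[OF this] True show ?thesis by simp
    qed simp
  qed
  also have "\<dots> \<le> liminf (\<lambda>n. \<integral>\<^sup>+\<omega>. ennreal ((G n n \<omega>)\<^sup>2) \<partial>M)"
    using GM by (intro nn_integral_liminf) auto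
  also have "\<dots> \<le> liminf (\<lambda>n. ennreal (2 * c + 1 + (\<integral>\<omega>. (mx n \<omega>)\<^sup>2 \<partial>M)))"
    using EGn Gi by (intro Liminf_mono always_eventually) (auto simp: nn_integral_eq_integral intro!: ennreal_leI)
  also have "\<dots> = ennreal (2 * c + 1)"
  proof (intro lim_imp_Liminf tendsto_ennrealI)
    show "(\<lambda>n. 2 * c + 1 + (\<integral>\<omega>. (mx n \<omega>)\<^sup>2 \<partial>M)) \<longlonglongrightarrow> 2 * c + 1"
      using tendsto_add[OF tendsto_const mxlim, of "2 * c + 1"] by simp
  qed simp
  finally show ?thesis .
qed

end

section \<open>Test functions and the martingale problem\<close>

text \<open>Truncated powers of order at least \<open>2\<close> are differentiable across their
  kink; all explicit test functions below are built from them.\<close>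

lemma has_real_derivative_pos_part_power:
  assumes n: "n \<ge> 2"
  shows "((\<lambda>x::real. (max 0 x) ^ n) has_real_derivative real n * (max 0 x) ^ (n - 1)) (at x)"
proof (cases x "0::real" rule: linorder_cases)
  case less
  have ev: "\<forall>\<^sub>F y in nhds x. 0 = (max 0 y) ^ n"
    using eventually_nhds_in_open[of "{..<0}" x] less n by (auto elim!: eventually_mono simp: max_def power_0_left)
  have "((\<lambda>x::real. 0) has_real_derivative 0) (at x)" by simp
  then have "((\<lambda>x::real. (max 0 x) ^ n) has_real_derivative 0) (at x)"
    by (rule DERIV_cong_ev[OF refl ev refl, THEN iffD1])
  then show ?thesis using less n by (simp add: power_0_left)
next
  case equal
  have "((\<lambda>h::real. ((max 0 h) ^ n) / h) \<longlongrightarrow> 0) (at 0)"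
  proof (rule tendsto_0_le[where K=1])
    have "((\<lambda>h::real. \<bar>h\<bar> ^ (n - 1)) \<longlongrightarrow> \<bar>0\<bar> ^ (n - 1)) (at 0)" by (intro tendsto_intros)
    then show "((\<lambda>h::real. \<bar>h\<bar> ^ (n - 1)) \<longlongrightarrow> 0) (at 0)" using n by (simp add: power_0_left)
    show "\<forall>\<^sub>F h::real in at 0. norm (max 0 h ^ n / h) \<le> norm (\<bar>h\<bar> ^ (n - 1)) * 1"
    proof (rule always_eventually, rule allI)
      fix h :: real
      have nn: "n = Suc (n - 1)" using n by simp
      show "norm (max 0 h ^ n / h) \<le> norm (\<bar>h\<bar> ^ (n - 1)) * 1"
        by (cases "h > 0"; subst nn) (auto simp: max_def abs_mult)
    qed
  qed
  then show ?thesis using equal n by (simp add: has_field_derivative_iff power_0_left)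
next
  case greater
  have ev: "\<forall>\<^sub>F y in nhds x. y ^ n = (max 0 y) ^ n"
    using eventually_nhds_in_open[of "{0<..}" x] greater by (auto elim!: eventually_mono simp: max_def)
  have "((\<lambda>x::real. x ^ n) has_real_derivative real n * x ^ (n - 1)) (at x)"
    by (auto intro!: derivative_eq_intros)
  then have "((\<lambda>x::real. (max 0 x) ^ n) has_real_derivative real n * x ^ (n - 1)) (at x)"
    by (rule DERIV_cong_ev[OF refl ev refl, THEN iffD1])
  then show ?thesis using greater by simp
qed

lemma has_real_derivative_pos_part_affine:
  assumes n: "n \<ge> 2"
  shows "((\<lambda>x::real. (max 0 (p + q * x)) ^ n) has_real_derivative
    real n * q * (max 0 (p + q * x)) ^ (n - 1)) (at x within S)"
proof -
  have "((\<lambda>x. p + q * x) has_real_derivative q) (at x within S)" by (auto intro!: derivative_eq_intros)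
  from DERIV_chain'[OF this has_real_derivative_pos_part_power[OF n]] show ?thesis
    by (simp add: mult_ac)
qed

lemma pos_part_shift_deriv:
  "n \<ge> 2 \<Longrightarrow> ((\<lambda>x::real. (max 0 (x - a)) ^ n) has_real_derivative real n * (max 0 (x - a)) ^ (n - 1)) (at x within S)"
  using has_real_derivative_pos_part_affine[of n "-a" 1 x S] by simp

lemma pos_part_scale_deriv:
  "n \<ge> 2 \<Longrightarrow> ((\<lambda>x::real. (max 0 (1 - x / d)) ^ n) has_real_derivative
    real n * (- 1 / d) * (max 0 (1 - x / d)) ^ (n - 1)) (at x within S)"
  using has_real_derivative_pos_part_affine[of n 1 "- 1 / d" x S] by simp

text \<open>The ramp is the identity near \<open>0\<close> and flat at \<open>l\<close>. Subtracting a corner of width \<open>d\<close>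
  makes its derivative vanish at \<open>0\<close> as well, without changing it on \<open>[d,l]\<close>. The spike has
  second derivative \<open>1\<close> at \<open>0\<close> and is supported in \<open>[0,d]\<close>.\<close>

definition ramp :: "real \<Rightarrow> real \<Rightarrow> real" where
  "ramp l x = x - 4 / (3 * l\<^sup>2) * (max 0 (x - l / 2)) ^ 3"
definition ramp1 :: "real \<Rightarrow> real \<Rightarrow> real" where
  "ramp1 l x = 1 - 4 / l\<^sup>2 * (max 0 (x - l / 2)) ^ 2"
definition ramp2 :: "real \<Rightarrow> real \<Rightarrow> real" where
  "ramp2 l x = - 8 / l\<^sup>2 * max 0 (x - l / 2)"

definition corner :: "real \<Rightarrow> real \<Rightarrow> real" where
  "corner d x = - d / 3 * (max 0 (1 - x / d)) ^ 3"
definition corner1 :: "real \<Rightarrow> real \<Rightarrow> real" where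
  "corner1 d x = (max 0 (1 - x / d)) ^ 2"
definition corner2 :: "real \<Rightarrow> real \<Rightarrow> real" where
  "corner2 d x = - 2 / d * max 0 (1 - x / d)"

definition spike :: "real \<Rightarrow> real \<Rightarrow> real" where
  "spike d x = - d\<^sup>2 * ((max 0 (1 - x / d)) ^ 3 / 3 - (max 0 (1 - x / d)) ^ 4 / 4)"
definition spike1 :: "real \<Rightarrow> real \<Rightarrow> real" where
  "spike1 d x = d * ((max 0 (1 - x / d)) ^ 2 - (max 0 (1 - x / d)) ^ 3)"
definition spike2 :: "real \<Rightarrow> real \<Rightarrow> real" where
  "spike2 d x = 3 * (max 0 (1 - x / d)) ^ 2 - 2 * max 0 (1 - x / d)"

lemma ramp_deriv: "(ramp l has_real_derivative ramp1 l x) (at x within S)"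
  unfolding ramp_def [abs_def]
  by (rule DERIV_cong[OF DERIV_diff[OF DERIV_ident DERIV_cmult[OF pos_part_shift_deriv]]])
     (auto simp: ramp1_def)

lemma ramp1_deriv: "(ramp1 l has_real_derivative ramp2 l x) (at x within S)"
  unfolding ramp1_def [abs_def]
  by (rule DERIV_cong[OF DERIV_diff[OF DERIV_const DERIV_cmult[OF pos_part_shift_deriv]]])
     (auto simp: ramp2_def)

lemma corner_deriv: "d > 0 \<Longrightarrow> (corner d has_real_derivative corner1 d x) (at x within S)"
  unfolding corner_def [abs_def]
  by (rule DERIV_cong[OF DERIV_cmult[OF pos_part_scale_deriv]]) (auto simp: corner1_def)

lemma corner1_deriv: "d > 0 \<Longrightarrow> (corner1 d has_real_derivative corner2 d x) (at x within S)"
  unfolding corner1_def [abs_def]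
  by (rule DERIV_cong[OF pos_part_scale_deriv]) (auto simp: corner2_def)

lemma spike_deriv: "d > 0 \<Longrightarrow> (spike d has_real_derivative spike1 d x) (at x within S)"
  unfolding spike_def [abs_def]
  by (rule DERIV_cong[OF DERIV_cmult[OF DERIV_diff[OF DERIV_cdivide[OF pos_part_scale_deriv]
        DERIV_cdivide[OF pos_part_scale_deriv]]]])
     (auto simp: spike1_def field_simps power2_eq_square)

lemma spike1_deriv: "d > 0 \<Longrightarrow> (spike1 d has_real_derivative spike2 d x) (at x within S)"
  unfolding spike1_def [abs_def]
  by (rule DERIV_cong[OF DERIV_cmult[OF DERIV_diff[OF pos_part_scale_deriv pos_part_scale_deriv]]])
     (auto simp: spike2_def field_simps)

lemma continuous_on_ramp:
  "continuous_on S (ramp l)" "continuous_on S (ramp1 l)" "continuous_on S (ramp2 l)"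
proof -
  show "continuous_on S (ramp l)" by (rule DERIV_continuous_on[OF ramp_deriv])
  show "continuous_on S (ramp1 l)" by (rule DERIV_continuous_on[OF ramp1_deriv])
  show "continuous_on S (ramp2 l)" unfolding ramp2_def by (intro continuous_intros)
qed

lemma continuous_on_corner2: "d > 0 \<Longrightarrow> continuous_on S (corner2 d)"
  unfolding corner2_def by (intro continuous_intros) auto

lemma continuous_on_spike2: "d > 0 \<Longrightarrow> continuous_on S (spike2 d)"
  unfolding spike2_def by (intro continuous_intros) auto

lemma ramp_near: "x \<le> l / 2 \<Longrightarrow> ramp l x = x"
  by (simp add: ramp_def)

lemma ramp1_0: "l > 0 \<Longrightarrow> ramp1 l 0 = 1"
  by (simp add: ramp1_def)

text \<open>The right end point fixes the coefficient in \<open>ramp1\<close>: the truncated term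
  equals \<open>l / 2\<close> there, and \<open>4 / l\<^sup>2\<close> is the inverse of its
  square.\<close>

lemma ramp1_l: "l > 0 \<Longrightarrow> ramp1 l l = 0"
  by (simp add: ramp1_def power2_eq_square)

lemma ramp_bounds:
  assumes l: "l > 0" and x: "x \<in> {0..l}"
  shows "0 \<le> ramp l x" "ramp l x \<le> l"
proof -
  have "0 \<le> 4 / (3 * l\<^sup>2) * (max 0 (x - l / 2)) ^ 3" by (intro mult_nonneg_nonneg) auto
  then show "ramp l x \<le> l" using x unfolding ramp_def atLeastAtMost_iff by linarith
  show "0 \<le> ramp l x"
  proof (cases "x \<le> l / 2")
    case True then show ?thesis using x by (simp add: ramp_near)
  next
    case False
    have "max 0 (x - l / 2) \<le> l / 2" using x l by (simp add: max_def)
    then have "(max 0 (x - l / 2)) ^ 3 \<le> (l / 2) ^ 3" by (intro power_mono) auto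
    then have "4 / (3 * l\<^sup>2) * (max 0 (x - l / 2)) ^ 3 \<le> 4 / (3 * l\<^sup>2) * (l / 2) ^ 3"
      using l by (intro mult_left_mono) auto
    also have "\<dots> = l / 6" using l by (simp add: power2_eq_square power3_eq_cube)
    finally show ?thesis using False l by (simp add: ramp_def)
  qed
qed

lemma pos_part_unit:
  assumes "d > 0" "x \<ge> 0"
  shows "0 \<le> max 0 (1 - x / d)" "max 0 (1 - x / d) \<le> (1::real)"
  using assms by auto

text \<open>The sign of \<open>corner2\<close> matters more than its size: it is of order
  \<open>1 / d\<close> and blows up as the corner shrinks, but with a fixed sign it can only help a
  one-sided estimate of the generator.\<close>

lemma corner_bounds:
  assumes d: "d > 0" "x \<ge> 0"
  shows "\<bar>corner d x\<bar> \<le> d" "0 \<le> corner1 d x" "corner1 d x \<le> 1" "corner2 d x \<le> 0"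
proof -
  note z = pos_part_unit[OF d]
  have "(max 0 (1 - x / d)) ^ 3 \<le> 1" using z by (intro power_le_one)
  then have "d * (max 0 (1 - x / d)) ^ 3 \<le> d * 1" using d by (intro mult_left_mono) auto
  moreover have "0 \<le> d * (max 0 (1 - x / d)) ^ 3" using d z by (intro mult_nonneg_nonneg) auto
  ultimately show "\<bar>corner d x\<bar> \<le> d" unfolding corner_def by (simp add: abs_le_iff)
  show "0 \<le> corner1 d x" "corner1 d x \<le> 1" unfolding corner1_def using z by (auto intro!: power_le_one)
  show "corner2 d x \<le> 0" unfolding corner2_def using d z by (auto intro!: divide_nonneg_pos)
qed

lemma corner_far:
  assumes d: "d > 0" "x \<ge> d"
  shows "corner d x = 0" "corner1 d x = 0" "corner2 d x = 0"
  using d by (auto simp: corner_def corner1_def corner2_def)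

lemma corner1_0: "corner1 d 0 = 1"
  by (simp add: corner1_def)

lemma spike_bounds:
  assumes d: "d > 0" "x \<ge> 0"
  shows "\<bar>spike d x\<bar> \<le> d\<^sup>2" "\<bar>spike1 d x\<bar> \<le> d" "\<bar>spike2 d x\<bar> \<le> 3"
proof -
  define z where "z = max 0 (1 - x / d)"
  have z: "0 \<le> z" "z \<le> 1" using pos_part_unit[OF d] by (auto simp: z_def)
  have p: "0 \<le> z ^ n" "z ^ n \<le> 1" for n using z by (auto intro: power_le_one)
  have "\<bar>z ^ 3 / 3 - z ^ 4 / 4\<bar> \<le> 1" using p[of 3] p[of 4] by linarith
  then have "d\<^sup>2 * \<bar>z ^ 3 / 3 - z ^ 4 / 4\<bar> \<le> d\<^sup>2 * 1" by (intro mult_left_mono) auto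
  then show "\<bar>spike d x\<bar> \<le> d\<^sup>2" by (simp add: spike_def z_def abs_mult)
  have "\<bar>z ^ 2 - z ^ 3\<bar> \<le> 1" using p[of 2] p[of 3] by linarith
  then have "d * \<bar>z ^ 2 - z ^ 3\<bar> \<le> d * 1" using d by (intro mult_left_mono) auto
  then show "\<bar>spike1 d x\<bar> \<le> d" using d by (simp add: spike1_def z_def abs_mult)
  show "\<bar>spike2 d x\<bar> \<le> 3" using p[of 2] z unfolding spike2_def z_def[symmetric] by linarith
qed

lemma spike_far:
  assumes d: "d > 0" "x \<ge> d"
  shows "spike1 d x = 0" "spike2 d x = 0"
  using d by (auto simp: spike1_def spike2_def)

lemma spike_0: "spike1 d 0 = 0" "spike2 d 0 = 1"
  by (auto simp: spike1_def spike2_def)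

text \<open>With \<open>z = 1 - x / d\<close>, the derivative \<open>d * (z\<^sup>2 - z ^ 3)\<close>
  vanishes at \<open>x = 0\<close> and \<open>x = d\<close>, and its double zero at
  \<open>x = d\<close> keeps the second derivative continuous. The spike itself is of order
  \<open>d\<^sup>2\<close>, although its second derivative at \<open>0\<close> does not
  shrink.\<close>

lemma neumann_spike:
  assumes "0 < d" "d \<le> l"
  shows "neumann_C2 l (spike d) (spike1 d) (spike2 d)"
  using assms by (auto simp: neumann_C2_def spike_deriv spike1_deriv continuous_on_spike2 spike_0 spike_far)

lemma neumann_ramp_corner:
  assumes "0 < d" "d \<le> l"
  shows "neumann_C2 l (\<lambda>x. ramp l x - corner d x) (\<lambda>x. ramp1 l x - corner1 d x) (\<lambda>x. ramp2 l x - corner2 d x)"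
  using assms unfolding neumann_C2_def
  by (auto intro!: DERIV_diff ramp_deriv ramp1_deriv corner_deriv corner1_deriv continuous_on_diff
      continuous_on_ramp continuous_on_corner2 simp: ramp1_0 corner1_0 ramp1_l corner_far)

text \<open>The derivative \<open>2 * ramp * ramp1\<close> vanishes at \<open>0\<close> because the
  ramp itself does, so the square meets the reflection condition that the ramp violates.\<close>

lemma neumann_ramp_square:
  assumes "0 < l"
  shows "neumann_C2 l (\<lambda>x. (ramp l x)\<^sup>2) (\<lambda>x. 2 * ramp l x * ramp1 l x)
    (\<lambda>x. 2 * (ramp1 l x)\<^sup>2 + 2 * ramp l x * ramp2 l x)"
  using assms unfolding neumann_C2_def
  by (auto intro!: derivative_eq_intros ramp_deriv ramp1_deriv continuous_intros continuous_on_ramp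
      simp: ramp1_l ramp_near power2_eq_square)

section \<open>Time integrals along a continuous path\<close>

lemma path_integral_diff:
  fixes \<phi> :: "real \<Rightarrow> real"
  assumes c: "continuous_on {0..} \<phi>" and st: "0 \<le> s" "s \<le> t"
  shows "(LINT u:{0..t}|lborel. \<phi> u) - (LINT u:{0..s}|lborel. \<phi> u) = integral {s..t} \<phi>"
    and "\<phi> integrable_on {s..t}"
proof -
  have i: "\<phi> integrable_on {a..b}" if "0 \<le> a" for a b
    using that by (intro integrable_continuous_real continuous_on_subset[OF c]) auto
  have "set_integrable lborel {0..u} \<phi>" for u
    by (intro borel_integrable_atLeastAtMost') (auto intro: continuous_on_subset[OF c])
  then have "(LINT r:{0..u}|lborel. \<phi> r) = integral {0..u} \<phi>" for u
    by (rule set_borel_integral_eq_integral)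
  then show "(LINT u:{0..t}|lborel. \<phi> u) - (LINT u:{0..s}|lborel. \<phi> u) = integral {s..t} \<phi>"
    using Henstock_Kurzweil_Integration.integral_combine[OF st i[OF order_refl]] by simp
  show "\<phi> integrable_on {s..t}" using i st by auto
qed

lemma path_integral_bounds:
  fixes \<phi> :: "real \<Rightarrow> real"
  assumes c: "continuous_on {0..} \<phi>" and st: "0 \<le> s" "s \<le> t"
  shows "(\<And>u. u \<in> {s..t} \<Longrightarrow> C \<le> \<phi> u) \<Longrightarrow>
      C * (t - s) \<le> (LINT u:{0..t}|lborel. \<phi> u) - (LINT u:{0..s}|lborel. \<phi> u)"
    and "(\<And>u. u \<in> {s..t} \<Longrightarrow> \<phi> u \<le> C) \<Longrightarrow>
      (LINT u:{0..t}|lborel. \<phi> u) - (LINT u:{0..s}|lborel. \<phi> u) \<le> C * (t - s)"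
    and "(\<And>u. u \<in> {s..t} \<Longrightarrow> \<bar>\<phi> u\<bar> \<le> C) \<Longrightarrow>
      \<bar>(LINT u:{0..t}|lborel. \<phi> u) - (LINT u:{0..s}|lborel. \<phi> u)\<bar> \<le> C * (t - s)"
proof -
  note d = path_integral_diff[OF assms]
  have k: "integral {s..t} (\<lambda>_. C) = C * (t - s)" for C :: real using st by simp
  show 1: "(\<And>u. u \<in> {s..t} \<Longrightarrow> C \<le> \<phi> u) \<Longrightarrow>
      C * (t - s) \<le> (LINT u:{0..t}|lborel. \<phi> u) - (LINT u:{0..s}|lborel. \<phi> u)" for C
    unfolding d(1) k[symmetric] by (intro integral_le d(2)) auto
  show 2: "(\<And>u. u \<in> {s..t} \<Longrightarrow> \<phi> u \<le> C) \<Longrightarrow>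
      (LINT u:{0..t}|lborel. \<phi> u) - (LINT u:{0..s}|lborel. \<phi> u) \<le> C * (t - s)" for C
    unfolding d(1) k[symmetric] by (intro integral_le d(2)) auto
  assume a: "\<And>u. u \<in> {s..t} \<Longrightarrow> \<bar>\<phi> u\<bar> \<le> C"
  show "\<bar>(LINT u:{0..t}|lborel. \<phi> u) - (LINT u:{0..s}|lborel. \<phi> u)\<bar> \<le> C * (t - s)"
    using 1[of "-C"] 2[of C] a by (force simp: abs_le_iff)
qed

section \<open>The martingale problem of one reflecting diffusion\<close>

locale reflected_diffusion = usual_prob_space M F for M :: "'a measure" and F +
  fixes \<sigma> b :: "real \<Rightarrow> real" and l y c :: real and Y :: "real \<Rightarrow> 'a \<Rightarrow> real"
  assumes l: "0 < l"
    and \<sigma>_cont: "continuous_on {0..l} \<sigma>" and b_cont: "continuous_on {0..l} b"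
    and c: "0 < c" and elliptic: "\<And>x. x \<in> {0..l} \<Longrightarrow> c \<le> (\<sigma> x)\<^sup>2"
    and diffusion: "reflecting_diffusion M F \<sigma> b l y Y"
begin

lemma Y_range: "\<omega> \<in> space M \<Longrightarrow> 0 \<le> t \<Longrightarrow> Y t \<omega> \<in> {0..l}"
  using diffusion by (auto simp: reflecting_diffusion_def)

lemma Y_cont: "\<omega> \<in> space M \<Longrightarrow> continuous_on {0..} (\<lambda>t. Y t \<omega>)"
  using diffusion by (auto simp: reflecting_diffusion_def continuous_paths_def)

lemma Y_meas: "0 \<le> s \<Longrightarrow> s \<le> t \<Longrightarrow> Y s \<in> borel_measurable (F t)"
  using diffusion by (auto simp: reflecting_diffusion_def adapted_process_def intro: measurable_F_mono)

lemma Y_comp_cont: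
  "continuous_on {0..l} g \<Longrightarrow> \<omega> \<in> space M \<Longrightarrow> continuous_on {0..} (\<lambda>t. g (Y t \<omega>))"
  by (rule continuous_on_compose2[OF _ Y_cont]) (use Y_range in auto)

lemma Y_comp_meas:
  assumes g: "continuous_on {0..l} g" and st: "0 \<le> s" "s \<le> t"
  shows "(\<lambda>\<omega>. g (Y s \<omega>)) \<in> borel_measurable (F t)"
proof -
  \<comment> \<open>Clamping to \<open>[0,l]\<close> extends \<open>g\<close> continuously to the
    whole line without changing it on the range of \<open>Y\<close>.\<close>
  have "continuous_on UNIV (\<lambda>x. g (max 0 (min l x)))"
    by (rule continuous_on_compose2[OF g]) (use l in \<open>auto intro!: continuous_intros\<close>)
  from borel_measurable_continuous_on[OF this Y_meas[OF st]]
  show ?thesis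
  proof (rule measurable_cong[THEN iffD1, rotated])
    fix \<omega> assume "\<omega> \<in> space (F t)"
    then have "Y s \<omega> \<in> {0..l}" using Y_range st by simp
    then have "max 0 (min l (Y s \<omega>)) = Y s \<omega>" by auto
    then show "g (max 0 (min l (Y s \<omega>))) = g (Y s \<omega>)" by simp
  qed
qed

definition gen :: "(real \<Rightarrow> real) \<Rightarrow> (real \<Rightarrow> real) \<Rightarrow> real \<Rightarrow> real" where
  "gen g1 g2 x = (\<sigma> x)\<^sup>2 / 2 * g2 x + b x * g1 x"

definition path_int :: "(real \<Rightarrow> real) \<Rightarrow> real \<Rightarrow> 'a \<Rightarrow> real" where
  "path_int g t \<omega> = (LINT s:{0..t}|lborel. g (Y s \<omega>))"

lemma gen_cont: "continuous_on {0..l} g1 \<Longrightarrow> continuous_on {0..l} g2 \<Longrightarrow> continuous_on {0..l} (gen g1 g2)"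
  unfolding gen_def by (intro continuous_intros \<sigma>_cont b_cont) auto

lemma neumann_martingale:
  "neumann_C2 l f f1 f2 \<Longrightarrow> martingale M F (\<lambda>t \<omega>. f (Y t \<omega>) - f (Y 0 \<omega>) - path_int (gen f1 f2) t \<omega>)"
  using diffusion unfolding reflecting_diffusion_def path_int_def gen_def by blast

lemma neumann_continuous:
  assumes "neumann_C2 l f f1 f2"
  shows "continuous_on {0..l} f" "continuous_on {0..l} f1" "continuous_on {0..l} f2"
  using assms unfolding neumann_C2_def by (auto intro: DERIV_continuous_on)

lemma bounded_on:
  assumes "continuous_on {0..l} (g :: real \<Rightarrow> real)"
  obtains C where "0 \<le> C" "\<And>x. x \<in> {0..l} \<Longrightarrow> \<bar>g x\<bar> \<le> C"
proof -
  have "bounded (g ` {0..l})" by (intro compact_imp_bounded compact_continuous_image assms) auto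
  then obtain C where C: "\<forall>x\<in>{0..l}. \<bar>g x\<bar> \<le> C" unfolding bounded_iff by auto
  show ?thesis
  proof (rule that[of "\<bar>C\<bar>"])
    show "\<bar>g x\<bar> \<le> \<bar>C\<bar>" if "x \<in> {0..l}" for x
      using C[rule_format, OF that] by linarith
  qed simp
qed

lemma path_int_cont:
  assumes g: "continuous_on {0..l} g" and \<omega>: "\<omega> \<in> space M"
  shows "continuous_on {0..} (\<lambda>t. path_int g t \<omega>)"
proof -
  obtain C where C: "0 \<le> C" "\<And>x. x \<in> {0..l} \<Longrightarrow> \<bar>g x\<bar> \<le> C" using bounded_on[OF g] by blast
  have L: "\<bar>path_int g t \<omega> - path_int g s \<omega>\<bar> \<le> C * (t - s)" if "0 \<le> s" "s \<le> t" for s t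
    unfolding path_int_def
    by (rule path_integral_bounds(3)[OF Y_comp_cont[OF g \<omega>] that]) (use C Y_range[OF \<omega>] that in auto)
  have "C-lipschitz_on {0..} (\<lambda>t. path_int g t \<omega>)"
  proof (rule lipschitz_onI)
    fix s t :: real assume "s \<in> {0..}" "t \<in> {0..}"
    then show "dist (path_int g s \<omega>) (path_int g t \<omega>) \<le> C * dist s t"
      using L[of s t] L[of t s] by (cases "s \<le> t") (auto simp: dist_real_def abs_minus_commute)
  qed fact
  then show ?thesis by (rule lipschitz_on_continuous_on)
qed

text \<open>Adaptedness of the integral is read off the martingale problem: the integral is the
  increment of \<open>f (Y)\<close> minus an adapted martingale.\<close>

lemma neumann_path_int_meas:
  assumes f: "neumann_C2 l f f1 f2" and st: "0 \<le> s" "s \<le> t"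
  shows "path_int (gen f1 f2) s \<in> borel_measurable (F t)"
proof -
  have "(\<lambda>\<omega>. f (Y s \<omega>) - f (Y 0 \<omega>) - path_int (gen f1 f2) s \<omega>) \<in> borel_measurable (F t)"
    using neumann_martingale[OF f] st by (auto simp: martingale_def adapted_process_def intro: measurable_F_mono)
  moreover have "(\<lambda>\<omega>. f (Y s \<omega>) - f (Y 0 \<omega>)) \<in> borel_measurable (F t)"
    using st by (intro borel_measurable_diff Y_comp_meas neumann_continuous[OF f]) auto
  ultimately have "(\<lambda>\<omega>. (f (Y s \<omega>) - f (Y 0 \<omega>)) - (f (Y s \<omega>) - f (Y 0 \<omega>) - path_int (gen f1 f2) s \<omega>)) \<in> borel_measurable (F t)"
    by (rule borel_measurable_diff[rotated])
  then show ?thesis by simp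
qed

text \<open>Dynkin's formula with a weight known at time \<open>s\<close>. Integrability of both
  sides is recorded because the later estimates compare such integrals by monotonicity.\<close>

lemma dynkin:
  assumes f: "neumann_C2 l f f1 f2" and st: "0 \<le> s" "s \<le> t"
    and \<eta>: "\<eta> \<in> borel_measurable (F s)" "\<And>\<omega>. \<omega> \<in> space M \<Longrightarrow> \<bar>\<eta> \<omega>\<bar> \<le> K"
  shows "(\<integral>\<omega>. \<eta> \<omega> * (f (Y t \<omega>) - f (Y s \<omega>)) \<partial>M)
      = (\<integral>\<omega>. \<eta> \<omega> * (path_int (gen f1 f2) t \<omega> - path_int (gen f1 f2) s \<omega>) \<partial>M)"
    and "integrable M (\<lambda>\<omega>. \<eta> \<omega> * (f (Y t \<omega>) - f (Y s \<omega>)))"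
    and "integrable M (\<lambda>\<omega>. \<eta> \<omega> * (path_int (gen f1 f2) t \<omega> - path_int (gen f1 f2) s \<omega>))"
proof -
  note fc = neumann_continuous[OF f]
  obtain C where C: "0 \<le> C" "\<And>x. x \<in> {0..l} \<Longrightarrow> \<bar>f x\<bar> \<le> C" using bounded_on[OF fc(1)] by blast
  have fY: "integrable M (\<lambda>\<omega>. f (Y u \<omega>))" if "0 \<le> u" for u
    using Y_comp_meas[OF fc(1) that order_refl] C Y_range that
    by (intro integrable_bounded[where K=C]) (auto intro: measurable_F_M)
  note m = martingale_increment[OF neumann_martingale[OF f] st \<eta>]
  show i1: "integrable M (\<lambda>\<omega>. \<eta> \<omega> * (f (Y t \<omega>) - f (Y s \<omega>)))"
    using fY st by (intro integrable_bounded_mult[OF measurable_F_M[OF \<eta>(1)] \<eta>(2)]) auto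
  have eq: "(\<lambda>\<omega>. \<eta> \<omega> * (path_int (gen f1 f2) t \<omega> - path_int (gen f1 f2) s \<omega>))
    = (\<lambda>\<omega>. \<eta> \<omega> * (f (Y t \<omega>) - f (Y s \<omega>)) - \<eta> \<omega> * ((f (Y t \<omega>) - f (Y 0 \<omega>) - path_int (gen f1 f2) t \<omega>) - (f (Y s \<omega>) - f (Y 0 \<omega>) - path_int (gen f1 f2) s \<omega>)))"
    by (simp add: fun_eq_iff algebra_simps)
  show "integrable M (\<lambda>\<omega>. \<eta> \<omega> * (path_int (gen f1 f2) t \<omega> - path_int (gen f1 f2) s \<omega>))"
    unfolding eq by (rule Bochner_Integration.integrable_diff[OF i1 m(1)])
  show "(\<integral>\<omega>. \<eta> \<omega> * (f (Y t \<omega>) - f (Y s \<omega>)) \<partial>M)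
      = (\<integral>\<omega>. \<eta> \<omega> * (path_int (gen f1 f2) t \<omega> - path_int (gen f1 f2) s \<omega>) \<partial>M)"
    unfolding eq using Bochner_Integration.integral_diff[OF i1 m(1)] m(2) by simp
qed

end

text \<open>Along the times \<open>(Suc n)\<^sup>2\<close>, second moments of linear growth become
  summable: after division the \<open>n\<close>-th is at most \<open>C / (Suc n)\<^sup>2\<close>. So
  the series of squares is almost surely finite and its terms tend to \<open>0\<close>.\<close>

lemma (in prob_space) second_moment_subsequence:
  fixes X :: "nat \<Rightarrow> 'a \<Rightarrow> real"
  assumes X: "\<And>n. X n \<in> borel_measurable M" and C: "0 \<le> C"
    and bound: "\<And>n. (\<integral>\<^sup>+\<omega>. ennreal ((X n \<omega>)\<^sup>2) \<partial>M) \<le> ennreal (C * (real (Suc n))\<^sup>2)"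
  shows "AE \<omega> in M. (\<lambda>n. X n \<omega> / (real (Suc n))\<^sup>2) \<longlonglongrightarrow> 0"
proof -
  have sq: "ennreal ((X n \<omega> / (real (Suc n))\<^sup>2)\<^sup>2) = ennreal (1 / (real (Suc n)) ^ 4) * ennreal ((X n \<omega>)\<^sup>2)" for n \<omega>
    by (subst ennreal_mult[symmetric]) (auto simp: power_divide power_mult[symmetric])
  have le: "(\<integral>\<^sup>+\<omega>. ennreal ((X n \<omega> / (real (Suc n))\<^sup>2)\<^sup>2) \<partial>M) \<le> ennreal (C / (real (Suc n))\<^sup>2)" for n
  proof -
    have "(\<integral>\<^sup>+\<omega>. ennreal ((X n \<omega> / (real (Suc n))\<^sup>2)\<^sup>2) \<partial>M) = ennreal (1 / (real (Suc n)) ^ 4) * (\<integral>\<^sup>+\<omega>. ennreal ((X n \<omega>)\<^sup>2) \<partial>M)"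
      unfolding sq by (rule nn_integral_cmult) (use X in auto)
    also have "\<dots> \<le> ennreal (1 / (real (Suc n)) ^ 4) * ennreal (C * (real (Suc n))\<^sup>2)"
      by (intro mult_left_mono bound) auto
    also have "\<dots> = ennreal (C / (real (Suc n))\<^sup>2)"
      using C by (subst ennreal_mult[symmetric]) (auto simp: power4_eq_xxxx power2_eq_square)
    finally show ?thesis .
  qed
  have summ: "summable (\<lambda>n. C / (real (Suc n))\<^sup>2)"
    using summable_mult[OF inverse_power_summable[of 2, THEN summable_Suc_iff[THEN iffD2]], of C]
    by (simp add: field_simps del: of_nat_Suc)
  have "(\<integral>\<^sup>+\<omega>. (\<Sum>n. ennreal ((X n \<omega> / (real (Suc n))\<^sup>2)\<^sup>2)) \<partial>M) = (\<Sum>n. \<integral>\<^sup>+\<omega>. ennreal ((X n \<omega> / (real (Suc n))\<^sup>2)\<^sup>2) \<partial>M)"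
    by (rule nn_integral_suminf) (use X in auto)
  also have "\<dots> \<le> (\<Sum>n. ennreal (C / (real (Suc n))\<^sup>2))" by (intro suminf_le le) auto
  also have "\<dots> = ennreal (\<Sum>n. C / (real (Suc n))\<^sup>2)" using C summ by (intro suminf_ennreal2) auto
  finally have "(\<integral>\<^sup>+\<omega>. (\<Sum>n. ennreal ((X n \<omega> / (real (Suc n))\<^sup>2)\<^sup>2)) \<partial>M) \<noteq> \<infinity>"
    by (auto simp: top_unique)
  then have "AE \<omega> in M. (\<Sum>n. ennreal ((X n \<omega> / (real (Suc n))\<^sup>2)\<^sup>2)) \<noteq> \<infinity>"
    by (intro nn_integral_PInf_AE borel_measurable_suminf) (use X in auto)
  then show ?thesis
  proof eventually_elim
    case (elim \<omega>)
    then have "summable (\<lambda>n. (X n \<omega> / (real (Suc n))\<^sup>2)\<^sup>2)" by (intro summable_suminf_not_top) auto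
    then have "(\<lambda>n. (X n \<omega> / (real (Suc n))\<^sup>2)\<^sup>2) \<longlonglongrightarrow> 0" by (rule summable_LIMSEQ_zero)
    from tendsto_real_sqrt[OF this] have "(\<lambda>n. \<bar>X n \<omega> / (real (Suc n))\<^sup>2\<bar>) \<longlonglongrightarrow> 0" by simp
    then show ?case by (rule tendsto_rabs_zero_cancel)
  qed
qed

section \<open>Energy of the ramp, time spent at the end point, and the speed measure\<close>

context reflected_diffusion
begin

lemma path_int_bounds:
  assumes g: "continuous_on {0..l} g" and \<omega>: "\<omega> \<in> space M" and st: "0 \<le> s" "s \<le> t"
  shows "(\<And>x. x \<in> {0..l} \<Longrightarrow> C \<le> g x) \<Longrightarrow> C * (t - s) \<le> path_int g t \<omega> - path_int g s \<omega>"
    and "(\<And>x. x \<in> {0..l} \<Longrightarrow> g x \<le> C) \<Longrightarrow> path_int g t \<omega> - path_int g s \<omega> \<le> C * (t - s)"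
    and "(\<And>x. x \<in> {0..l} \<Longrightarrow> \<bar>g x\<bar> \<le> C) \<Longrightarrow> \<bar>path_int g t \<omega> - path_int g s \<omega>\<bar> \<le> C * (t - s)"
  unfolding path_int_def
  by (rule path_integral_bounds[OF Y_comp_cont[OF g \<omega>] st]; use Y_range[OF \<omega>] st in force)+

lemma path_int_0: "path_int g 0 \<omega> = 0"
proof -
  have "AE s in lborel. indicator {0..0::real} s *\<^sub>R g (Y s \<omega>) = 0"
    using AE_lborel_singleton[of "0::real"] by eventually_elim (auto simp: indicator_def)
  then show ?thesis unfolding path_int_def set_lebesgue_integral_def by (rule integral_eq_zero_AE)
qed

lemma Y_comp_integrable:
  fixes g :: "real \<Rightarrow> real"
  assumes "continuous_on {0..l} g" "0 \<le> t"
  shows "integrable M (\<lambda>\<omega>. g (Y t \<omega>))"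
proof -
  obtain C where C: "0 \<le> C" "\<And>x. x \<in> {0..l} \<Longrightarrow> \<bar>g x\<bar> \<le> C" using bounded_on[OF assms(1)] by blast
  then show ?thesis
    using Y_comp_meas[OF assms order_refl] Y_range[OF _ assms(2)]
    by (intro integrable_bounded[where K=C]) (auto intro: measurable_F_M)
qed

text \<open>The ramp of the process is a submartingale up to a drift of bounded rate, as the second
  derivative of a corner has a sign, while the square of the ramp is a Neumann function.\<close>

lemma ramp_energy:
  obtains C where "0 \<le> C"
    "\<And>s t. 0 \<le> s \<Longrightarrow> s \<le> t \<Longrightarrow> (\<integral>\<omega>. (ramp l (Y t \<omega>) - ramp l (Y s \<omega>))\<^sup>2 \<partial>M) \<le> C * (t - s)"
proof -
  let ?f = "ramp l" and ?f1 = "ramp1 l" and ?f2 = "ramp2 l"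
  let ?F1 = "\<lambda>x. 2 * ?f x * ?f1 x" and ?F2 = "\<lambda>x. 2 * (?f1 x)\<^sup>2 + 2 * ?f x * ?f2 x"
  note FN = neumann_ramp_square[OF l]
  note Fc = neumann_continuous[OF FN]
  obtain C1 where C1: "0 \<le> C1" "\<And>x. x \<in> {0..l} \<Longrightarrow> \<bar>gen ?F1 ?F2 x\<bar> \<le> C1"
    using bounded_on[OF gen_cont[OF Fc(2,3)]] by blast
  obtain C2 where C2: "0 \<le> C2" "\<And>x. x \<in> {0..l} \<Longrightarrow> \<bar>gen ?f1 ?f2 x\<bar> \<le> C2"
    using bounded_on[OF gen_cont[OF continuous_on_ramp(2,3)]] by blast
  obtain C3 where C3: "0 \<le> C3" "\<And>x. x \<in> {0..l} \<Longrightarrow> \<bar>b x\<bar> \<le> C3" using bounded_on[OF b_cont] by blast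
  \<comment> \<open>\<open>C1\<close> bounds the growth of the squared ramp. The cross term enters
    with factor \<open>2\<close>; in it the ramp is a weight of size at most \<open>l\<close> and
    the drift is at least \<open>- (C2 + C3)\<close>.\<close>
  define C where "C = C1 + 2 * (l * (C2 + C3))"
  show ?thesis
  proof (rule that[of C])
    show "0 \<le> C" using C1 C2 C3 l by (auto simp: C_def)
    fix s t :: real assume st: "0 \<le> s" "s \<le> t"
    then have t0: "0 \<le> t" by simp
    have fr: "0 \<le> ?f (Y u \<omega>)" "?f (Y u \<omega>) \<le> l" if "\<omega> \<in> space M" "0 \<le> u" for u \<omega>
      using ramp_bounds[OF l Y_range[OF that]] .
    have fm: "(\<lambda>\<omega>. ?f (Y u \<omega>)) \<in> borel_measurable (F v)" if "0 \<le> u" "u \<le> v" for u v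
      by (rule Y_comp_meas[OF continuous_on_ramp(1) that])
    have fi: "integrable M (\<lambda>\<omega>. ?f (Y u \<omega>))" if "0 \<le> u" for u
      by (rule Y_comp_integrable[OF continuous_on_ramp(1) that])
    have fsb: "\<bar>?f (Y s \<omega>)\<bar> \<le> l" if "\<omega> \<in> space M" for \<omega> using fr[OF that st(1)] by simp
    have F: "(\<integral>\<omega>. (?f (Y t \<omega>))\<^sup>2 - (?f (Y s \<omega>))\<^sup>2 \<partial>M) \<le> C1 * (t - s)"
    proof -
      note d = dynkin[OF FN st borel_measurable_const[of 1], of 1, simplified]
      have "(\<integral>\<omega>. path_int (gen ?F1 ?F2) t \<omega> - path_int (gen ?F1 ?F2) s \<omega> \<partial>M) \<le> (\<integral>\<omega>. C1 * (t - s) \<partial>M)"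
        using d(3) path_int_bounds(2)[OF gen_cont[OF Fc(2,3)] _ st, of _ C1] C1
        by (intro integral_mono) (auto simp: abs_le_iff)
      then show ?thesis using d(1) by (simp add: prob_space)
    qed
    have lower: "- (l * (C2 + C3) * (t - s)) - l * (2 * d) \<le> (\<integral>\<omega>. ?f (Y s \<omega>) * (?f (Y t \<omega>) - ?f (Y s \<omega>)) \<partial>M)"
      if d: "0 < d" "d \<le> l" for d
    proof -
      let ?g = "\<lambda>x. ?f x - corner d x" and ?g1 = "\<lambda>x. ?f1 x - corner1 d x" and ?g2 = "\<lambda>x. ?f2 x - corner2 d x"
      note gN = neumann_ramp_corner[OF d]
      note gc = neumann_continuous[OF gN]
      have gen_ge: "- (C2 + C3) \<le> gen ?g1 ?g2 x" if x: "x \<in> {0..l}" for x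
      proof -
        have x0: "0 \<le> x" using x by simp
        note cb = corner_bounds[OF d(1) x0]
        have "gen ?g1 ?g2 x = gen ?f1 ?f2 x - (\<sigma> x)\<^sup>2 / 2 * corner2 d x - b x * corner1 d x"
          by (simp add: gen_def algebra_simps diff_divide_distrib)
        moreover have "(\<sigma> x)\<^sup>2 / 2 * corner2 d x \<le> 0" using cb(4) by (simp add: mult_nonneg_nonpos)
        moreover have "\<bar>b x * corner1 d x\<bar> \<le> C3 * 1"
          unfolding abs_mult using C3 x cb by (intro mult_mono) auto
        ultimately show ?thesis using C2(2)[OF x] by linarith
      qed
      note dy = dynkin[OF gN st fm[OF st(1) order_refl] fsb]
      have "- (l * ((C2 + C3) * (t - s))) \<le> (\<integral>\<omega>. ?f (Y s \<omega>) * (path_int (gen ?g1 ?g2) t \<omega> - path_int (gen ?g1 ?g2) s \<omega>) \<partial>M)"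
      proof -
        have "(\<integral>\<omega>. - (l * ((C2 + C3) * (t - s))) \<partial>M) \<le> (\<integral>\<omega>. ?f (Y s \<omega>) * (path_int (gen ?g1 ?g2) t \<omega> - path_int (gen ?g1 ?g2) s \<omega>) \<partial>M)"
        proof (rule integral_mono)
          fix \<omega> assume w: "\<omega> \<in> space M"
          have "- (C2 + C3) * (t - s) \<le> path_int (gen ?g1 ?g2) t \<omega> - path_int (gen ?g1 ?g2) s \<omega>"
            by (rule path_int_bounds(1)[OF gen_cont[OF gc(2,3)] w st gen_ge])
          then have "?f (Y s \<omega>) * (- (C2 + C3) * (t - s)) \<le> ?f (Y s \<omega>) * (path_int (gen ?g1 ?g2) t \<omega> - path_int (gen ?g1 ?g2) s \<omega>)"
            using fr[OF w st(1)] by (intro mult_left_mono)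
          moreover have "?f (Y s \<omega>) * ((C2 + C3) * (t - s)) \<le> l * ((C2 + C3) * (t - s))"
            using fr[OF w st(1)] C2 C3 st by (intro mult_right_mono mult_nonneg_nonneg) auto
          ultimately show "- (l * ((C2 + C3) * (t - s))) \<le> ?f (Y s \<omega>) * (path_int (gen ?g1 ?g2) t \<omega> - path_int (gen ?g1 ?g2) s \<omega>)"
            by (simp add: algebra_simps)
        qed (use dy(3) in auto)
        then show ?thesis by (simp add: prob_space)
      qed
      also have "\<dots> = (\<integral>\<omega>. ?f (Y s \<omega>) * (?g (Y t \<omega>) - ?g (Y s \<omega>)) \<partial>M)" using dy(1) by simp
      also have "\<dots> \<le> (\<integral>\<omega>. ?f (Y s \<omega>) * (?f (Y t \<omega>) - ?f (Y s \<omega>)) + l * (2 * d) \<partial>M)"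
      proof (rule integral_mono)
        show "integrable M (\<lambda>\<omega>. ?f (Y s \<omega>) * (?f (Y t \<omega>) - ?f (Y s \<omega>)) + l * (2 * d))"
          using integrable_bounded_mult[OF measurable_F_M[OF fm[OF st(1) order_refl]] fsb, of "\<lambda>\<omega>. ?f (Y t \<omega>) - ?f (Y s \<omega>)"]
            fi[OF t0] fi[OF st(1)] by auto
        fix \<omega> assume w: "\<omega> \<in> space M"
        have "\<bar>corner d (Y u \<omega>)\<bar> \<le> d" if "0 \<le> u" for u
          using Y_range[OF w that] by (intro corner_bounds(1) d) auto
        from this[OF st(1)] this[OF t0] have "?g (Y t \<omega>) - ?g (Y s \<omega>) \<le> (?f (Y t \<omega>) - ?f (Y s \<omega>)) + 2 * d" by linarith
        then have "?f (Y s \<omega>) * (?g (Y t \<omega>) - ?g (Y s \<omega>)) \<le> ?f (Y s \<omega>) * ((?f (Y t \<omega>) - ?f (Y s \<omega>)) + 2 * d)"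
          using fr[OF w st(1)] by (intro mult_left_mono)
        also have "\<dots> \<le> ?f (Y s \<omega>) * (?f (Y t \<omega>) - ?f (Y s \<omega>)) + l * (2 * d)"
          unfolding distrib_left using fr[OF w st(1)] d by (intro add_left_mono mult_right_mono) auto
        finally show "?f (Y s \<omega>) * (?g (Y t \<omega>) - ?g (Y s \<omega>)) \<le> ?f (Y s \<omega>) * (?f (Y t \<omega>) - ?f (Y s \<omega>)) + l * (2 * d)" .
      qed (rule dy(2))
      also have "\<dots> = (\<integral>\<omega>. ?f (Y s \<omega>) * (?f (Y t \<omega>) - ?f (Y s \<omega>)) \<partial>M) + l * (2 * d)"
        using integrable_bounded_mult[OF measurable_F_M[OF fm[OF st(1) order_refl]] fsb, of "\<lambda>\<omega>. ?f (Y t \<omega>) - ?f (Y s \<omega>)"]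
            fi[OF t0] fi[OF st(1)] by (subst Bochner_Integration.integral_add) (auto simp: prob_space)
      finally show ?thesis by (simp add: algebra_simps)
    qed
    \<comment> \<open>The main term does not involve the width \<open>d\<close> of the corner, while
      the error \<open>2 * l * d\<close> left by the corner is at most \<open>e\<close> once
      \<open>d \<le> e / (2 * l)\<close>.\<close>
    have cross: "- (l * (C2 + C3) * (t - s)) \<le> (\<integral>\<omega>. ?f (Y s \<omega>) * (?f (Y t \<omega>) - ?f (Y s \<omega>)) \<partial>M)"
    proof (rule field_le_epsilon)
      fix e :: real assume e: "0 < e"
      define d where "d = min l (e / (2 * l))"
      have d: "0 < d" "d \<le> l" using e l by (auto simp: d_def)
      have "l * (2 * d) \<le> l * (2 * (e / (2 * l)))" using l by (intro mult_left_mono) (auto simp: d_def)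
      then have "l * (2 * d) \<le> e" using l by simp
      then show "- (l * (C2 + C3) * (t - s)) \<le> (\<integral>\<omega>. ?f (Y s \<omega>) * (?f (Y t \<omega>) - ?f (Y s \<omega>)) \<partial>M) + e"
        using lower[OF d] by linarith
    qed
    have i2: "integrable M (\<lambda>\<omega>. (?f (Y t \<omega>))\<^sup>2 - (?f (Y s \<omega>))\<^sup>2)"
      using Y_comp_integrable[OF Fc(1)] st t0 by (intro Bochner_Integration.integrable_diff) auto
    have i3: "integrable M (\<lambda>\<omega>. 2 * (?f (Y s \<omega>) * (?f (Y t \<omega>) - ?f (Y s \<omega>))))"
      using integrable_bounded_mult[OF measurable_F_M[OF fm[OF st(1) order_refl]] fsb, of "\<lambda>\<omega>. ?f (Y t \<omega>) - ?f (Y s \<omega>)"]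
            fi[OF t0] fi[OF st(1)] by auto
    have eq: "(?f (Y t \<omega>) - ?f (Y s \<omega>))\<^sup>2 = ((?f (Y t \<omega>))\<^sup>2 - (?f (Y s \<omega>))\<^sup>2) - 2 * (?f (Y s \<omega>) * (?f (Y t \<omega>) - ?f (Y s \<omega>)))" for \<omega>
      by (simp add: power2_eq_square algebra_simps)
    have "(\<integral>\<omega>. (?f (Y t \<omega>) - ?f (Y s \<omega>))\<^sup>2 \<partial>M) = (\<integral>\<omega>. (?f (Y t \<omega>))\<^sup>2 - (?f (Y s \<omega>))\<^sup>2 \<partial>M) - 2 * (\<integral>\<omega>. ?f (Y s \<omega>) * (?f (Y t \<omega>) - ?f (Y s \<omega>)) \<partial>M)"
      unfolding eq Bochner_Integration.integral_diff[OF i2 i3] by simp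
    then show "(\<integral>\<omega>. (?f (Y t \<omega>) - ?f (Y s \<omega>))\<^sup>2 \<partial>M) \<le> C * (t - s)"
      using F cross by (simp add: C_def algebra_simps)
  qed
qed

lemma path_set_integrable:
  fixes g :: "real \<Rightarrow> real"
  assumes g: "g \<in> borel_measurable borel" and \<omega>: "\<omega> \<in> space M" and K: "\<And>x. x \<in> {0..l} \<Longrightarrow> \<bar>g x\<bar> \<le> K"
  shows "set_integrable lborel {0..t} (\<lambda>s. g (Y s \<omega>))"
proof -
  have m: "(\<lambda>s. indicator {0..t} s *\<^sub>R Y s \<omega>) \<in> borel_measurable borel"
    by (rule borel_measurable_continuous_on_indicator)
       (use continuous_on_subset[OF Y_cont[OF \<omega>]] in auto)
  have "(\<lambda>s. indicator {0..t} s *\<^sub>R g (indicator {0..t} s *\<^sub>R Y s \<omega>)) \<in> borel_measurable borel"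
    using measurable_compose[OF m g] by measurable
  also have "(\<lambda>s. indicator {0..t} s *\<^sub>R g (indicator {0..t} s *\<^sub>R Y s \<omega>)) = (\<lambda>s. indicator {0..t} s *\<^sub>R g (Y s \<omega>))"
    by (auto simp: indicator_def)
  finally have gm: "(\<lambda>s. indicator {0..t} s *\<^sub>R g (Y s \<omega>)) \<in> borel_measurable lborel" by simp
  have "integrable lborel (\<lambda>s. K * indicator {0..t} s :: real)"
    by (intro integrable_mult_right integrable_real_indicator) (auto simp: emeasure_lborel_Icc_eq)
  then show ?thesis unfolding set_integrable_def
  proof (rule Bochner_Integration.integrable_bound[OF _ gm])
    have "norm (indicator {0..t} s *\<^sub>R g (Y s \<omega>)) \<le> norm (K * indicator {0..t} s)" for s
    proof (cases "s \<in> {0..t}")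
      case True
      then have "\<bar>g (Y s \<omega>)\<bar> \<le> K" by (intro K Y_range \<omega>) simp
      then show ?thesis using True by simp
    qed simp
    then show "AE s in lborel. norm (indicator {0..t} s *\<^sub>R g (Y s \<omega>)) \<le> norm (K * indicator {0..t} s)" by simp
  qed
qed

lemma path_int_dominated:
  assumes g: "\<And>n. g n \<in> borel_measurable borel" "g' \<in> borel_measurable borel" and \<omega>: "\<omega> \<in> space M"
    and K: "\<And>n x. x \<in> {0..l} \<Longrightarrow> \<bar>g n x\<bar> \<le> K" and lim: "\<And>x. x \<in> {0..l} \<Longrightarrow> (\<lambda>n. g n x) \<longlonglongrightarrow> g' x"
  shows "(\<lambda>n. path_int (g n) t \<omega>) \<longlonglongrightarrow> path_int g' t \<omega>"
  unfolding path_int_def set_lebesgue_integral_def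
proof (rule integral_dominated_convergence[where w="\<lambda>s. K * indicator {0..t} s"])
  have K': "\<bar>g' x\<bar> \<le> K" if "x \<in> {0..l}" for x
    using tendsto_rabs[OF lim[OF that]] K[OF that] by (intro LIMSEQ_le_const2) auto
  show "(\<lambda>s. indicator {0..t} s *\<^sub>R g' (Y s \<omega>)) \<in> borel_measurable lborel"
    using path_set_integrable[OF g(2) \<omega> K'] by (auto simp: set_integrable_def)
  show "(\<lambda>s. indicator {0..t} s *\<^sub>R g n (Y s \<omega>)) \<in> borel_measurable lborel" for n
    using path_set_integrable[OF g(1) \<omega> K] by (auto simp: set_integrable_def)
  show "integrable lborel (\<lambda>s. K * indicator {0..t} s :: real)"
    by (intro integrable_mult_right integrable_real_indicator) (auto simp: emeasure_lborel_Icc_eq)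
  show "AE s in lborel. (\<lambda>n. indicator {0..t} s *\<^sub>R g n (Y s \<omega>)) \<longlonglongrightarrow> indicator {0..t} s *\<^sub>R g' (Y s \<omega>)"
    using lim Y_range[OF \<omega>] by (intro AE_I2) (auto simp: indicator_def)
  show "AE s in lborel. norm (indicator {0..t} s *\<^sub>R g n (Y s \<omega>)) \<le> K * indicator {0..t} s" for n
    using K Y_range[OF \<omega>] by (intro AE_I2) (auto simp: indicator_def)
qed

lemma borel_measurable_truncated:
  assumes "continuous_on {0..l} (g :: real \<Rightarrow> real)"
  shows "(\<lambda>x. indicator {0..l} x * g x) \<in> borel_measurable borel"
  using borel_measurable_continuous_on_indicator[OF _ assms] by simp

lemma path_int_cong:
  assumes "\<omega> \<in> space M" "\<And>x. x \<in> {0..l} \<Longrightarrow> g x = g' x"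
  shows "path_int g t \<omega> = path_int g' t \<omega>"
  unfolding path_int_def by (rule set_lebesgue_integral_cong) (use assms Y_range in auto)

text \<open>The generator of a spike of width \<open>d\<close> is bounded uniformly in
  \<open>d\<close> and tends to \<open>(\<sigma> 0)\<^sup>2 / 2\<close> times the indicator of
  \<open>0\<close>, but by Dynkin's formula its expected time integral is a difference of values of
  order \<open>d\<^sup>2\<close>. Ellipticity makes the factor positive, so the expected time at
  \<open>0\<close> vanishes.\<close>

lemma zero_time:
  assumes t: "0 \<le> t"
  shows "AE \<omega> in M. path_int (indicator {0}) t \<omega> = 0"
proof -
  define d where "d n = l / real (Suc n)" for n
  have d: "0 < d n" "d n \<le> l" for n using l by (auto simp: d_def divide_le_eq)
  have dlim: "d \<longlonglongrightarrow> 0" unfolding d_def using LIMSEQ_Suc[OF lim_const_over_n[of l]] by simp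
  let ?G = "\<lambda>n. gen (spike1 (d n)) (spike2 (d n))"
  define h where "h n x = indicator {0..l} x * ?G n x" for n x
  define a where "a = (\<sigma> 0)\<^sup>2 / 2"
  have a: "a > 0" using elliptic[of 0] l c by (auto simp: a_def)
  note sN = neumann_spike[OF d]
  note sc = neumann_continuous[OF sN]
  have Gc: "continuous_on {0..l} (?G n)" for n by (intro gen_cont sc)
  obtain S where S: "0 \<le> S" "\<And>x. x \<in> {0..l} \<Longrightarrow> \<bar>(\<sigma> x)\<^sup>2 / 2\<bar> \<le> S"
  proof -
    have "continuous_on {0..l} (\<lambda>x. (\<sigma> x)\<^sup>2 / 2)" by (intro continuous_intros \<sigma>_cont) auto
    then show thesis using bounded_on that by blast
  qed
  obtain B where B: "0 \<le> B" "\<And>x. x \<in> {0..l} \<Longrightarrow> \<bar>b x\<bar> \<le> B" using bounded_on[OF b_cont] by blast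
  define K where "K = S * 3 + B * l"
  have hK: "\<bar>h n x\<bar> \<le> K" if x: "x \<in> {0..l}" for n x
  proof -
    have x0: "0 \<le> x" using x by simp
    note sb = spike_bounds[OF d(1) x0, of n]
    have "\<bar>(\<sigma> x)\<^sup>2 / 2 * spike2 (d n) x\<bar> \<le> S * 3" unfolding abs_mult using S x sb by (intro mult_mono) auto
    moreover have "\<bar>b x * spike1 (d n) x\<bar> \<le> B * l" unfolding abs_mult using B x sb d[of n] by (intro mult_mono) auto
    ultimately show ?thesis using x by (simp add: h_def gen_def K_def)
  qed
  have hlim: "(\<lambda>n. h n x) \<longlonglongrightarrow> a * indicator {0} x" if x: "x \<in> {0..l}" for x
  proof (cases "x = 0")
    case True
    then show ?thesis using l by (simp add: h_def gen_def spike_0 a_def)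
  next
    case False
    then have "\<forall>\<^sub>F n in sequentially. d n < x" using order_tendstoD(2)[OF dlim] x by auto
    then have "\<forall>\<^sub>F n in sequentially. h n x = 0"
      by eventually_elim (use d in \<open>simp add: h_def gen_def spike_far\<close>)
    then show ?thesis using False by (simp add: tendsto_eventually)
  qed
  have plim: "(\<lambda>n. path_int (?G n) t \<omega>) \<longlonglongrightarrow> path_int (\<lambda>x. a * indicator {0} x) t \<omega>" if w: "\<omega> \<in> space M" for \<omega>
  proof -
    have "(\<lambda>n. path_int (h n) t \<omega>) \<longlonglongrightarrow> path_int (\<lambda>x. a * indicator {0} x) t \<omega>"
      by (rule path_int_dominated[OF _ _ w hK hlim])
         (auto simp: h_def intro!: borel_measurable_truncated Gc)
    then show ?thesis using path_int_cong[OF w, of "h _" "?G _"] by (simp add: h_def)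
  qed
  have pK: "\<bar>path_int (?G n) t \<omega>\<bar> \<le> K * t" if w: "\<omega> \<in> space M" for n \<omega>
    using path_int_bounds(3)[OF Gc w order_refl t, of n K] hK[of _ n] by (simp add: path_int_0 h_def)
  have pM: "path_int (?G n) t \<in> borel_measurable M" for n
    by (rule measurable_F_M[OF neumann_path_int_meas[OF sN t order_refl]])
  have limM: "path_int (\<lambda>x. a * indicator {0} x) t \<in> borel_measurable M"
    by (rule borel_measurable_LIMSEQ_real[OF plim pM])
  have "(\<lambda>n. \<integral>\<omega>. path_int (?G n) t \<omega> \<partial>M) \<longlonglongrightarrow> (\<integral>\<omega>. path_int (\<lambda>x. a * indicator {0} x) t \<omega> \<partial>M)"
    by (rule integral_dominated_convergence[where w="\<lambda>_. K * t"])
       (use plim pM limM pK in auto)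
  moreover have "(\<lambda>n. \<integral>\<omega>. path_int (?G n) t \<omega> \<partial>M) \<longlonglongrightarrow> 0"
  proof (rule tendsto_0_le[where K=2])
    show "(\<lambda>n. (d n)\<^sup>2) \<longlonglongrightarrow> 0" using tendsto_power[OF dlim, of 2] by simp
    show "\<forall>\<^sub>F n in sequentially. norm (\<integral>\<omega>. path_int (?G n) t \<omega> \<partial>M) \<le> norm ((d n)\<^sup>2) * 2"
    proof (rule always_eventually, rule allI)
      fix n
      note dy = dynkin[OF sN order_refl t borel_measurable_const[of 1], of 1, simplified]
      have "\<bar>\<integral>\<omega>. spike (d n) (Y t \<omega>) - spike (d n) (Y 0 \<omega>) \<partial>M\<bar> \<le> (\<integral>\<omega>. \<bar>spike (d n) (Y t \<omega>) - spike (d n) (Y 0 \<omega>)\<bar> \<partial>M)"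
        by (rule integral_abs_bound)
      also have "\<dots> \<le> (\<integral>\<omega>. 2 * (d n)\<^sup>2 \<partial>M)"
      proof (rule integral_mono)
        fix \<omega> assume w: "\<omega> \<in> space M"
        have "\<bar>spike (d n) (Y u \<omega>)\<bar> \<le> (d n)\<^sup>2" if "0 \<le> u" for u
          using Y_range[OF w that] by (intro spike_bounds d) auto
        from this[OF t] this[OF order_refl]
        show "\<bar>spike (d n) (Y t \<omega>) - spike (d n) (Y 0 \<omega>)\<bar> \<le> 2 * (d n)\<^sup>2" by linarith
      qed (use dy(2)[of n] in auto)
      also have "\<dots> = 2 * (d n)\<^sup>2" by (simp add: prob_space)
      finally show "norm (\<integral>\<omega>. path_int (?G n) t \<omega> \<partial>M) \<le> norm ((d n)\<^sup>2) * 2"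
        using dy(1)[of n] by (simp add: path_int_0)
    qed
  qed
  ultimately have E0: "(\<integral>\<omega>. path_int (\<lambda>x. a * indicator {0} x) t \<omega> \<partial>M) = 0" by (rule LIMSEQ_unique)
  have nn: "0 \<le> path_int (\<lambda>x. a * indicator {0} x) t \<omega>" for \<omega>
    unfolding path_int_def set_lebesgue_integral_def using a
    by (intro Bochner_Integration.integral_nonneg) (auto simp: indicator_def)
  have "\<bar>path_int (\<lambda>x. a * indicator {0} x) t \<omega>\<bar> \<le> K * t" if "\<omega> \<in> space M" for \<omega>
    using tendsto_rabs[OF plim[OF that]] pK[OF that] by (intro LIMSEQ_le_const2) auto
  then have "integrable M (path_int (\<lambda>x. a * indicator {0} x) t)"
    using limM by (intro integrable_bounded[where K="K * t"])
  then have "AE \<omega> in M. path_int (\<lambda>x. a * indicator {0} x) t \<omega> = 0"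
    using E0 nn by (subst integral_nonneg_eq_0_iff_AE[symmetric]) auto
  then show ?thesis
  proof eventually_elim
    case (elim \<omega>)
    then have "a * path_int (indicator {0}) t \<omega> = 0"
      unfolding path_int_def set_integral_mult_right by simp
    then show ?case using a by simp
  qed
qed

text \<open>The equation \<open>gen g1 g2 = 1\<close> is solved with the integrating factor
  \<open>exp e\<close>, where \<open>e' = q\<close>: it becomes \<open>(exp e * g1)' = w\<close>.
  The solution that vanishes at \<open>l\<close> has slope \<open>- m l\<close> at \<open>0\<close>,
  which \<open>m l * ramp\<close> cancels without disturbing \<open>l\<close>. The speed mass thus
  appears as the defect of the reflection condition.\<close>

lemma speed_mass_corrector:
  obtains p p1 p2 where "neumann_C2 l p p1 p2" "0 < speed_mass \<sigma> b l"
    "\<And>x. x \<in> {0..l} \<Longrightarrow> gen p1 p2 x = 1 + speed_mass \<sigma> b l * gen (ramp1 l) (ramp2 l) x"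
proof -
  define q where "q x = 2 * b x / (\<sigma> x)\<^sup>2" for x
  define e where "e x = integral {0..x} q" for x
  define w where "w x = 2 / (\<sigma> x)\<^sup>2 * exp (e x)" for x
  define m where "m x = integral {0..x} w" for x
  have \<sigma>0: "\<sigma> x \<noteq> 0" if "x \<in> {0..l}" for x using elliptic[OF that] c by auto
  have qc: "continuous_on {0..l} q" unfolding q_def using \<sigma>0
    by (intro continuous_intros \<sigma>_cont b_cont) auto
  have e': "(e has_real_derivative q x) (at x within {0..l})" if "x \<in> {0..l}" for x
    unfolding e_def by (rule integral_has_real_derivative[OF qc that])
  have wc: "continuous_on {0..l} w" unfolding w_def using \<sigma>0
    by (intro continuous_intros \<sigma>_cont DERIV_continuous_on[OF e']) auto
  have m': "(m has_real_derivative w x) (at x within {0..l})" if "x \<in> {0..l}" for x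
    unfolding m_def by (rule integral_has_real_derivative[OF wc that])
  have eq: "(LINT y:{0..x}|lborel. 2 * b y / (\<sigma> y)\<^sup>2) = e x" if "x \<in> {0..l}" for x
    unfolding e_def q_def[symmetric]
    by (rule set_borel_integral_eq_integral, rule borel_integrable_atLeastAtMost')
       (use that in \<open>auto intro: continuous_on_subset[OF qc]\<close>)
  have mass: "speed_mass \<sigma> b l = m l"
  proof -
    have "speed_mass \<sigma> b l = (LINT x:{0..l}|lborel. w x)"
      unfolding speed_mass_def by (rule set_lebesgue_integral_cong) (auto simp: eq w_def)
    also have "\<dots> = m l" unfolding m_def
      by (intro set_borel_integral_eq_integral borel_integrable_atLeastAtMost' wc)
    finally show ?thesis .
  qed
  have m0: "m 0 = 0" by (simp add: m_def)
  have wpos: "w x > 0" if "x \<in> {0..l}" for x using \<sigma>0[OF that] by (simp add: w_def)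
  have "m 0 < m l"
  proof (rule DERIV_pos_imp_increasing_open[OF l])
    fix x assume x: "0 < x" "x < l"
    then have "(m has_real_derivative w x) (at x)"
      using m'[of x] at_within_Icc_at[of 0 x l] by simp
    then show "\<exists>y. (m has_real_derivative y) (at x) \<and> 0 < y" using wpos[of x] x by auto
  qed (rule DERIV_continuous_on[OF m'])
  then have mpos: "0 < m l" by (simp add: m0)
  define g1 where "g1 x = exp (- e x) * (m x - m l)" for x
  define g2 where "g2 x = - q x * g1 x + 2 / (\<sigma> x)\<^sup>2" for x
  have g1': "(g1 has_real_derivative g2 x) (at x within {0..l})" if x: "x \<in> {0..l}" for x
  proof -
    have "(g1 has_real_derivative exp (- e x) * - q x * (m x - m l) + w x * exp (- e x)) (at x within {0..l})"
      unfolding g1_def [abs_def] using e'[OF x] m'[OF x] by (auto intro!: derivative_eq_intros)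
    also have "exp (- e x) * - q x * (m x - m l) + w x * exp (- e x) = g2 x"
      by (simp add: g2_def g1_def w_def exp_minus field_simps)
    finally show ?thesis .
  qed
  have g1c: "continuous_on {0..l} g1" by (rule DERIV_continuous_on[OF g1'])
  have g2c: "continuous_on {0..l} g2" unfolding g2_def using \<sigma>0
    by (intro continuous_intros g1c qc \<sigma>_cont) auto
  define g where "g x = integral {0..x} g1" for x
  have g': "(g has_real_derivative g1 x) (at x within {0..l})" if "x \<in> {0..l}" for x
    unfolding g_def by (rule integral_has_real_derivative[OF g1c that])
  define p where "p x = g x + m l * ramp l x" for x
  define p1 where "p1 x = g1 x + m l * ramp1 l x" for x
  define p2 where "p2 x = g2 x + m l * ramp2 l x" for x
  show ?thesis
  proof (rule that[of p p1 p2])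
    show "neumann_C2 l p p1 p2" unfolding neumann_C2_def
    proof (intro conjI ballI)
      show "(p has_real_derivative p1 x) (at x within {0..l})" if "x \<in> {0..l}" for x
        unfolding p_def [abs_def] p1_def by (intro DERIV_add DERIV_cmult g' ramp_deriv that)
      show "(p1 has_real_derivative p2 x) (at x within {0..l})" if "x \<in> {0..l}" for x
        unfolding p1_def [abs_def] p2_def by (intro DERIV_add DERIV_cmult g1' ramp1_deriv that)
      show "continuous_on {0..l} p2" unfolding p2_def by (intro continuous_intros g2c continuous_on_ramp)
      show "p1 0 = 0" using l by (simp add: p1_def g1_def m0 e_def ramp1_0)
      show "p1 l = 0" using l by (simp add: p1_def g1_def ramp1_l)
    qed
    show "0 < speed_mass \<sigma> b l" using mpos mass by simp
    fix x assume x: "x \<in> {0..l}"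
    have "gen g1 g2 x = 1" using \<sigma>0[OF x] by (simp add: gen_def g2_def q_def field_simps)
    then show "gen p1 p2 x = 1 + speed_mass \<sigma> b l * gen (ramp1 l) (ramp2 l) x"
      by (simp add: mass gen_def p1_def p2_def algebra_simps add_divide_distrib)
  qed
qed

text \<open>Between consecutive integers the martingale moves by at most a fixed \<open>K\<close>,
  and these increments are orthogonal, so each step adds at most \<open>K\<^sup>2\<close> to the
  second moment.\<close>

lemma neumann_second_moment:
  assumes f: "neumann_C2 l f f1 f2"
  obtains C where "0 \<le> C"
    "\<And>n. (\<integral>\<omega>. (f (Y (real n) \<omega>) - f (Y 0 \<omega>) - path_int (gen f1 f2) (real n) \<omega>)\<^sup>2 \<partial>M) \<le> C * real n"
    "\<And>n. integrable M (\<lambda>\<omega>. (f (Y (real n) \<omega>) - f (Y 0 \<omega>) - path_int (gen f1 f2) (real n) \<omega>)\<^sup>2)"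
proof -
  note fc = neumann_continuous[OF f]
  note Gc = gen_cont[OF fc(2,3)]
  obtain C1 where C1: "0 \<le> C1" "\<And>x. x \<in> {0..l} \<Longrightarrow> \<bar>f x\<bar> \<le> C1" using bounded_on[OF fc(1)] by blast
  obtain C2 where C2: "0 \<le> C2" "\<And>x. x \<in> {0..l} \<Longrightarrow> \<bar>gen f1 f2 x\<bar> \<le> C2" using bounded_on[OF Gc] by blast
  define K where "K = 2 * C1 + C2"
  define N where "N t \<omega> = f (Y t \<omega>) - f (Y 0 \<omega>) - path_int (gen f1 f2) t \<omega>" for t \<omega>
  have Nmart: "martingale M F N" using neumann_martingale[OF f] by (simp add: N_def [abs_def])
  have Nm: "N t \<in> borel_measurable (F t)" if "0 \<le> t" for t
    using Nmart that by (auto simp: martingale_def adapted_process_def)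
  have inc: "\<bar>N (real (Suc n)) \<omega> - N (real n) \<omega>\<bar> \<le> K" if w: "\<omega> \<in> space M" for n \<omega>
  proof -
    have "\<bar>path_int (gen f1 f2) (real (Suc n)) \<omega> - path_int (gen f1 f2) (real n) \<omega>\<bar> \<le> C2 * (real (Suc n) - real n)"
      by (rule path_int_bounds(3)[OF Gc w _ _ C2(2)]) auto
    moreover have "\<bar>f (Y (real (Suc n)) \<omega>)\<bar> \<le> C1" "\<bar>f (Y (real n) \<omega>)\<bar> \<le> C1"
      by (intro C1(2) Y_range w; simp)+
    ultimately show ?thesis by (simp add: N_def K_def)
  qed
  have K0: "0 \<le> K" using C1 C2 by (simp add: K_def)
  have Nb: "\<bar>N (real n) \<omega>\<bar> \<le> K * real n" if w: "\<omega> \<in> space M" for n \<omega>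
  proof (induction n)
    case 0 then show ?case by (simp add: N_def path_int_0)
  next
    case (Suc n) then show ?case using inc[OF w, of n] by (simp add: algebra_simps)
  qed
  have sqb: "x\<^sup>2 \<le> y\<^sup>2" if "\<bar>x\<bar> \<le> y" for x y :: real using that abs_le_square_iff[of x y] by auto
  have NM: "N (real n) \<in> borel_measurable M" for n by (rule measurable_F_M[OF Nm]) simp
  have Ni: "integrable M (\<lambda>\<omega>. (N (real n) \<omega>)\<^sup>2)" for n
    using NM[of n] Nb by (intro integrable_bounded[where K="(K * real n)\<^sup>2"]) (auto intro: sqb)
  have di: "integrable M (\<lambda>\<omega>. (N (real (Suc n)) \<omega> - N (real n) \<omega>)\<^sup>2)" for n
    using NM[of n] NM[of "Suc n"] inc by (intro integrable_bounded[where K="K\<^sup>2"]) (auto intro: sqb)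
  have "(\<integral>\<omega>. (N (real n) \<omega>)\<^sup>2 \<partial>M) \<le> K\<^sup>2 * real n" for n
  proof (induction n)
    case 0 then show ?case by (simp add: N_def path_int_0)
  next
    case (Suc n)
    have "(\<lambda>\<omega>. 2 * N (real n) \<omega>) \<in> borel_measurable (F (real n))" using Nm[of "real n"] by simp
    note o = martingale_increment[OF Nmart _ _ this, of "real (Suc n)" "2 * (K * real n)"]
    have o: "integrable M (\<lambda>\<omega>. 2 * N (real n) \<omega> * (N (real (Suc n)) \<omega> - N (real n) \<omega>))"
      "(\<integral>\<omega>. 2 * N (real n) \<omega> * (N (real (Suc n)) \<omega> - N (real n) \<omega>) \<partial>M) = 0"
      by (rule o; use Nb[of _ n] in \<open>simp add: abs_mult\<close>)+
    have eq: "(N (real (Suc n)) \<omega>)\<^sup>2 = ((N (real n) \<omega>)\<^sup>2 + 2 * N (real n) \<omega> * (N (real (Suc n)) \<omega> - N (real n) \<omega>))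
        + (N (real (Suc n)) \<omega> - N (real n) \<omega>)\<^sup>2" for \<omega>
      by (simp add: power2_eq_square algebra_simps)
    have "(\<integral>\<omega>. (N (real (Suc n)) \<omega>)\<^sup>2 \<partial>M) = (\<integral>\<omega>. (N (real n) \<omega>)\<^sup>2 \<partial>M) + 0 + (\<integral>\<omega>. (N (real (Suc n)) \<omega> - N (real n) \<omega>)\<^sup>2 \<partial>M)"
      unfolding eq Bochner_Integration.integral_add[OF Bochner_Integration.integrable_add[OF Ni o(1)] di]
        Bochner_Integration.integral_add[OF Ni o(1)] o(2) ..
    also have "(\<integral>\<omega>. (N (real (Suc n)) \<omega> - N (real n) \<omega>)\<^sup>2 \<partial>M) \<le> (\<integral>\<omega>. K\<^sup>2 \<partial>M)"
      using inc by (intro integral_mono di) (auto intro: sqb)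
    finally show ?case using Suc by (simp add: prob_space algebra_simps)
  qed
  from that[of "K\<^sup>2", folded N_def, OF _ this Ni] show ?thesis by simp
qed

text \<open>For the corrector \<open>p\<close>, the integral of \<open>gen p1 p2\<close> is
  \<open>t\<close> plus the speed mass times the integral of the generator of the ramp. As
  \<open>p\<close> is bounded and its martingale is negligible along the squares, \<open>1\<close>
  plus the speed mass times the average tends to \<open>0\<close>.\<close>

lemma ramp_average:
  "0 < speed_mass \<sigma> b l"
  "AE \<omega> in M. (\<lambda>n. path_int (gen (ramp1 l) (ramp2 l)) ((real (Suc n))\<^sup>2) \<omega> / (real (Suc n))\<^sup>2)
      \<longlonglongrightarrow> - 1 / speed_mass \<sigma> b l"
proof -
  let ?m = "speed_mass \<sigma> b l" and ?R = "gen (ramp1 l) (ramp2 l)"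
  obtain p p1 p2 where p: "neumann_C2 l p p1 p2" and m: "0 < ?m"
    and pg: "\<And>x. x \<in> {0..l} \<Longrightarrow> gen p1 p2 x = 1 + ?m * ?R x"
    by (rule speed_mass_corrector) blast
  show "0 < ?m" by (rule m)
  note pc = neumann_continuous[OF p]
  obtain C1 where C1: "0 \<le> C1" "\<And>x. x \<in> {0..l} \<Longrightarrow> \<bar>p x\<bar> \<le> C1" using bounded_on[OF pc(1)] by blast
  obtain C where C: "0 \<le> C"
    "\<And>n. (\<integral>\<omega>. (p (Y (real n) \<omega>) - p (Y 0 \<omega>) - path_int (gen p1 p2) (real n) \<omega>)\<^sup>2 \<partial>M) \<le> C * real n"
    "\<And>n. integrable M (\<lambda>\<omega>. (p (Y (real n) \<omega>) - p (Y 0 \<omega>) - path_int (gen p1 p2) (real n) \<omega>)\<^sup>2)"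
    using neumann_second_moment[OF p] by blast
  define N where "N t \<omega> = p (Y t \<omega>) - p (Y 0 \<omega>) - path_int (gen p1 p2) t \<omega>" for t \<omega>
  have "martingale M F N" using neumann_martingale[OF p] by (simp add: N_def [abs_def])
  then have Nm: "N t \<in> borel_measurable (F t)" if "0 \<le> t" for t
    using that by (auto simp: martingale_def adapted_process_def)
  have sq: "(real (Suc n))\<^sup>2 = real ((Suc n)\<^sup>2)" for n by simp
  have "AE \<omega> in M. (\<lambda>n. N ((real (Suc n))\<^sup>2) \<omega> / (real (Suc n))\<^sup>2) \<longlonglongrightarrow> 0"
  proof (rule second_moment_subsequence[OF _ C(1)])
    show "N ((real (Suc n))\<^sup>2) \<in> borel_measurable M" for n
      by (rule measurable_F_M[OF Nm]) simp
    show "(\<integral>\<^sup>+\<omega>. ennreal ((N ((real (Suc n))\<^sup>2) \<omega>)\<^sup>2) \<partial>M) \<le> ennreal (C * (real (Suc n))\<^sup>2)" for n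
      unfolding sq N_def using C(2)[of "(Suc n)\<^sup>2"] C(3)[of "(Suc n)\<^sup>2"]
      by (subst nn_integral_eq_integral) (auto intro: ennreal_leI)
  qed
  then show "AE \<omega> in M. (\<lambda>n. path_int ?R ((real (Suc n))\<^sup>2) \<omega> / (real (Suc n))\<^sup>2) \<longlonglongrightarrow> - 1 / ?m"
  proof (rule AE_mp, intro AE_I2 impI)
    fix \<omega> assume w: "\<omega> \<in> space M" and lim: "(\<lambda>n. N ((real (Suc n))\<^sup>2) \<omega> / (real (Suc n))\<^sup>2) \<longlonglongrightarrow> 0"
    define T where "T n = (real (Suc n))\<^sup>2" for n
    have Tpos: "T n > 0" for n by (simp add: T_def)
    have Tinf: "filterlim T at_top sequentially" unfolding T_def
      by (intro filterlim_pow_at_top filterlim_compose[OF filterlim_real_sequentially filterlim_Suc]) simp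
    have Rc: "continuous_on {0..l} ?R" by (intro gen_cont continuous_on_ramp)
    have pid: "path_int (gen p1 p2) t \<omega> = t + ?m * path_int ?R t \<omega>" if t: "0 \<le> t" for t
    proof -
      have i: "set_integrable lborel {0..t} (\<lambda>s. ?R (Y s \<omega>))"
        by (intro borel_integrable_atLeastAtMost' continuous_on_subset[OF Y_comp_cont[OF Rc w]]) auto
      have i1: "set_integrable lborel {0..t} (\<lambda>s. 1 :: real)"
        by (intro borel_integrable_atLeastAtMost') auto
      have "path_int (gen p1 p2) t \<omega> = path_int (\<lambda>x. 1 + ?m * ?R x) t \<omega>"
        by (rule path_int_cong[OF w pg])
      also have "\<dots> = (LINT s:{0..t}|lborel. 1) + (LINT s:{0..t}|lborel. ?m * ?R (Y s \<omega>))"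
        unfolding path_int_def using i i1 by (intro set_integral_add) auto
      also have "(LINT s:{0..t}|lborel. 1) = t"
        using t by (simp add: set_lebesgue_integral_def)
      finally show ?thesis by (simp add: path_int_def)
    qed
    have small: "(\<lambda>n. (p (Y (T n) \<omega>) - p (Y 0 \<omega>)) / T n) \<longlonglongrightarrow> 0"
    proof (rule tendsto_0_le[where K=1])
      show "(\<lambda>n. (2 * C1) / T n) \<longlonglongrightarrow> 0"
        by (intro tendsto_divide_0[OF tendsto_const] filterlim_at_top_imp_at_infinity Tinf)
      have "\<bar>p (Y u \<omega>)\<bar> \<le> C1" if "0 \<le> u" for u by (intro C1 Y_range w that)
      from this[of 0] this[of "T _"] have "\<bar>p (Y (T n) \<omega>) - p (Y 0 \<omega>)\<bar> \<le> 2 * C1" for n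
        using Tpos[of n] by (smt (verit))
      then show "\<forall>\<^sub>F n in sequentially. norm ((p (Y (T n) \<omega>) - p (Y 0 \<omega>)) / T n) \<le> norm (2 * C1 / T n) * 1"
        using Tpos C1(1) by (intro always_eventually allI) (auto simp: abs_divide intro!: divide_right_mono less_imp_le[OF Tpos])
    qed
    have "(\<lambda>n. ((p (Y (T n) \<omega>) - p (Y 0 \<omega>)) / T n - N (T n) \<omega> / T n - 1) / ?m) \<longlonglongrightarrow> (0 - 0 - 1) / ?m"
      using m by (intro tendsto_intros small lim[folded T_def]) auto
    moreover have "((p (Y (T n) \<omega>) - p (Y 0 \<omega>)) / T n - N (T n) \<omega> / T n - 1) / ?m = path_int ?R (T n) \<omega> / T n" for n
      using Tpos[of n] m pid[of "T n"] by (simp add: N_def field_simps)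
    ultimately show "(\<lambda>n. path_int ?R ((real (Suc n))\<^sup>2) \<omega> / (real (Suc n))\<^sup>2) \<longlonglongrightarrow> - 1 / ?m"
      by (simp add: T_def)
  qed
qed

end

section \<open>Semimartingale decompositions along a path\<close>

definition grid :: "real \<Rightarrow> nat \<Rightarrow> nat \<Rightarrow> real" where
  "grid t n k = t * real k / real n"

lemma grid_0 [simp]: "grid t n 0 = 0"
  by (simp add: grid_def)

lemma grid_last [simp]: "0 < n \<Longrightarrow> grid t n n = t"
  by (simp add: grid_def)

lemma grid_mono: "0 \<le> t \<Longrightarrow> j \<le> k \<Longrightarrow> grid t n j \<le> grid t n k"
  by (auto simp: grid_def intro!: divide_right_mono mult_left_mono)

lemma grid_nonneg: "0 \<le> t \<Longrightarrow> 0 \<le> grid t n k"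
  by (simp add: grid_def)

lemma grid_le: "0 \<le> t \<Longrightarrow> k \<le> n \<Longrightarrow> grid t n k \<le> t"
  using grid_mono[of t k n n] by (cases "n = 0") auto

lemma grid_uniform:
  fixes x :: "real \<Rightarrow> real"
  assumes x: "continuous_on {0..} x" and t: "0 \<le> t" and e: "0 < \<epsilon>"
  shows "\<forall>\<^sub>F n in sequentially. \<forall>k<n. \<forall>u\<in>{grid t n k..grid t n (Suc k)}. \<bar>x u - x (grid t n k)\<bar> \<le> \<epsilon>"
proof -
  have "uniformly_continuous_on {0..t} x"
    by (intro compact_uniformly_continuous continuous_on_subset[OF x]) auto
  then obtain \<delta> where \<delta>: "\<delta> > 0" "\<And>u w. u \<in> {0..t} \<Longrightarrow> w \<in> {0..t} \<Longrightarrow> dist u w < \<delta> \<Longrightarrow> dist (x u) (x w) < \<epsilon>"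
    using e unfolding uniformly_continuous_on_def by metis
  have "(\<lambda>n. t / real n) \<longlonglongrightarrow> 0" by (rule lim_const_over_n)
  from order_tendstoD(2)[OF this \<delta>(1)] show ?thesis
  proof eventually_elim
    case (elim n)
    show ?case
    proof (intro allI impI ballI)
      fix k u assume k: "k < n" and u: "u \<in> {grid t n k..grid t n (Suc k)}"
      have step: "grid t n (Suc k) = grid t n k + t / real n"
        by (simp add: grid_def ring_distribs add_divide_distrib)
      have "u \<le> t" using u grid_le[OF t, of "Suc k" n] k by auto
      moreover have "0 \<le> u" using u grid_nonneg[OF t, of n k] by auto
      moreover have "dist u (grid t n k) < \<delta>" using u step elim by (auto simp: dist_real_def)
      ultimately have "dist (x u) (x (grid t n k)) < \<epsilon>"
        using grid_nonneg[OF t, of n k] grid_le[OF t, of k n] k by (intro \<delta>(2)) auto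
      then show "\<bar>x u - x (grid t n k)\<bar> \<le> \<epsilon>" by (simp add: dist_real_def)
    qed
  qed
qed

lemma sum_indicator_grid:
  assumes t: "0 \<le> t"
  shows "(\<Sum>k<m. indicator {grid t n k<..grid t n (Suc k)} s) = (indicator {0<..grid t n m} s :: real)"
proof (induction m)
  case (Suc m)
  then show ?case using grid_mono[OF t, of m "Suc m" n] grid_nonneg[OF t, of n m]
    by (auto simp: indicator_def)
qed simp

text \<open>The step functions that sample \<open>\<phi>\<close> at the left grid points converge
  pointwise and boundedly on \<open>{0<..t}\<close>. A general measure \<open>\<mu>\<close> with a
  density \<open>r\<close> covers both the Stieltjes measures of the finite variation part and the
  drift with respect to Lebesgue measure.\<close>

lemma stieltjes_sums:
  fixes \<phi> r :: "real \<Rightarrow> real"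
  assumes \<mu>: "sets \<mu> = sets borel" and \<phi>: "continuous_on {0..} \<phi>" and t: "0 < t"
    and r: "set_integrable \<mu> {0<..t} r"
  shows "(\<lambda>n. \<Sum>k<n. \<phi> (grid t n k) * (LINT s:{grid t n k<..grid t n (Suc k)}|\<mu>. r s))
    \<longlonglongrightarrow> (LINT s:{0<..t}|\<mu>. \<phi> s * r s)"
proof -
  have t0: "0 \<le> t" using t by simp
  have "bounded (\<phi> ` {0..t})"
    by (intro compact_imp_bounded compact_continuous_image continuous_on_subset[OF \<phi>]) auto
  then obtain K where K: "\<forall>x\<in>{0..t}. \<bar>\<phi> x\<bar> \<le> K" unfolding bounded_iff by auto
  define step where "step n s = (\<Sum>k<n. \<phi> (grid t n k) * indicator {grid t n k<..grid t n (Suc k)} s)" for n s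
  have ind: "(\<Sum>k<n. indicator {grid t n k<..grid t n (Suc k)} s) = (indicator {0<..t} s :: real)" if "n > 0" for n s
    using sum_indicator_grid[OF t0, where m=n and n=n and s=s] that by simp
  have stepK: "\<bar>step n s\<bar> \<le> K * indicator {0<..t} s" if n: "n > 0" for n s
  proof -
    have "\<bar>step n s\<bar> \<le> (\<Sum>k<n. \<bar>\<phi> (grid t n k) * indicator {grid t n k<..grid t n (Suc k)} s\<bar>)"
      unfolding step_def by (rule sum_abs)
    also have "\<dots> \<le> (\<Sum>k<n. K * indicator {grid t n k<..grid t n (Suc k)} s)"
    proof (rule sum_mono)
      fix k assume "k \<in> {..<n}"
      then have "\<bar>\<phi> (grid t n k)\<bar> \<le> K" using K grid_le[OF t0, of k n] grid_nonneg[OF t0, of n k] by auto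
      then show "\<bar>\<phi> (grid t n k) * indicator {grid t n k<..grid t n (Suc k)} s\<bar> \<le> K * indicator {grid t n k<..grid t n (Suc k)} s"
        by (auto simp: indicator_def)
    qed
    also have "\<dots> = K * indicator {0<..t} s" using ind[OF n, of s] by (simp add: sum_distrib_left[symmetric])
    finally show ?thesis .
  qed
  have steplim: "(\<lambda>n. step n s) \<longlonglongrightarrow> \<phi> s" if s: "s \<in> {0<..t}" for s
  proof (rule LIMSEQ_I)
    fix e :: real assume e: "0 < e"
    then have "0 < e / 2" by simp
    from grid_uniform[OF \<phi> t0 this] eventually_gt_at_top[of 0]
    have "\<forall>\<^sub>F n in sequentially. norm (step n s - \<phi> s) < e"
    proof eventually_elim
      case (elim n)
      have "step n s - \<phi> s = (\<Sum>k<n. (\<phi> (grid t n k) - \<phi> s) * indicator {grid t n k<..grid t n (Suc k)} s)"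
        unfolding step_def using ind[OF elim(2), of s] s
        by (simp add: left_diff_distrib sum_subtractf sum_distrib_left[symmetric])
      also have "\<bar>\<dots>\<bar> \<le> (\<Sum>k<n. \<bar>(\<phi> (grid t n k) - \<phi> s) * indicator {grid t n k<..grid t n (Suc k)} s\<bar>)"
        by (rule sum_abs)
      also have "\<dots> \<le> (\<Sum>k<n. e / 2 * indicator {grid t n k<..grid t n (Suc k)} s)"
      proof (rule sum_mono)
        fix k assume "k \<in> {..<n}"
        then show "\<bar>(\<phi> (grid t n k) - \<phi> s) * indicator {grid t n k<..grid t n (Suc k)} s\<bar> \<le> e / 2 * indicator {grid t n k<..grid t n (Suc k)} s"
          using elim(1) by (auto simp: indicator_def abs_minus_commute)
      qed
      also have "\<dots> = e / 2" unfolding sum_distrib_left[symmetric] using ind[OF elim(2), of s] s by simp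
      finally show ?case using e by simp
    qed
    then show "\<exists>no. \<forall>n\<ge>no. norm (step n s - \<phi> s) < e" by (simp add: eventually_sequentially)
  qed
  have ri: "integrable \<mu> (\<lambda>s. indicator {0<..t} s * r s)" using r by (simp add: set_integrable_def)
  have rm: "(\<lambda>s. indicator {0<..t} s * r s) \<in> borel_measurable \<mu>" using ri by (rule borel_measurable_integrable)
  have stepm: "step n \<in> borel_measurable \<mu>" for n
    unfolding step_def by (intro borel_measurable_sum borel_measurable_times borel_measurable_const borel_measurable_indicator) (simp add: \<mu>)
  have eq: "(\<Sum>k<n. \<phi> (grid t n k) * (LINT s:{grid t n k<..grid t n (Suc k)}|\<mu>. r s)) = (\<integral>s. step n s * (indicator {0<..t} s * r s) \<partial>\<mu>)" for n
  proof -
    have sub: "indicator {grid t n k<..grid t n (Suc k)} s * (indicator {0<..t} s * r s) = indicator {grid t n k<..grid t n (Suc k)} s * r s"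
      if "k < n" for k s
      using grid_le[OF t0, of "Suc k" n] grid_nonneg[OF t0, of n k] that by (auto simp: indicator_def)
    have i: "integrable \<mu> (\<lambda>s. indicator {grid t n k<..grid t n (Suc k)} s * (indicator {0<..t} s * r s))" for k
      using integrable_mult_indicator[OF _ ri, of "{grid t n k<..grid t n (Suc k)}"] by (simp add: \<mu>)
    have "(\<integral>s. step n s * (indicator {0<..t} s * r s) \<partial>\<mu>)
      = (\<integral>s. (\<Sum>k<n. \<phi> (grid t n k) * (indicator {grid t n k<..grid t n (Suc k)} s * (indicator {0<..t} s * r s))) \<partial>\<mu>)"
      unfolding step_def sum_distrib_right mult.assoc ..
    also have "\<dots> = (\<Sum>k<n. \<phi> (grid t n k) * (\<integral>s. indicator {grid t n k<..grid t n (Suc k)} s * (indicator {0<..t} s * r s) \<partial>\<mu>))"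
      using i by (subst Bochner_Integration.integral_sum) auto
    also have "\<dots> = (\<Sum>k<n. \<phi> (grid t n k) * (LINT s:{grid t n k<..grid t n (Suc k)}|\<mu>. r s))"
      unfolding set_lebesgue_integral_def by (intro sum.cong) (auto simp: sub)
    finally show ?thesis by simp
  qed
  have "(\<lambda>n. \<integral>s. step (Suc n) s * (indicator {0<..t} s * r s) \<partial>\<mu>) \<longlonglongrightarrow> (\<integral>s. \<phi> s * (indicator {0<..t} s * r s) \<partial>\<mu>)"
  proof (rule integral_dominated_convergence[where w="\<lambda>s. \<bar>K\<bar> * \<bar>indicator {0<..t} s * r s\<bar>"])
    show "(\<lambda>s. step (Suc n) s * (indicator {0<..t} s * r s)) \<in> borel_measurable \<mu>" for n
      by (intro borel_measurable_times[OF stepm rm])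
    have lim: "(\<lambda>n. step (Suc n) s * (indicator {0<..t} s * r s)) \<longlonglongrightarrow> \<phi> s * (indicator {0<..t} s * r s)" for s
    proof (cases "s \<in> {0<..t}")
      case True
      from tendsto_mult[OF LIMSEQ_Suc[OF steplim[OF this]] tendsto_const] show ?thesis .
    qed simp
    then show "(\<lambda>s. \<phi> s * (indicator {0<..t} s * r s)) \<in> borel_measurable \<mu>"
      by (rule borel_measurable_LIMSEQ_real) (intro borel_measurable_times[OF stepm rm])
    show "AE s in \<mu>. (\<lambda>n. step (Suc n) s * (indicator {0<..t} s * r s)) \<longlonglongrightarrow> \<phi> s * (indicator {0<..t} s * r s)"
      using lim by simp
    show "integrable \<mu> (\<lambda>s. \<bar>K\<bar> * \<bar>indicator {0<..t} s * r s\<bar>)" using ri by (intro integrable_mult_right integrable_abs)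
    show "AE s in \<mu>. norm (step (Suc n) s * (indicator {0<..t} s * r s)) \<le> \<bar>K\<bar> * \<bar>indicator {0<..t} s * r s\<bar>" for n
    proof (rule AE_I2)
      fix s
      have "\<bar>step (Suc n) s\<bar> \<le> \<bar>K\<bar>" using stepK[of "Suc n" s] by (cases "s \<in> {0<..t}") auto
      then show "norm (step (Suc n) s * (indicator {0<..t} s * r s)) \<le> \<bar>K\<bar> * \<bar>indicator {0<..t} s * r s\<bar>"
        by (simp add: abs_mult mult_right_mono)
    qed
  qed
  then have "(\<lambda>n. \<Sum>k<Suc n. \<phi> (grid t (Suc n) k) * (LINT s:{grid t (Suc n) k<..grid t (Suc n) (Suc k)}|\<mu>. r s))
    \<longlonglongrightarrow> (LINT s:{0<..t}|\<mu>. \<phi> s * r s)"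
    unfolding eq by (simp add: set_lebesgue_integral_def mult_ac)
  then show ?thesis by (rule LIMSEQ_imp_Suc)
qed

lemma interval_measure_facts:
  assumes p: "mono p" "continuous_on UNIV p" and st: "s \<le> t"
  shows "(LINT u:{s<..t}|interval_measure p. (1::real)) = p t - p s"
    and "set_integrable (interval_measure p) {s<..t} (\<lambda>_. 1::real)"
proof -
  have m: "\<And>x y. x \<le> y \<Longrightarrow> p x \<le> p y" using p(1) by (simp add: mono_def)
  have c: "\<And>a. continuous (at_right a) p"
    using p(2) by (meson UNIV_I continuous_at_imp_continuous_within continuous_on_eq_continuous_at open_UNIV)
  have em: "emeasure (interval_measure p) {s<..t} = ennreal (p t - p s)"
    by (rule emeasure_interval_measure_Ioc[OF st m c])
  have fin: "emeasure (interval_measure p) {s<..t} < \<infinity>" by (simp add: em)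
  show "set_integrable (interval_measure p) {s<..t} (\<lambda>_. 1::real)"
    unfolding set_integrable_def using fin by (simp add: integrable_real_indicator)
  show "(LINT u:{s<..t}|interval_measure p. (1::real)) = p t - p s"
    unfolding set_lebesgue_integral_def using em m[OF st] by (simp add: measure_def)
qed

text \<open>Controls the process \<open>J\<close> of Tanaka's formula: integrating a sign produces
  no more variation than the integrator has.\<close>

lemma interval_measure_integral_diff:
  fixes k :: "real \<Rightarrow> real"
  assumes p: "mono p" "continuous_on UNIV p" and st: "0 \<le> s" "s \<le> t"
    and k: "set_integrable (interval_measure p) {0<..t} k" and K: "\<And>u. \<bar>k u\<bar> \<le> 1"
  shows "\<bar>(LINT u:{0<..t}|interval_measure p. k u) - (LINT u:{0<..s}|interval_measure p. k u)\<bar> \<le> p t - p s"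
proof -
  have "{0<..t} = {0<..s} \<union> {s<..t}" using st by auto
  then have "(LINT u:{0<..t}|interval_measure p. k u) = (LINT u:{0<..s}|interval_measure p. k u) + (LINT u:{s<..t}|interval_measure p. k u)"
    using st by (simp add: set_integral_Un[OF _ set_integrable_subset[OF k] set_integrable_subset[OF k]])
  moreover have "\<bar>LINT u:{s<..t}|interval_measure p. k u\<bar> \<le> (LINT u:{s<..t}|interval_measure p. 1)"
  proof -
    have i: "set_integrable (interval_measure p) {s<..t} k" by (rule set_integrable_subset[OF k]) (use st in auto)
    have "\<bar>LINT u:{s<..t}|interval_measure p. k u\<bar> \<le> (LINT u:{s<..t}|interval_measure p. \<bar>k u\<bar>)"
      using set_integral_norm_bound[OF i] by simp
    also have "\<dots> \<le> (LINT u:{s<..t}|interval_measure p. 1)"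
      using interval_measure_facts[OF p st(2)] K i by (intro set_integral_mono set_integrable_abs) auto
    finally show ?thesis .
  qed
  ultimately show ?thesis using interval_measure_facts(1)[OF p st(2)] by simp
qed

lemma lborel_integral_diff:
  fixes r :: "real \<Rightarrow> real"
  assumes r: "continuous_on {0..} r" and st: "0 \<le> s" "s \<le> t"
  shows "(LINT u:{s<..t}|lborel. r u) = (LINT u:{0..t}|lborel. r u) - (LINT u:{0..s}|lborel. r u)"
proof -
  have "(LINT u:{s<..t}|lborel. r u) = (LINT u:{s..t}|lborel. r u)"
    using interval_integral_Ioc[OF st(2), of r] interval_integral_Icc[OF st(2), of r] by simp
  also have "\<dots> = integral {s..t} r"
    by (intro set_borel_integral_eq_integral borel_integrable_atLeastAtMost' continuous_on_subset[OF r]) (use st in auto)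
  finally show ?thesis using path_integral_diff(1)[OF r st] by simp
qed

text \<open>Equal to \<open>1\<close> up to \<open>2 * d\<close> and to \<open>0\<close> from
  \<open>3 * d\<close> on. The corner lives on \<open>[0,d]\<close>, so a point at which
  \<open>1 - cutoff\<close> is nonzero keeps a distance of more than \<open>d\<close> from
  it.\<close>

definition cutoff :: "real \<Rightarrow> real \<Rightarrow> real" where
  "cutoff d x = max 0 (min 1 (3 - x / d))"

text \<open>Here \<open>y = z + v\<close> and \<open>y = y 0 + i + j + L\<close> are a semimartingale decomposition and
  Tanaka's formula along a single path. While \<open>y\<close> is near \<open>0\<close> its increments are read off both
  decompositions, with weights that produce half the increment of \<open>L\<close>; away from \<open>0\<close> they are read
  off the martingale problem for a Neumann function that agrees with the ramp there.\<close>

lemma excursion_path: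
  fixes y z v i j L A N p q r :: "real \<Rightarrow> real"
  assumes t: "0 < t" and d: "0 < d" "4 * d \<le> l / 2"
    and y: "continuous_on {0..} y"
    and yz: "\<And>u. 0 \<le> u \<Longrightarrow> y u = z u + v u"
    and yi: "\<And>u. 0 \<le> u \<Longrightarrow> y u = y 0 + i u + j u + L u"
    and v: "jordan_pair v p q"
    and j: "\<And>u. 0 \<le> u \<Longrightarrow> set_integrable (interval_measure p) {0<..u} (\<lambda>s. sgn_left (y s)) \<and>
        set_integrable (interval_measure q) {0<..u} (\<lambda>s. sgn_left (y s)) \<and>
        j u = (LINT s:{0<..u}|interval_measure p. sgn_left (y s)) - (LINT s:{0<..u}|interval_measure q. sgn_left (y s))"
    and L: "mono_on {0..} L" "continuous_on {0..} L"
    and r: "continuous_on {0..} r" "\<And>u. 0 \<le> u \<Longrightarrow> \<bar>r u\<bar> \<le> C"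
    and A: "\<And>s u. 0 \<le> s \<Longrightarrow> s \<le> u \<Longrightarrow> (\<And>w. w \<in> {s..u} \<Longrightarrow> d \<le> y w) \<Longrightarrow>
        A u - A s = (LINT s:{0..u}|lborel. r s) - (LINT s:{0..s}|lborel. r s)"
    and N: "\<And>u. 0 \<le> u \<Longrightarrow> N u = (ramp l (y u) - corner d (y u)) - ystart - A u"
  defines "D \<equiv> \<lambda>n k. (cutoff d (y (grid t n k)) - 1 / 2) * (z (grid t n (Suc k)) - z (grid t n k))
      + 1 / 2 * (i (grid t n (Suc k)) - i (grid t n k))
      + (1 - cutoff d (y (grid t n k))) * (N (grid t n (Suc k)) - N (grid t n k))"
  defines "U \<equiv> \<lambda>n k. ramp l (y (grid t n (Suc k))) - ramp l (y (grid t n k))"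
  shows "(\<lambda>n. \<Sum>k<n. D n k) \<longlonglongrightarrow> ramp l (y t) - ramp l (y 0)
      - ((LINT s:{0<..t}|interval_measure p. cutoff d (y s)) - (LINT s:{0<..t}|interval_measure q. cutoff d (y s)))
      + 1 / 2 * (v t - v 0 - j t) - 1 / 2 * (L t - L 0)
      - (LINT s:{0<..t}|lborel. (1 - cutoff d (y s)) * r s)"
    and "\<forall>\<^sub>F n in sequentially. \<forall>k\<le>n. (\<Sum>j<k. (D n j)\<^sup>2 - 2 * (U n j)\<^sup>2) \<le> 1"
proof -
  have t0: "0 \<le> t" using t by simp
  have pq: "mono p" "continuous_on UNIV p" "mono q" "continuous_on UNIV q" "\<And>u. 0 \<le> u \<Longrightarrow> v u = p u - q u"
    using v by (auto simp: jordan_pair_def)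
  have cut01: "0 \<le> cutoff d x" "cutoff d x \<le> 1" for x by (auto simp: cutoff_def)
  have cutc: "continuous_on S (cutoff d)" for S unfolding cutoff_def using d by (intro continuous_intros) auto
  have cutyc: "continuous_on {0..} (\<lambda>s. cutoff d (y s))"
    by (rule continuous_on_compose2[OF cutc y subset_UNIV])
  define A' where "A' u = (LINT s:{0..u}|lborel. r s)" for u
  define g where "g = grid t"
  have g0: "0 \<le> g n k" for n k by (simp add: g_def grid_nonneg t0)
  have gS: "g n k \<le> g n (Suc k)" for n k unfolding g_def by (rule grid_mono[OF t0]) simp
  define E where "E n k = - cutoff d (y (g n k)) * (v (g n (Suc k)) - v (g n k))
      + 1 / 2 * ((v (g n (Suc k)) - v (g n k)) - (j (g n (Suc k)) - j (g n k)))
      - 1 / 2 * (L (g n (Suc k)) - L (g n k))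
      - (1 - cutoff d (y (g n k))) * (A' (g n (Suc k)) - A' (g n k))" for n k
  have evD: "\<forall>\<^sub>F n in sequentially. \<forall>k<n. D n k = U n k + E n k"
  proof -
    \<comment> \<open>On such a mesh a step with nonzero cutoff starts below \<open>3 * d\<close>
      and stays below \<open>l / 2\<close>, where the ramp is the identity. A step with cutoff
      different from \<open>1\<close> starts above \<open>2 * d\<close> and stays above
      \<open>d\<close>, where the corner vanishes and \<open>A\<close> has density
      \<open>r\<close>.\<close>
    have "0 < d / 2" using d by simp
    from grid_uniform[OF y t0 this] show ?thesis
    proof eventually_elim
      case (elim n)
      show ?case
      proof (intro allI impI)
        fix k assume k: "k < n"
        let ?s = "g n k" and ?u = "g n (Suc k)"
        have near: "\<bar>y w - y ?s\<bar> \<le> d / 2" if "w \<in> {?s..?u}" for w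
          using elim k that by (auto simp: g_def)
        have su: "\<bar>y ?u - y ?s\<bar> \<le> d / 2" using near[of ?u] gS[of n k] by simp
        have 1: "cutoff d (y ?s) * (y ?u - y ?s) = cutoff d (y ?s) * U n k"
        proof (cases "cutoff d (y ?s) = 0")
          case False
          then have "y ?s < 3 * d" using d by (auto simp: cutoff_def max_def min_def field_simps split: if_splits)
          then have "y ?s \<le> l / 2" "y ?u \<le> l / 2" using d su by linarith+
          then show ?thesis by (simp add: U_def g_def[symmetric] ramp_near)
        qed simp
        have 2: "(1 - cutoff d (y ?s)) * (N ?u - N ?s) = (1 - cutoff d (y ?s)) * (U n k - (A' ?u - A' ?s))"
        proof (cases "cutoff d (y ?s) = 1")
          case False
          then have y2: "2 * d < y ?s" using d by (auto simp: cutoff_def max_def min_def field_simps split: if_splits)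
          have far: "d \<le> y w" if "w \<in> {?s..?u}" for w using near[OF that] y2 d by linarith
          have "A ?u - A ?s = A' ?u - A' ?s" unfolding A'_def by (rule A[OF g0 gS far])
          moreover have "corner d (y ?s) = 0" "corner d (y ?u) = 0"
            using corner_far(1)[OF d(1)] far gS[of n k] by auto
          ultimately show ?thesis by (simp add: N[OF g0] U_def g_def[symmetric])
        qed simp
        have 3: "z ?u - z ?s = (y ?u - y ?s) - (v ?u - v ?s)" using yz[OF g0] by simp
        have 4: "i ?u - i ?s = (y ?u - y ?s) - (j ?u - j ?s) - (L ?u - L ?s)"
          using yi[OF g0, of n k] yi[OF g0, of n "Suc k"] by simp
        \<comment> \<open>The contributions \<open>- 1 / 2\<close> and \<open>1 / 2\<close> of the
          increment of \<open>y\<close> cancel, which leaves the cutoff times this increment, paths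
          of finite variation, and half of the increment of \<open>L\<close>.\<close>
        have "D n k = cutoff d (y ?s) * (y ?u - y ?s) + (1 - cutoff d (y ?s)) * (N ?u - N ?s)
            - cutoff d (y ?s) * (v ?u - v ?s) + 1 / 2 * ((v ?u - v ?s) - (j ?u - j ?s)) - 1 / 2 * (L ?u - L ?s)"
          unfolding D_def g_def[symmetric] 3 4 by (simp add: field_simps)
        then show "D n k = U n k + E n k" unfolding 1 2 E_def by (simp add: algebra_simps)
      qed
    qed
  qed
  have cutsum: "(\<lambda>n. \<Sum>k<n. cutoff d (y (g n k)) * (w (g n (Suc k)) - w (g n k))) \<longlonglongrightarrow> (LINT s:{0<..t}|interval_measure w. cutoff d (y s))"
    if w: "mono w" "continuous_on UNIV w" for w
  proof -
    have "(\<lambda>n. \<Sum>k<n. cutoff d (y (grid t n k)) * (LINT s:{grid t n k<..grid t n (Suc k)}|interval_measure w. 1))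
        \<longlonglongrightarrow> (LINT s:{0<..t}|interval_measure w. cutoff d (y s) * 1)"
      by (rule stieltjes_sums[OF _ cutyc t interval_measure_facts(2)[OF w t0]]) simp
    then show ?thesis unfolding interval_measure_facts(1)[OF w gS[unfolded g_def]] by (simp add: g_def)
  qed
  have Asum: "(\<lambda>n. \<Sum>k<n. (1 - cutoff d (y (g n k))) * (A' (g n (Suc k)) - A' (g n k))) \<longlonglongrightarrow> (LINT s:{0<..t}|lborel. (1 - cutoff d (y s)) * r s)"
  proof -
    have ri: "set_integrable lborel {0<..t} r"
      by (rule set_integrable_subset[OF borel_integrable_atLeastAtMost'[of 0 t]])
         (auto intro: continuous_on_subset[OF r(1)])
    have "(\<lambda>n. \<Sum>k<n. (1 - cutoff d (y (grid t n k))) * (LINT s:{grid t n k<..grid t n (Suc k)}|lborel. r s))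
        \<longlonglongrightarrow> (LINT s:{0<..t}|lborel. (1 - cutoff d (y s)) * r s)"
      by (rule stieltjes_sums[OF _ _ t ri]) (auto intro!: continuous_intros cutyc)
    then show ?thesis unfolding lborel_integral_diff[OF r(1) g0[unfolded g_def] gS[unfolded g_def]]
      by (simp add: g_def A'_def)
  qed
  have tele: "(\<Sum>k<n. x (g n (Suc k)) - x (g n k)) = x t - x 0" if "0 < n" for n and x :: "real \<Rightarrow> real"
    using sum_lessThan_telescope[of "\<lambda>k. x (g n k)" n] that by (simp add: g_def)
  let ?R = "ramp l (y t) - ramp l (y 0)
      - ((LINT s:{0<..t}|interval_measure p. cutoff d (y s)) - (LINT s:{0<..t}|interval_measure q. cutoff d (y s)))
      + 1 / 2 * (v t - v 0 - j t) - 1 / 2 * (L t - L 0)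
      - (LINT s:{0<..t}|lborel. (1 - cutoff d (y s)) * r s)"
  have j0: "j 0 = 0" using j[of 0] by (simp add: set_lebesgue_integral_def)
  show "(\<lambda>n. \<Sum>k<n. D n k) \<longlonglongrightarrow> ?R"
  proof (rule Lim_transform_eventually)
    show "(\<lambda>n. ramp l (y t) - ramp l (y 0)
      - ((\<Sum>k<n. cutoff d (y (g n k)) * (p (g n (Suc k)) - p (g n k))) - (\<Sum>k<n. cutoff d (y (g n k)) * (q (g n (Suc k)) - q (g n k))))
      + 1 / 2 * (v t - v 0 - j t) - 1 / 2 * (L t - L 0)
      - (\<Sum>k<n. (1 - cutoff d (y (g n k))) * (A' (g n (Suc k)) - A' (g n k)))) \<longlonglongrightarrow> ?R"
      by (intro tendsto_intros cutsum Asum pq)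
    show "\<forall>\<^sub>F n in sequentially. ramp l (y t) - ramp l (y 0)
      - ((\<Sum>k<n. cutoff d (y (g n k)) * (p (g n (Suc k)) - p (g n k))) - (\<Sum>k<n. cutoff d (y (g n k)) * (q (g n (Suc k)) - q (g n k))))
      + 1 / 2 * (v t - v 0 - j t) - 1 / 2 * (L t - L 0)
      - (\<Sum>k<n. (1 - cutoff d (y (g n k))) * (A' (g n (Suc k)) - A' (g n k))) = (\<Sum>k<n. D n k)"
      using evD eventually_gt_at_top[of 0]
    proof eventually_elim
      case (elim n)
      have "(\<Sum>k<n. D n k) = (\<Sum>k<n. U n k + E n k)" using elim by (intro sum.cong) auto
      also have "\<dots> = (\<Sum>k<n. U n k) - (\<Sum>k<n. cutoff d (y (g n k)) * (v (g n (Suc k)) - v (g n k)))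
          + 1 / 2 * ((\<Sum>k<n. v (g n (Suc k)) - v (g n k)) - (\<Sum>k<n. j (g n (Suc k)) - j (g n k)))
          - 1 / 2 * (\<Sum>k<n. L (g n (Suc k)) - L (g n k))
          - (\<Sum>k<n. (1 - cutoff d (y (g n k))) * (A' (g n (Suc k)) - A' (g n k)))"
        unfolding E_def sum_distrib_left sum_subtractf[symmetric] sum.distrib[symmetric]
        by (rule sum.cong) (auto simp: algebra_simps)
      also have "(\<Sum>k<n. U n k) = ramp l (y t) - ramp l (y 0)"
        unfolding U_def g_def[symmetric] using tele[OF elim(2), of "\<lambda>u. ramp l (y u)"] .
      also have "(\<Sum>k<n. cutoff d (y (g n k)) * (v (g n (Suc k)) - v (g n k)))
         = (\<Sum>k<n. cutoff d (y (g n k)) * (p (g n (Suc k)) - p (g n k))) - (\<Sum>k<n. cutoff d (y (g n k)) * (q (g n (Suc k)) - q (g n k)))"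
        unfolding sum_subtractf[symmetric] by (rule sum.cong) (auto simp: pq(5)[OF g0] algebra_simps)
      finally show ?case unfolding tele[OF elim(2)] using j0 by (simp add: algebra_simps)
    qed
  qed
  \<comment> \<open>A continuous nondecreasing majorant of the variation of \<open>E\<close>. One
    copy of \<open>p + q\<close> pays for the term with the cutoff, the other for half the
    difference of \<open>v\<close> and \<open>j\<close>.\<close>
  define \<Phi> where "\<Phi> u = 2 * (p u + q u) + 1 / 2 * L u + \<bar>C\<bar> * u" for u
  have \<Phi>c: "continuous_on {0..} \<Phi>" unfolding \<Phi>_def
    by (intro continuous_intros L continuous_on_subset[OF pq(2)] continuous_on_subset[OF pq(4)]) auto
  have sgn1: "\<bar>sgn_left x\<bar> \<le> 1" for x by (simp add: sgn_left_def)
  have aux: "\<bar>- a + w - x - f\<bar> \<le> P + P + x + R"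
    if "\<bar>a\<bar> \<le> P" "\<bar>f\<bar> \<le> R" "\<bar>w\<bar> \<le> P" "0 \<le> x" for a w x f P R :: real
    using that by linarith
  have Ebound: "\<bar>E n k\<bar> \<le> \<Phi> (g n (Suc k)) - \<Phi> (g n k)" for n k
  proof -
    let ?s = "g n k" and ?u = "g n (Suc k)"
    have pm: "p ?s \<le> p ?u" "q ?s \<le> q ?u" using pq gS[of n k] by (auto simp: mono_def)
    have v1: "\<bar>v ?u - v ?s\<bar> \<le> (p ?u - p ?s) + (q ?u - q ?s)" using pm by (simp add: pq(5)[OF g0])
    have j1: "\<bar>j ?u - j ?s\<bar> \<le> (p ?u - p ?s) + (q ?u - q ?s)"
    proof -
      note ju = j[OF g0[of n "Suc k"]] and js = j[OF g0[of n k]]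
      note a = interval_measure_integral_diff[OF pq(1,2) g0 gS conjunct1[OF ju] sgn1]
      note b = interval_measure_integral_diff[OF pq(3,4) g0 gS conjunct1[OF conjunct2[OF ju]] sgn1]
      from a b show ?thesis using ju js by linarith
    qed
    have L1: "0 \<le> L ?u - L ?s" using mono_onD[OF L(1), of ?s ?u] g0 gS by simp
    have A1: "\<bar>A' ?u - A' ?s\<bar> \<le> \<bar>C\<bar> * (?u - ?s)"
      unfolding A'_def
    proof (rule path_integral_bounds(3)[OF r(1) g0 gS])
      fix u assume "u \<in> {?s..?u}"
      then have "0 \<le> u" using g0[of n k] by simp
      from r(2)[OF this] show "\<bar>r u\<bar> \<le> \<bar>C\<bar>" by linarith
    qed
    have "\<bar>cutoff d (y ?s) * (v ?u - v ?s)\<bar> \<le> 1 * ((p ?u - p ?s) + (q ?u - q ?s))"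
      unfolding abs_mult using cut01[of "y ?s"] v1 by (intro mult_mono) auto
    moreover have "\<bar>(1 - cutoff d (y ?s)) * (A' ?u - A' ?s)\<bar> \<le> 1 * (\<bar>C\<bar> * (?u - ?s))"
      unfolding abs_mult using cut01[of "y ?s"] A1 by (intro mult_mono) auto
    moreover have "\<bar>1 / 2 * ((v ?u - v ?s) - (j ?u - j ?s))\<bar> \<le> 1 * ((p ?u - p ?s) + (q ?u - q ?s))"
    proof -
      have "\<bar>(v ?u - v ?s) - (j ?u - j ?s)\<bar> \<le> 2 * ((p ?u - p ?s) + (q ?u - q ?s))"
        unfolding mult_2 by (rule order_trans[OF abs_triangle_ineq4 add_mono[OF v1 j1]])
      then show ?thesis unfolding abs_mult by simp
    qed
    moreover have "0 \<le> 1 / 2 * (L ?u - L ?s)" using L1 by simp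
    ultimately have "\<bar>E n k\<bar> \<le> 1 * ((p ?u - p ?s) + (q ?u - q ?s)) + 1 * ((p ?u - p ?s) + (q ?u - q ?s))
       + 1 / 2 * (L ?u - L ?s) + 1 * (\<bar>C\<bar> * (?u - ?s))"
      unfolding E_def mult_minus_left by (rule aux)
    also have "\<dots> = \<Phi> ?u - \<Phi> ?s" by (simp add: \<Phi>_def algebra_simps)
    finally show ?thesis .
  qed
  then have \<Phi>mono: "0 \<le> \<Phi> (g n (Suc k)) - \<Phi> (g n k)" for n k by (meson abs_ge_zero order_trans)
  \<comment> \<open>Chosen so that \<open>2 * \<epsilon> * \<bar>\<Phi> t - \<Phi> 0\<bar>\<close>
    is at most \<open>1\<close>; the added \<open>1\<close> excludes division by zero.\<close>
  define \<epsilon> where "\<epsilon> = 1 / (2 * \<bar>\<Phi> t - \<Phi> 0\<bar> + 1)"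
  have e: "0 < \<epsilon>" by (simp add: \<epsilon>_def add_nonneg_pos)
  show "\<forall>\<^sub>F n in sequentially. \<forall>k\<le>n. (\<Sum>j<k. (D n j)\<^sup>2 - 2 * (U n j)\<^sup>2) \<le> 1"
    using evD grid_uniform[OF \<Phi>c t0 e] eventually_gt_at_top[of 0]
  proof eventually_elim
    case (elim n)
    show ?case
    proof (intro allI impI)
      fix k assume k: "k \<le> n"
      have "(\<Sum>j<k. (D n j)\<^sup>2 - 2 * (U n j)\<^sup>2) \<le> (\<Sum>j<k. 2 * \<epsilon> * (\<Phi> (g n (Suc j)) - \<Phi> (g n j)))"
      proof (rule sum_mono)
        fix j assume "j \<in> {..<k}"
        then have jn: "j < n" using k by simp
        have De: "D n j = U n j + E n j" using elim(1) jn by simp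
        \<comment> \<open>This is
          \<open>(U + E)\<^sup>2 \<le> 2 * U\<^sup>2 + 2 * E\<^sup>2\<close>, the origin of the
          factor \<open>2\<close> before the squares of \<open>U\<close>. The squares of
          \<open>E\<close> sum to little, since its increments are uniformly small and its total
          variation is bounded by \<open>\<Phi>\<close>.\<close>
        have "0 \<le> (U n j - E n j)\<^sup>2" by simp
        then have "(D n j)\<^sup>2 - 2 * (U n j)\<^sup>2 \<le> 2 * (E n j)\<^sup>2"
          unfolding De by (simp add: power2_eq_square algebra_simps)
        also have "(E n j)\<^sup>2 = \<bar>E n j\<bar> * \<bar>E n j\<bar>" by (simp add: power2_eq_square)
        also have "\<bar>E n j\<bar> * \<bar>E n j\<bar> \<le> \<epsilon> * (\<Phi> (g n (Suc j)) - \<Phi> (g n j))"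
        proof (rule mult_mono)
          have "\<bar>\<Phi> (g n (Suc j)) - \<Phi> (g n j)\<bar> \<le> \<epsilon>"
            using elim(2) jn gS[of n j] by (auto simp: g_def)
          then show "\<bar>E n j\<bar> \<le> \<epsilon>" using Ebound[of n j] by linarith
        qed (use Ebound e in auto)
        finally show "(D n j)\<^sup>2 - 2 * (U n j)\<^sup>2 \<le> 2 * \<epsilon> * (\<Phi> (g n (Suc j)) - \<Phi> (g n j))" by simp
      qed
      also have "\<dots> \<le> (\<Sum>j<n. 2 * \<epsilon> * (\<Phi> (g n (Suc j)) - \<Phi> (g n j)))"
        using k e \<Phi>mono by (intro sum_mono2) (auto intro!: mult_nonneg_nonneg)
      also have "\<dots> = 2 * \<epsilon> * (\<Phi> t - \<Phi> 0)"
        unfolding sum_distrib_left[symmetric] tele[OF elim(3)] ..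
      also have "\<dots> \<le> 2 * \<epsilon> * \<bar>\<Phi> t - \<Phi> 0\<bar>" using e by (intro mult_left_mono) auto
      also have "\<dots> \<le> 1" by (simp add: \<epsilon>_def divide_le_eq add_nonneg_pos)
      finally show "(\<Sum>j<k. (D n j)\<^sup>2 - 2 * (U n j)\<^sup>2) \<le> 1" .
    qed
  qed
qed

section \<open>Localisation\<close>

context usual_prob_space
begin

text \<open>\<open>K\<close> is at once the level and a cap that keeps the time finite. For
  continuous paths \<open>u < \<tau>\<close> means that \<open>u < K\<close> and \<open>m\<close>
  stays strictly below the level on \<open>[0,u]\<close>. By compactness the latter is a bound with
  margin \<open>1 / (n + 1)\<close> for some \<open>n\<close> at countably many times, so the event
  is known at time \<open>u\<close>.\<close>

lemma hitting_time_exists: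
  fixes m :: "real \<Rightarrow> 'a \<Rightarrow> real"
  assumes m: "adapted_process F m" "continuous_paths M m" and K: "0 < K"
    and m0: "\<And>\<omega>. \<omega> \<in> space M \<Longrightarrow> m 0 \<omega> \<le> K"
  obtains \<tau> where "\<And>\<omega>. \<omega> \<in> space M \<Longrightarrow> 0 \<le> \<tau> \<omega>"
    and "\<And>u. 0 \<le> u \<Longrightarrow> {\<omega>\<in>space M. u < \<tau> \<omega>} \<in> sets (F u)"
    and "\<And>\<omega> u. \<omega> \<in> space M \<Longrightarrow> 0 \<le> u \<Longrightarrow> m (min u (\<tau> \<omega>)) \<omega> \<le> K"
    and "\<And>\<omega> u. \<omega> \<in> space M \<Longrightarrow> 0 \<le> u \<Longrightarrow> u < K \<Longrightarrow> (\<And>r. r \<in> {0..u} \<Longrightarrow> m r \<omega> < K) \<Longrightarrow> u < \<tau> \<omega>"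
proof -
  define H where "H \<omega> = {u. 0 \<le> u \<and> K \<le> m u \<omega>}" for \<omega>
  define \<tau> where "\<tau> \<omega> = Inf (insert K (H \<omega>))" for \<omega>
  have mc: "continuous_on {0..} (\<lambda>u. m u \<omega>)" if "\<omega> \<in> space M" for \<omega>
    using m(2) that by (simp add: continuous_paths_def)
  have bdd: "bdd_below (insert K (H \<omega>))" for \<omega>
    using K by (intro bdd_belowI[of _ 0]) (auto simp: H_def)
  have \<tau>0: "0 \<le> \<tau> \<omega>" for \<omega> unfolding \<tau>_def using K by (intro cInf_greatest) (auto simp: H_def)
  have dir1: "u < K \<and> (\<forall>r\<in>{0..u}. m r \<omega> < K)" if "u < \<tau> \<omega>" for u \<omega>
  proof -
    have "u < x" if "x \<in> insert K (H \<omega>)" for x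
      using cInf_lower[OF that bdd] \<open>u < \<tau> \<omega>\<close> by (simp add: \<tau>_def)
    then show ?thesis by (force simp: H_def not_le[symmetric])
  qed
  have dir2: "u < \<tau> \<omega>" if w: "\<omega> \<in> space M" and u: "0 \<le> u" "u < K" and r: "\<And>r. r \<in> {0..u} \<Longrightarrow> m r \<omega> < K" for u \<omega>
  proof -
    have "closed ({0..} \<inter> (\<lambda>u. m u \<omega>) -` {K..})"
      by (intro continuous_closed_preimage mc w) auto
    also have "{0..} \<inter> (\<lambda>u. m u \<omega>) -` {K..} = H \<omega>" by (auto simp: H_def)
    finally have "closed (insert K (H \<omega>))" by (rule closed_insert)
    from closed_contains_Inf[OF _ bdd this] have "\<tau> \<omega> \<in> insert K (H \<omega>)" by (simp add: \<tau>_def)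
    then show ?thesis using r[of "\<tau> \<omega>"] u by (auto simp: H_def not_le[symmetric])
  qed
  have iff: "u < \<tau> \<omega> \<longleftrightarrow> u < K \<and> (\<forall>r\<in>{0..u}. m r \<omega> < K)" if "\<omega> \<in> space M" "0 \<le> u" for u \<omega>
    using dir1 dir2[OF that] by blast
  \<comment> \<open>Quotients of naturals clipped at \<open>u\<close> form a countable set that is
    contained and dense in \<open>[0,u]\<close>.\<close>
  define Q where "Q u = (\<lambda>(a::nat, b::nat). min u (real a / real b)) ` UNIV" for u :: real
  have Qc: "countable (Q u)" for u unfolding Q_def by (intro countable_image) simp
  have Qi: "Q u \<subseteq> {0..u}" if "0 \<le> u" for u using that by (auto simp: Q_def)
  have dense: "(\<forall>r\<in>{0..u}. m r \<omega> < K) \<longleftrightarrow> (\<exists>n::nat. \<forall>r\<in>Q u. m r \<omega> \<le> K - 1 / real (Suc n))"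
    if w: "\<omega> \<in> space M" and u: "0 \<le> u" for u \<omega>
  proof
    assume lt: "\<forall>r\<in>{0..u}. m r \<omega> < K"
    have "\<exists>x\<in>{0..u}. \<forall>y\<in>{0..u}. m y \<omega> \<le> m x \<omega>"
      by (rule continuous_attains_sup) (use u continuous_on_subset[OF mc[OF w]] in auto)
    then obtain x where x: "x \<in> {0..u}" "\<And>y. y \<in> {0..u} \<Longrightarrow> m y \<omega> \<le> m x \<omega>" by blast
    then have "0 < K - m x \<omega>" using lt by auto
    from nat_approx_posE[OF this] obtain n where "1 / real (Suc n) < K - m x \<omega>" by blast
    then have "\<forall>r\<in>Q u. m r \<omega> \<le> K - 1 / real (Suc n)" using x(2) Qi[OF u] by force
    then show "\<exists>n::nat. \<forall>r\<in>Q u. m r \<omega> \<le> K - 1 / real (Suc n)" by blast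
  next
    assume "\<exists>n::nat. \<forall>r\<in>Q u. m r \<omega> \<le> K - 1 / real (Suc n)"
    then obtain n :: nat where n: "\<And>r. r \<in> Q u \<Longrightarrow> m r \<omega> \<le> K - 1 / real (Suc n)" by blast
    show "\<forall>r\<in>{0..u}. m r \<omega> < K"
    proof
      fix r assume r: "r \<in> {0..u}"
      \<comment> \<open>Rounding down keeps the approximations of \<open>r\<close> below
        \<open>u\<close>, so the clipping in \<open>Q u\<close> does not alter them.\<close>
      define a where "a k = real (nat \<lfloor>r * real (Suc k)\<rfloor>) / real (Suc k)" for k
      have a: "a k \<le> r" "r - 1 / real (Suc k) \<le> a k" for k
      proof -
        have nn: "0 \<le> r * real (Suc k)" using r by simp
        have "real (nat \<lfloor>r * real (Suc k)\<rfloor>) \<le> r * real (Suc k)" using nn by linarith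
        then show "a k \<le> r" by (simp add: a_def divide_le_eq del: of_nat_Suc)
        have "r * real (Suc k) - 1 \<le> real (nat \<lfloor>r * real (Suc k)\<rfloor>)" using nn by linarith
        then have "(r * real (Suc k) - 1) / real (Suc k) \<le> a k" unfolding a_def by (rule divide_right_mono) simp
        then show "r - 1 / real (Suc k) \<le> a k" by (simp add: diff_divide_distrib del: of_nat_Suc)
      qed
      have aQ: "a k \<in> Q u" for k
      proof -
        have "a k = min u (real (nat \<lfloor>r * real (Suc k)\<rfloor>) / real (Suc k))" using a(1)[of k] r by (simp add: a_def)
        then show ?thesis unfolding Q_def by (metis (no_types, lifting) UNIV_I case_prod_conv image_eqI)
      qed
      have "a \<longlonglongrightarrow> r"
      proof (rule tendsto_sandwich)
        show "(\<lambda>k. r - 1 / real (Suc k)) \<longlonglongrightarrow> r"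
          using tendsto_diff[OF tendsto_const[of r] LIMSEQ_Suc[OF lim_const_over_n[of 1]]] by simp
      qed (use a in auto)
      moreover have "a k \<in> {0..}" for k using aQ[of k] Qi[OF u] by auto
      ultimately have "(\<lambda>k. m (a k) \<omega>) \<longlonglongrightarrow> m r \<omega>"
        using r by (intro continuous_on_tendsto_compose[OF mc[OF w]] always_eventually allI) auto
      then have "m r \<omega> \<le> K - 1 / real (Suc n)" by (rule LIMSEQ_le_const2) (use n[OF aQ] in auto)
      then show "m r \<omega> < K" by (smt (verit) divide_pos_pos of_nat_0_less_iff zero_less_Suc)
    qed
  qed
  show ?thesis
  proof (rule that[of \<tau>])
    show "{\<omega>\<in>space M. u < \<tau> \<omega>} \<in> sets (F u)" if u: "0 \<le> u" for u
    proof -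
      have mm: "m r \<in> borel_measurable (F u)" if "r \<in> Q u" for r
      proof -
        have r: "0 \<le> r" "r \<le> u" using Qi[OF u] that by auto
        then have "m r \<in> borel_measurable (F r)" using m(1) by (simp add: adapted_process_def)
        then show ?thesis using r(2) by (rule measurable_F_mono)
      qed
      have "{\<omega>\<in>space M. u < \<tau> \<omega>} = {\<omega>\<in>space (F u). u < K \<and> (\<exists>n::nat. \<forall>r\<in>Q u. m r \<omega> \<le> K - 1 / real (Suc n))}"
        using iff[OF _ u] dense[OF _ u] by auto
      also have "\<dots> \<in> sets (F u)"
        unfolding pred_def[symmetric] using Qc mm
        by (intro pred_intros_logic pred_intros_countable pred_intros_countable_bounded)
           (auto simp: pred_def simp del: space_F intro!: borel_measurable_le)
      finally show ?thesis .
    qed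
    show "m (min u (\<tau> \<omega>)) \<omega> \<le> K" if w: "\<omega> \<in> space M" and u: "0 \<le> u" for \<omega> u
    proof (cases "u < \<tau> \<omega>")
      case True
      have "m u \<omega> < K" using dir1[OF True] u by simp
      then show ?thesis using True by simp
    next
      case False
      \<comment> \<open>The level may be attained at \<open>\<tau>\<close> itself. The bound there
        is a limit of values strictly before \<open>\<tau>\<close>, or the initial bound if
        \<open>\<tau> \<omega>\<close> is \<open>0\<close>.\<close>
      have "m (\<tau> \<omega>) \<omega> \<le> K"
      proof (cases "\<tau> \<omega> = 0")
        case True then show ?thesis using m0[OF w] by simp
      next
        case False
        then have pos: "0 < \<tau> \<omega>" using \<tau>0[of \<omega>] by simp
        have "(\<lambda>n. \<tau> \<omega> - \<tau> \<omega> / real (Suc n)) \<longlonglongrightarrow> \<tau> \<omega>"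
          using tendsto_diff[OF tendsto_const LIMSEQ_Suc[OF lim_const_over_n[of "\<tau> \<omega>"]], of "\<tau> \<omega>"] by simp
        moreover have in0: "0 \<le> \<tau> \<omega> - \<tau> \<omega> / real (Suc n)" for n using pos by (simp add: divide_le_eq)
        ultimately have "(\<lambda>n. m (\<tau> \<omega> - \<tau> \<omega> / real (Suc n)) \<omega>) \<longlonglongrightarrow> m (\<tau> \<omega>) \<omega>"
          by (intro continuous_on_tendsto_compose[OF mc[OF w]]) (use pos in auto)
        moreover have "m (\<tau> \<omega> - \<tau> \<omega> / real (Suc n)) \<omega> \<le> K" for n
        proof -
          have "\<tau> \<omega> - \<tau> \<omega> / real (Suc n) < \<tau> \<omega>" using pos by simp
          then have "\<forall>r\<in>{0..\<tau> \<omega> - \<tau> \<omega> / real (Suc n)}. m r \<omega> < K" using dir1 by blast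
          moreover have "\<tau> \<omega> - \<tau> \<omega> / real (Suc n) \<in> {0..\<tau> \<omega> - \<tau> \<omega> / real (Suc n)}"
            using in0[of n] unfolding atLeastAtMost_iff by blast
          ultimately show ?thesis by (blast intro: less_imp_le)
        qed
        ultimately show ?thesis by (intro LIMSEQ_le_const2) auto
      qed
      then show ?thesis using False by (simp add: min_def)
    qed
  qed (use \<tau>0 dir2 in auto)
qed

text \<open>The factor in the localised martingale that cuts out the paths with \<open>T n = 0\<close> is
  harmless, since only increments are tested.\<close>

lemma clm_stopped_increment:
  assumes Z: "continuous_paths M Z" and T: "\<And>\<omega>. \<omega> \<in> space M \<Longrightarrow> 0 \<le> T \<omega>"
    and mart: "martingale M F (\<lambda>t \<omega>. if 0 < T \<omega> then Z (min t (T \<omega>)) \<omega> else 0)"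
    and S: "\<And>u. 0 \<le> u \<Longrightarrow> {\<omega>\<in>space M. u < S \<omega>} \<in> sets (F u)"
    and ST: "\<And>\<omega>. \<omega> \<in> space M \<Longrightarrow> 0 \<le> S \<omega> \<and> S \<omega> \<le> T \<omega>"
    and bound: "\<And>\<omega> u. \<omega> \<in> space M \<Longrightarrow> 0 \<le> u \<Longrightarrow> \<bar>Z (min u (S \<omega>)) \<omega> - Z 0 \<omega>\<bar> \<le> K"
    and st: "0 \<le> s" "s \<le> t"
    and \<eta>: "\<eta> \<in> borel_measurable (F s)" "\<And>\<omega>. \<omega> \<in> space M \<Longrightarrow> \<bar>\<eta> \<omega>\<bar> \<le> C"
  shows "(\<integral>\<omega>. \<eta> \<omega> * (Z (min t (S \<omega>)) \<omega> - Z (min s (S \<omega>)) \<omega>) \<partial>M) = 0"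
proof -
  define X where "X t \<omega> = (if 0 < T \<omega> then Z (min t (T \<omega>)) \<omega> else 0)" for t \<omega>
  have Xc: "continuous_paths M X"
    unfolding continuous_paths_def
  proof
    fix \<omega> assume w: "\<omega> \<in> space M"
    have "continuous_on {0..} (\<lambda>u. Z u \<omega>)" using Z w by (simp add: continuous_paths_def)
    then have "continuous_on {0..} (\<lambda>t. Z (min t (T \<omega>)) \<omega>)"
      by (rule continuous_on_compose2) (use T[OF w] in \<open>auto intro!: continuous_intros\<close>)
    then show "continuous_on {0..} (\<lambda>t. X t \<omega>)" unfolding X_def by (cases "0 < T \<omega>") auto
  qed
  have XS: "X (min u (S \<omega>)) \<omega> = (if 0 < T \<omega> then Z (min u (S \<omega>)) \<omega> else 0)" if "\<omega> \<in> space M" for u \<omega>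
    using ST[OF that] by (simp add: X_def min.assoc min_absorb1)
  have X0: "X 0 \<omega> = (if 0 < T \<omega> then Z 0 \<omega> else 0)" for \<omega> by (simp add: X_def)
  have K0: "0 \<le> K" if "\<omega> \<in> space M" for \<omega> using bound[OF that order_refl] by linarith
  have "(\<integral>\<omega>. \<eta> \<omega> * (X (min t (S \<omega>)) \<omega> - X (min s (S \<omega>)) \<omega>) \<partial>M) = 0"
  proof (rule optional_stopping[OF _ Xc S _ _ st \<eta>])
    show "martingale M F X" using mart by (simp add: X_def [abs_def])
    show "\<bar>X (min u (S \<omega>)) \<omega> - X 0 \<omega>\<bar> \<le> K" if "\<omega> \<in> space M" "0 \<le> u" for \<omega> u
      using bound[OF that] K0[OF that(1)] by (simp add: XS[OF that(1)] X0)
  qed (use ST in auto)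
  also have "(\<integral>\<omega>. \<eta> \<omega> * (X (min t (S \<omega>)) \<omega> - X (min s (S \<omega>)) \<omega>) \<partial>M)
    = (\<integral>\<omega>. \<eta> \<omega> * (Z (min t (S \<omega>)) \<omega> - Z (min s (S \<omega>)) \<omega>) \<partial>M)"
  proof (rule Bochner_Integration.integral_cong[OF refl])
    fix \<omega> assume w: "\<omega> \<in> space M"
    show "\<eta> \<omega> * (X (min t (S \<omega>)) \<omega> - X (min s (S \<omega>)) \<omega>) = \<eta> \<omega> * (Z (min t (S \<omega>)) \<omega> - Z (min s (S \<omega>)) \<omega>)"
    proof (cases "0 < T \<omega>")
      case False
      then have "S \<omega> = 0" using ST[OF w] by linarith
      then show ?thesis using st by simp
    qed (simp add: XS[OF w])
  qed
  finally show ?thesis .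
qed

text \<open>One sequence has to serve both processes, because the transform mixes their increments.
  It is the minimum of the two given localizing times and of the time at which the larger
  displacement hits the level \<open>Suc n\<close>. Optional stopping carries the orthogonality over
  to the minimum.\<close>

lemma localize_pair:
  assumes Z: "continuous_local_martingale M F Z" and I: "continuous_local_martingale M F I"
  obtains S :: "nat \<Rightarrow> 'a \<Rightarrow> real" where
    "\<And>n \<omega>. \<omega> \<in> space M \<Longrightarrow> 0 \<le> S n \<omega>"
    "\<And>n u. 0 \<le> u \<Longrightarrow> {\<omega>\<in>space M. u < S n \<omega>} \<in> sets (F u)"
    "\<And>X n \<omega> u. X = Z \<or> X = I \<Longrightarrow> \<omega> \<in> space M \<Longrightarrow> 0 \<le> u \<Longrightarrow> \<bar>X (min u (S n \<omega>)) \<omega> - X 0 \<omega>\<bar> \<le> real (Suc n)"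
    "\<And>X n s t \<eta> C. X = Z \<or> X = I \<Longrightarrow> 0 \<le> s \<Longrightarrow> s \<le> t \<Longrightarrow> \<eta> \<in> borel_measurable (F s) \<Longrightarrow>
        (\<And>\<omega>. \<omega> \<in> space M \<Longrightarrow> \<bar>\<eta> \<omega>\<bar> \<le> C) \<Longrightarrow>
        (\<integral>\<omega>. \<eta> \<omega> * (X (min t (S n \<omega>)) \<omega> - X (min s (S n \<omega>)) \<omega>) \<partial>M) = 0"
    "AE \<omega> in M. \<forall>t\<ge>0. \<forall>\<^sub>F n in sequentially. t < S n \<omega>"
proof -
  from Z obtain TZ :: "nat \<Rightarrow> 'a \<Rightarrow> real" where TZ': "\<forall>n. stopping_time F (TZ n)"
    "\<forall>n. \<forall>\<omega>\<in>space M. 0 \<le> TZ n \<omega> \<and> TZ n \<omega> \<le> TZ (Suc n) \<omega>"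
    "AE \<omega> in M. filterlim (\<lambda>n. TZ n \<omega>) at_top sequentially"
    "\<forall>n. martingale M F (\<lambda>t \<omega>. if 0 < TZ n \<omega> then Z (min t (TZ n \<omega>)) \<omega> else 0)"
    unfolding continuous_local_martingale_def by (elim conjE exE)
  note TZ = TZ'(1)[rule_format] TZ'(2)[rule_format, THEN conjunct1] TZ'(3) TZ'(4)[rule_format]
  from I obtain TI :: "nat \<Rightarrow> 'a \<Rightarrow> real" where TI': "\<forall>n. stopping_time F (TI n)"
    "\<forall>n. \<forall>\<omega>\<in>space M. 0 \<le> TI n \<omega> \<and> TI n \<omega> \<le> TI (Suc n) \<omega>"
    "AE \<omega> in M. filterlim (\<lambda>n. TI n \<omega>) at_top sequentially"
    "\<forall>n. martingale M F (\<lambda>t \<omega>. if 0 < TI n \<omega> then I (min t (TI n \<omega>)) \<omega> else 0)"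
    unfolding continuous_local_martingale_def by (elim conjE exE)
  note TI = TI'(1)[rule_format] TI'(2)[rule_format, THEN conjunct1] TI'(3) TI'(4)[rule_format]
  define m where "m u \<omega> = max \<bar>Z u \<omega> - Z 0 \<omega>\<bar> \<bar>I u \<omega> - I 0 \<omega>\<bar>" for u \<omega>
  have Zac: "adapted_process F Z" "continuous_paths M Z" and Iac: "adapted_process F I" "continuous_paths M I"
    using Z I by (auto simp: continuous_local_martingale_def)
  have am: "X u \<in> borel_measurable (F t)" if "adapted_process F X" "0 \<le> u" "u \<le> t" for X u t
    using that by (auto simp: adapted_process_def intro: measurable_F_mono)
  have ma: "adapted_process F m" unfolding adapted_process_def
  proof (intro allI impI)
    fix t :: real assume t: "0 \<le> t"
    have [measurable]: "Z t \<in> borel_measurable (F t)" "Z 0 \<in> borel_measurable (F t)"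
      "I t \<in> borel_measurable (F t)" "I 0 \<in> borel_measurable (F t)"
      using t am[OF Zac(1)] am[OF Iac(1)] by auto
    show "m t \<in> borel_measurable (F t)" unfolding m_def by measurable
  qed
  have mc: "continuous_paths M m"
    using Zac(2) Iac(2) unfolding continuous_paths_def m_def by (auto intro!: continuous_intros)
  have "\<exists>\<tau>. (\<forall>\<omega>\<in>space M. 0 \<le> \<tau> \<omega>) \<and> (\<forall>u\<ge>0. {\<omega>\<in>space M. u < \<tau> \<omega>} \<in> sets (F u)) \<and>
      (\<forall>\<omega>\<in>space M. \<forall>u\<ge>0. m (min u (\<tau> \<omega>)) \<omega> \<le> real (Suc n)) \<and>
      (\<forall>\<omega>\<in>space M. \<forall>u\<ge>0. u < real (Suc n) \<longrightarrow> (\<forall>r\<in>{0..u}. m r \<omega> < real (Suc n)) \<longrightarrow> u < \<tau> \<omega>)" for n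
  proof (rule hitting_time_exists[OF ma mc, of "real (Suc n)"])
    show "m 0 \<omega> \<le> real (Suc n)" for \<omega> by (simp add: m_def)
    fix \<tau> assume "\<And>\<omega>. \<omega> \<in> space M \<Longrightarrow> 0 \<le> \<tau> \<omega>"
      and "\<And>u. 0 \<le> u \<Longrightarrow> {\<omega>\<in>space M. u < \<tau> \<omega>} \<in> sets (F u)"
      and "\<And>\<omega> u. \<omega> \<in> space M \<Longrightarrow> 0 \<le> u \<Longrightarrow> m (min u (\<tau> \<omega>)) \<omega> \<le> real (Suc n)"
      and "\<And>\<omega> u. \<omega> \<in> space M \<Longrightarrow> 0 \<le> u \<Longrightarrow> u < real (Suc n) \<Longrightarrow>
        (\<And>r. r \<in> {0..u} \<Longrightarrow> m r \<omega> < real (Suc n)) \<Longrightarrow> u < \<tau> \<omega>"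
    then show ?thesis by (intro exI[of _ \<tau>]) simp
  qed simp
  then have "\<forall>n. \<exists>\<tau>. (\<forall>\<omega>\<in>space M. 0 \<le> \<tau> \<omega>) \<and> (\<forall>u\<ge>0. {\<omega>\<in>space M. u < \<tau> \<omega>} \<in> sets (F u)) \<and>
      (\<forall>\<omega>\<in>space M. \<forall>u\<ge>0. m (min u (\<tau> \<omega>)) \<omega> \<le> real (Suc n)) \<and>
      (\<forall>\<omega>\<in>space M. \<forall>u\<ge>0. u < real (Suc n) \<longrightarrow> (\<forall>r\<in>{0..u}. m r \<omega> < real (Suc n)) \<longrightarrow> u < \<tau> \<omega>)" ..
  from choice[OF this] obtain \<tau> :: "nat \<Rightarrow> 'a \<Rightarrow> real" where \<tau>': "\<forall>n. (\<forall>\<omega>\<in>space M. 0 \<le> \<tau> n \<omega>) \<and> (\<forall>u\<ge>0. {\<omega>\<in>space M. u < \<tau> n \<omega>} \<in> sets (F u)) \<and>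
      (\<forall>\<omega>\<in>space M. \<forall>u\<ge>0. m (min u (\<tau> n \<omega>)) \<omega> \<le> real (Suc n)) \<and>
      (\<forall>\<omega>\<in>space M. \<forall>u\<ge>0. u < real (Suc n) \<longrightarrow> (\<forall>r\<in>{0..u}. m r \<omega> < real (Suc n)) \<longrightarrow> u < \<tau> n \<omega>)" by (elim exE)
  have \<tau>: "\<And>n \<omega>. \<omega>\<in>space M \<Longrightarrow> 0 \<le> \<tau> n \<omega>"
    "\<And>n u. 0 \<le> u \<Longrightarrow> {\<omega>\<in>space M. u < \<tau> n \<omega>} \<in> sets (F u)"
    "\<And>n \<omega> u. \<omega>\<in>space M \<Longrightarrow> 0 \<le> u \<Longrightarrow> m (min u (\<tau> n \<omega>)) \<omega> \<le> real (Suc n)"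
    "\<And>n \<omega> u. \<omega>\<in>space M \<Longrightarrow> 0 \<le> u \<Longrightarrow> u < real (Suc n) \<Longrightarrow> (\<forall>r\<in>{0..u}. m r \<omega> < real (Suc n)) \<Longrightarrow> u < \<tau> n \<omega>"
    using \<tau>' by blast+
  define S where "S n \<omega> = min (min (TZ n \<omega>) (TI n \<omega>)) (\<tau> n \<omega>)" for n \<omega>
  have S0: "0 \<le> S n \<omega>" if "\<omega> \<in> space M" for n \<omega> using TZ(2) TI(2) \<tau>(1) that by (simp add: S_def)
  have SF: "{\<omega>\<in>space M. u < S n \<omega>} \<in> sets (F u)" if u: "0 \<le> u" for n u
  proof -
    have "{\<omega>\<in>space M. u < S n \<omega>} = {\<omega>\<in>space (F u). u < TZ n \<omega>} \<inter> {\<omega>\<in>space (F u). u < TI n \<omega>} \<inter> {\<omega>\<in>space M. u < \<tau> n \<omega>}"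
      by (auto simp: S_def)
    also have "\<dots> \<in> sets (F u)"
      using stopping_timeD2[OF TZ(1)[of n], of u] stopping_timeD2[OF TI(1)[of n], of u] \<tau>(2)[OF u]
      unfolding pred_def by blast
    finally show ?thesis .
  qed
  have SK: "\<bar>X (min u (S n \<omega>)) \<omega> - X 0 \<omega>\<bar> \<le> real (Suc n)" if X: "X = Z \<or> X = I" and w: "\<omega> \<in> space M" and u: "0 \<le> u" for X n \<omega> u
  proof -
    have "min (min u (S n \<omega>)) (\<tau> n \<omega>) = min u (S n \<omega>)" by (simp add: S_def)
    moreover have "0 \<le> min u (S n \<omega>)" using S0[OF w] u by simp
    ultimately have "m (min u (S n \<omega>)) \<omega> \<le> real (Suc n)" using \<tau>(3)[OF w, of "min u (S n \<omega>)" n] by simp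
    then show ?thesis using X by (auto simp: m_def)
  qed
  have orth: "(\<integral>\<omega>. \<eta> \<omega> * (X (min t (S n \<omega>)) \<omega> - X (min s (S n \<omega>)) \<omega>) \<partial>M) = 0"
    if X: "X = Z \<or> X = I" and st: "0 \<le> s" "s \<le> t" and \<eta>: "\<eta> \<in> borel_measurable (F s)"
      "\<And>\<omega>. \<omega> \<in> space M \<Longrightarrow> \<bar>\<eta> \<omega>\<bar> \<le> C" for X n s t \<eta> C
    using X
  proof
    assume "X = Z"
    have "(\<integral>\<omega>. \<eta> \<omega> * (Z (min t (S n \<omega>)) \<omega> - Z (min s (S n \<omega>)) \<omega>) \<partial>M) = 0"
    proof (rule clm_stopped_increment[where T="TZ n", OF Zac(2) TZ(2) TZ(4) SF _ _ st \<eta>])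
      show "\<bar>Z (min u (S n \<omega>)) \<omega> - Z 0 \<omega>\<bar> \<le> real (Suc n)" if "\<omega> \<in> space M" "0 \<le> u" for \<omega> u
        by (rule SK[OF _ that]) simp
    qed (use S0 in \<open>auto simp: S_def\<close>)
    then show ?thesis using \<open>X = Z\<close> by simp
  next
    assume "X = I"
    have "(\<integral>\<omega>. \<eta> \<omega> * (I (min t (S n \<omega>)) \<omega> - I (min s (S n \<omega>)) \<omega>) \<partial>M) = 0"
    proof (rule clm_stopped_increment[where T="TI n", OF Iac(2) TI(2) TI(4) SF _ _ st \<eta>])
      show "\<bar>I (min u (S n \<omega>)) \<omega> - I 0 \<omega>\<bar> \<le> real (Suc n)" if "\<omega> \<in> space M" "0 \<le> u" for \<omega> u
        by (rule SK[OF _ that]) simp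
    qed (use S0 in \<open>auto simp: S_def\<close>)
    then show ?thesis using \<open>X = I\<close> by simp
  qed
  have "AE \<omega> in M. \<omega> \<in> space M" by (rule AE_space)
  with TZ(3) TI(3) have ae: "AE \<omega> in M. \<forall>t\<ge>0. \<forall>\<^sub>F n in sequentially. t < S n \<omega>"
  proof eventually_elim
    case (elim \<omega>)
    show ?case
    proof (intro allI impI)
      fix t :: real assume t: "0 \<le> t"
      have "continuous_on {0..} (\<lambda>u. m u \<omega>)" using mc elim(3) by (simp add: continuous_paths_def)
      then have "bounded ((\<lambda>u. m u \<omega>) ` {0..t})"
        by (intro compact_imp_bounded compact_continuous_image) (auto intro: continuous_on_subset)
      then obtain B where B: "\<forall>u\<in>{0..t}. \<bar>m u \<omega>\<bar> \<le> B" unfolding bounded_iff by auto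
      have "\<forall>\<^sub>F n in sequentially. max t B < real n"
        using filterlim_real_sequentially unfolding filterlim_at_top_dense by blast
      moreover have "\<forall>\<^sub>F n in sequentially. t < TZ n \<omega>" "\<forall>\<^sub>F n in sequentially. t < TI n \<omega>"
        using elim by (auto simp: filterlim_at_top_dense)
      ultimately show "\<forall>\<^sub>F n in sequentially. t < S n \<omega>"
      proof eventually_elim
        case (elim n)
        have "t < \<tau> n \<omega>"
        proof (rule \<tau>(4)[OF \<open>\<omega> \<in> space M\<close> t])
          show "\<forall>r\<in>{0..t}. m r \<omega> < real (Suc n)" using B elim by (fastforce simp: abs_le_iff)
        qed (use elim in simp)
        then show ?case using elim by (simp add: S_def)
      qed
    qed
  qed
  show ?thesis by (rule that[of S]) (fact S0 SF SK orth ae)+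
qed

end

section \<open>The second moment of the ramp martingale\<close>

lemma cutoff_bounds: "0 \<le> cutoff d x" "cutoff d x \<le> 1"
  by (auto simp: cutoff_def)

lemma cutoff_0: "cutoff d 0 = 1"
  by (simp add: cutoff_def)

lemma cutoff_far: "0 < d \<Longrightarrow> 3 * d \<le> x \<Longrightarrow> cutoff d x = 0"
  by (simp add: cutoff_def field_simps)

lemma continuous_on_cutoff: "d \<noteq> 0 \<Longrightarrow> continuous_on S (cutoff d)"
  unfolding cutoff_def by (intro continuous_intros) auto

lemma cutoff_tendsto:
  assumes d: "\<And>m. 0 < d m" "d \<longlonglongrightarrow> 0" and x: "0 \<le> x"
  shows "(\<lambda>m. cutoff (d m) x) \<longlonglongrightarrow> indicator {0} x"
proof (cases "x = 0")
  case False
  then have "0 < x / 3" using x by simp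
  from order_tendstoD(2)[OF d(2) this] have "\<forall>\<^sub>F m in sequentially. cutoff (d m) x = 0"
    by eventually_elim (auto intro: cutoff_far[OF d(1)])
  then show ?thesis using False by (simp add: tendsto_eventually)
qed (simp add: cutoff_0)

text \<open>For \<open>y \<ge> 0\<close> the cutoffs tend to the indicator of \<open>0\<close>,
  which equals \<open>(1 - sgn_left y) / 2\<close>. The Stieltjes integral of the cutoff thereby
  turns into the sign integral that occurs in Tanaka's formula.\<close>

lemma cutoff_interval_limit:
  fixes y p :: "real \<Rightarrow> real"
  assumes d: "\<And>m. 0 < d m" "d \<longlonglongrightarrow> 0" and y: "continuous_on {0..} y" "\<And>s. 0 \<le> s \<Longrightarrow> 0 \<le> y s"
    and p: "mono p" "continuous_on UNIV p" and t: "0 \<le> t"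
    and i: "set_integrable (interval_measure p) {0<..t} (\<lambda>s. sgn_left (y s))"
  shows "(\<lambda>m. LINT s:{0<..t}|interval_measure p. cutoff (d m) (y s)) \<longlonglongrightarrow>
    1 / 2 * (p t - p 0 - (LINT s:{0<..t}|interval_measure p. sgn_left (y s)))"
proof -
  note f = interval_measure_facts[OF p t]
  have i1: "set_integrable (interval_measure p) {0<..t} (\<lambda>s. 1 / 2 * (1 - sgn_left (y s)))"
    using f(2) i by (intro set_integrable_mult_right set_integral_diff) auto
  have "(\<lambda>m. LINT s:{0<..t}|interval_measure p. cutoff (d m) (y s)) \<longlonglongrightarrow>
      (LINT s:{0<..t}|interval_measure p. 1 / 2 * (1 - sgn_left (y s)))"
    unfolding set_lebesgue_integral_def
  proof (rule integral_dominated_convergence[where w="indicator {0<..t}"])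
    show "(\<lambda>s. indicator {0<..t} s *\<^sub>R (1 / 2 * (1 - sgn_left (y s)))) \<in> borel_measurable (interval_measure p)"
      using i1 by (auto simp: set_integrable_def)
    show "(\<lambda>s. indicator {0<..t} s *\<^sub>R cutoff (d m) (y s)) \<in> borel_measurable (interval_measure p)" for m
    proof -
      have "continuous_on {0..} (\<lambda>s. cutoff (d m) (y s))"
        by (rule continuous_on_compose2[OF continuous_on_cutoff y(1) subset_UNIV]) (use d(1)[of m] in simp)
      then have "continuous_on {0<..t} (\<lambda>s. cutoff (d m) (y s))" by (rule continuous_on_subset) auto
      from borel_measurable_continuous_on_indicator[OF _ this]
      have "(\<lambda>s. indicator {0<..t} s *\<^sub>R cutoff (d m) (y s)) \<in> borel_measurable borel" by simp
      then show ?thesis by (subst measurable_cong_sets[OF sets_interval_measure refl])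
    qed
    show "integrable (interval_measure p) (indicator {0<..t} :: real \<Rightarrow> real)"
      using f(2) by (simp add: set_integrable_def)
    show "AE s in interval_measure p. (\<lambda>m. indicator {0<..t} s *\<^sub>R cutoff (d m) (y s)) \<longlonglongrightarrow> indicator {0<..t} s *\<^sub>R (1 / 2 * (1 - sgn_left (y s)))"
    proof (rule AE_I2)
      fix s
      show "(\<lambda>m. indicator {0<..t} s *\<^sub>R cutoff (d m) (y s)) \<longlonglongrightarrow> indicator {0<..t} s *\<^sub>R (1 / 2 * (1 - sgn_left (y s)))"
      proof (cases "s \<in> {0<..t}")
        case True
        then have y0: "0 \<le> y s" by (intro y(2)) simp
        have "1 / 2 * (1 - sgn_left (y s)) = indicator {0} (y s)"
          using y0 by (auto simp: sgn_left_def indicator_def)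
        then show ?thesis using True cutoff_tendsto[OF d y0] by simp
      qed simp
    qed
    show "AE s in interval_measure p. norm (indicator {0<..t} s *\<^sub>R cutoff (d m) (y s)) \<le> indicator {0<..t} s" for m
      using cutoff_bounds by (intro AE_I2) (auto simp: indicator_def)
  qed
  also have "(LINT s:{0<..t}|interval_measure p. 1 / 2 * (1 - sgn_left (y s)))
      = 1 / 2 * (p t - p 0 - (LINT s:{0<..t}|interval_measure p. sgn_left (y s)))"
    using f(1) set_integral_diff(2)[OF f(2) i] by simp
  finally show ?thesis .
qed

context reflected_diffusion
begin

lemma path_int_Ioc:
  assumes g: "continuous_on {0..l} g" and w: "\<omega> \<in> space M" and t: "0 \<le> t"
  shows "(LINT s:{0<..t}|lborel. g (Y s \<omega>)) = path_int g t \<omega>"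
  using lborel_integral_diff[OF Y_comp_cont[OF g w] order_refl t] path_int_0[of g \<omega>]
  by (simp add: path_int_def)

text \<open>Meant for the generator of the ramp, whose slope at \<open>0\<close> puts it outside the
  martingale problem. Riemann sums in finitely many values of \<open>Y\<close> give the
  measurability.\<close>

lemma path_int_meas:
  assumes g: "continuous_on {0..l} g" and t: "0 < t"
  shows "path_int g t \<in> borel_measurable M"
proof (rule borel_measurable_LIMSEQ_real)
  let ?u = "\<lambda>n \<omega>. \<Sum>k<n. g (Y (grid t n k) \<omega>) * (LINT s:{grid t n k<..grid t n (Suc k)}|lborel. 1)"
  have t0: "0 \<le> t" using t by simp
  have one: "set_integrable lborel {0<..t} (\<lambda>_. 1 :: real)"
    unfolding set_integrable_def using t0 by (simp add: integrable_real_indicator)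
  show "(\<lambda>n. ?u n \<omega>) \<longlonglongrightarrow> path_int g t \<omega>" if w: "\<omega> \<in> space M" for \<omega>
    using stieltjes_sums[OF _ Y_comp_cont[OF g w] t one] path_int_Ioc[OF g w t0] by simp
  show "?u n \<in> borel_measurable M" for n
    using grid_nonneg[OF t0]
    by (intro borel_measurable_sum borel_measurable_times borel_measurable_const measurable_F_M[OF Y_comp_meas[OF g _ order_refl]]) auto
qed

text \<open>The bound depends neither on the mesh index \<open>n\<close>, nor on the cutoff index
  \<open>m\<close>, nor on the localization index \<open>a\<close>, because it comes from the energy
  of the ramp alone. Fatou's lemma is applied in \<open>n\<close>, then in \<open>m\<close>, then in
  \<open>a\<close>. The summand \<open>1\<close> is the tolerance of the truncated
  comparison.\<close>

lemma ramp_local_time_moment: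
  assumes lt: "semimartingale_local_time M F Y 0 L"
  obtains C where "0 \<le> C"
    "\<And>t. 0 < t \<Longrightarrow> (\<integral>\<^sup>+\<omega>. ennreal ((ramp l (Y t \<omega>) - ramp l (Y 0 \<omega>) - 1 / 2 * L t \<omega>
        - path_int (gen (ramp1 l) (ramp2 l)) t \<omega>)\<^sup>2) \<partial>M) \<le> ennreal (2 * (C * t) + 1)"
proof -
  let ?R = "gen (ramp1 l) (ramp2 l)"
  from lt have La: "adapted_process F L" and Lc: "continuous_paths M L"
    and L0: "\<forall>\<omega>\<in>space M. L 0 \<omega> = 0 \<and> mono_on {0..} (\<lambda>t. L t \<omega>)"
    unfolding semimartingale_local_time_def by - (elim conjE, assumption)+
  from lt obtain Z V I J where Z: "continuous_local_martingale M F Z"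
    and V: "continuous_fv_process M F V"
    and YZ: "\<forall>\<omega>\<in>space M. \<forall>t\<ge>0. Y t \<omega> = Z t \<omega> + V t \<omega>"
    and I': "stochastic_integral M F (\<lambda>t \<omega>. sgn_left (Y t \<omega> - 0)) Z I"
    and J: "AE \<omega> in M. stieltjes_integral (\<lambda>t. sgn_left (Y t \<omega> - 0)) (\<lambda>t. V t \<omega>) (\<lambda>t. J t \<omega>)"
    and tanaka: "AE \<omega> in M. \<forall>t\<ge>0. \<bar>Y t \<omega> - 0\<bar> = \<bar>Y 0 \<omega> - 0\<bar> + I t \<omega> + J t \<omega> + L t \<omega>"
    unfolding semimartingale_local_time_def by (elim conjE exE)
  have I: "continuous_local_martingale M F I" using I' by (simp add: stochastic_integral_def)
  have Zac: "adapted_process F Z" "continuous_paths M Z" and Iac: "adapted_process F I" "continuous_paths M I"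
    using Z I by (auto simp: continuous_local_martingale_def)
  obtain S :: "nat \<Rightarrow> 'a \<Rightarrow> real" where S:
    "\<And>n \<omega>. \<omega> \<in> space M \<Longrightarrow> 0 \<le> S n \<omega>"
    "\<And>n u. 0 \<le> u \<Longrightarrow> {\<omega>\<in>space M. u < S n \<omega>} \<in> sets (F u)"
    "\<And>X n \<omega> u. X = Z \<or> X = I \<Longrightarrow> \<omega> \<in> space M \<Longrightarrow> 0 \<le> u \<Longrightarrow> \<bar>X (min u (S n \<omega>)) \<omega> - X 0 \<omega>\<bar> \<le> real (Suc n)"
    "\<And>X n s t \<eta> C. X = Z \<or> X = I \<Longrightarrow> 0 \<le> s \<Longrightarrow> s \<le> t \<Longrightarrow> \<eta> \<in> borel_measurable (F s) \<Longrightarrow>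
        (\<And>\<omega>. \<omega> \<in> space M \<Longrightarrow> \<bar>\<eta> \<omega>\<bar> \<le> C) \<Longrightarrow>
        (\<integral>\<omega>. \<eta> \<omega> * (X (min t (S n \<omega>)) \<omega> - X (min s (S n \<omega>)) \<omega>) \<partial>M) = 0"
    "AE \<omega> in M. \<forall>t\<ge>0. \<forall>\<^sub>F n in sequentially. t < S n \<omega>"
    using localize_pair[OF Z I] by blast
  obtain C where C: "0 \<le> C"
    "\<And>s t. 0 \<le> s \<Longrightarrow> s \<le> t \<Longrightarrow> (\<integral>\<omega>. (ramp l (Y t \<omega>) - ramp l (Y s \<omega>))\<^sup>2 \<partial>M) \<le> C * (t - s)"
    using ramp_energy by blast
  have Rc: "continuous_on {0..l} ?R" by (intro gen_cont continuous_on_ramp)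
  obtain CR where CR: "0 \<le> CR" "\<And>x. x \<in> {0..l} \<Longrightarrow> \<bar>?R x\<bar> \<le> CR" using bounded_on[OF Rc] by blast
  show ?thesis
  proof (rule that[OF C(1)])
    fix t :: real assume t: "0 < t"
    then have t0: "0 \<le> t" by simp
    define c where "c = C * t"
    define g where "g = grid t"
    have g0: "0 \<le> g n k" for n k by (simp add: g_def grid_nonneg t0)
    have gmono: "g n j \<le> g n k" if "j \<le> k" for n j k unfolding g_def by (rule grid_mono[OF t0 that])
    have gS: "g n k \<le> g n (Suc k)" for n k by (rule gmono) simp
    have gt: "g n k \<le> t" if "k \<le> n" for n k unfolding g_def by (rule grid_le[OF t0 that])
    \<comment> \<open>The factor \<open>8\<close> keeps \<open>4 * d m\<close> within
      \<open>l / 2\<close>, the range on which the ramp is the identity.\<close>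
    define d where "d m = l / (8 * real (Suc m))" for m
    have d: "0 < d m" "4 * d m \<le> l / 2" "d m \<le> l" for m
    proof -
      show "0 < d m" using l by (simp add: d_def)
      have "d m \<le> l / 8" unfolding d_def using l by (intro divide_left_mono) auto
      then show "4 * d m \<le> l / 2" "d m \<le> l" using l by linarith+
    qed
    have dlim: "d \<longlonglongrightarrow> 0"
    proof -
      have "(\<lambda>m. (l / 8) / real (Suc m)) \<longlonglongrightarrow> 0" by (rule LIMSEQ_Suc[OF lim_const_over_n])
      then show ?thesis by (simp add: d_def [abs_def] del: of_nat_Suc)
    qed
    let ?f = "\<lambda>m x. ramp l x - corner (d m) x"
    let ?G = "\<lambda>m. gen (\<lambda>x. ramp1 l x - corner1 (d m) x) (\<lambda>x. ramp2 l x - corner2 (d m) x)"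
    define N where "N m u \<omega> = ?f m (Y u \<omega>) - ?f m (Y 0 \<omega>) - path_int (?G m) u \<omega>" for m u \<omega>
    note fN = neumann_ramp_corner[OF d(1,3)]
    have Nmart: "martingale M F (N m)" for m using neumann_martingale[OF fN] by (simp add: N_def [abs_def])
    have fc: "continuous_on {0..l} (?f m)" and Gc: "continuous_on {0..l} (?G m)" for m
      using neumann_continuous[OF fN, of m] by (auto intro: gen_cont)
    have Nc: "continuous_on {0..} (\<lambda>u. N m u \<omega>)" if "\<omega> \<in> space M" for m \<omega>
      unfolding N_def by (intro continuous_intros Y_comp_cont[OF fc that] path_int_cont[OF Gc that])
    have Nm: "N m u \<in> borel_measurable (F v)" if "0 \<le> u" "u \<le> v" for m u v
    proof -
      have "N m u \<in> borel_measurable (F u)" using Nmart[of m] that(1) by (simp add: martingale_def adapted_process_def)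
      then show ?thesis using that(2) by (rule measurable_F_mono)
    qed
    have Nb: "\<exists>K\<ge>0. \<forall>u\<in>{0..t}. \<forall>\<omega>\<in>space M. \<bar>N m u \<omega>\<bar> \<le> K" for m
    proof -
      obtain C1 where C1: "0 \<le> C1" "\<And>x. x \<in> {0..l} \<Longrightarrow> \<bar>?f m x\<bar> \<le> C1" using bounded_on[OF fc] by blast
      obtain C2 where C2: "0 \<le> C2" "\<And>x. x \<in> {0..l} \<Longrightarrow> \<bar>?G m x\<bar> \<le> C2" using bounded_on[OF Gc] by blast
      show ?thesis
      proof (intro exI[of _ "2 * C1 + C2 * t"] conjI ballI)
        fix u \<omega> assume u: "u \<in> {0..t}" and w: "\<omega> \<in> space M"
        then have u0: "0 \<le> u" "u \<le> t" by auto
        have "\<bar>path_int (?G m) u \<omega> - path_int (?G m) 0 \<omega>\<bar> \<le> C2 * (u - 0)"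
          by (rule path_int_bounds(3)[OF Gc w order_refl u0(1) C2(2)])
        also have "\<dots> \<le> C2 * t" using C2 u0 by (intro mult_left_mono) auto
        finally have 1: "\<bar>path_int (?G m) u \<omega>\<bar> \<le> C2 * t" by (simp add: path_int_0)
        have "\<bar>?f m (Y u \<omega>)\<bar> \<le> C1" "\<bar>?f m (Y 0 \<omega>)\<bar> \<le> C1" by (intro C1(2) Y_range w u0 order_refl)+
        with 1 show "\<bar>N m u \<omega>\<bar> \<le> 2 * C1 + C2 * t" unfolding N_def by linarith
      qed (use C1 C2 t0 in auto)
    qed
    define cu where "cu m n k \<omega> = cutoff (d m) (Y (g n k) \<omega>)" for m n k \<omega>
    have cu01: "0 \<le> cu m n k \<omega>" "cu m n k \<omega> \<le> 1" for m n k \<omega> by (simp_all add: cu_def cutoff_bounds)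
    have cum: "cu m n k \<in> borel_measurable (F v)" if "g n k \<le> v" for m n k v
      unfolding cu_def using that d(1)[of m] by (intro Y_comp_meas continuous_on_cutoff g0) auto
    define X1 where "X1 a u \<omega> = Z (min u (S a \<omega>)) \<omega>" for a u \<omega>
    define X2 where "X2 a u \<omega> = I (min u (S a \<omega>)) \<omega>" for a u \<omega>
    define D where "D m a n k \<omega> = (cu m n k \<omega> - 1 / 2) * (X1 a (g n (Suc k)) \<omega> - X1 a (g n k) \<omega>)
       + 1 / 2 * (X2 a (g n (Suc k)) \<omega> - X2 a (g n k) \<omega>)
       + (1 - cu m n k \<omega>) * (N m (g n (Suc k)) \<omega> - N m (g n k) \<omega>)" for m a n k \<omega>
    define U where "U n k \<omega> = ramp l (Y (g n (Suc k)) \<omega>) - ramp l (Y (g n k) \<omega>)" for n k \<omega>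
    \<comment> \<open>On \<open>B a\<close> the stopping is inactive up to time \<open>t\<close>, so
      the stopped processes agree with \<open>Z\<close> and \<open>I\<close> at all grid
      points.\<close>
    define B where "B a = {\<omega>\<in>space M. t < S a \<omega>}" for a
    have BM: "B a \<in> sets M" for a unfolding B_def by (rule sets_F_M[OF S(2)[OF t0]])
    have X1m: "X1 a u \<in> borel_measurable (F v)" and X2m: "X2 a u \<in> borel_measurable (F v)" if "0 \<le> u" "u \<le> v" for a u v
      unfolding X1_def X2_def
      by (rule measurable_F_mono[OF stopped_measurable[OF Zac S(2) S(1) that(1)] that(2)]; assumption)
         (rule measurable_F_mono[OF stopped_measurable[OF Iac S(2) S(1) that(1)] that(2)]; assumption)
    have Xb: "\<bar>X1 a u \<omega> - X1 a v \<omega>\<bar> \<le> 2 * real (Suc a)" "\<bar>X2 a u \<omega> - X2 a v \<omega>\<bar> \<le> 2 * real (Suc a)"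
      if "\<omega> \<in> space M" "0 \<le> u" "0 \<le> v" for a u v \<omega>
    proof -
      have tr: "\<bar>x - x'\<bar> \<le> 2 * K" if "\<bar>x - x0\<bar> \<le> K" "\<bar>x' - x0\<bar> \<le> K" for x x' x0 K :: real
        using that by linarith
      show "\<bar>X1 a u \<omega> - X1 a v \<omega>\<bar> \<le> 2 * real (Suc a)" unfolding X1_def by (rule tr; rule S(3); use that in simp)
      show "\<bar>X2 a u \<omega> - X2 a v \<omega>\<bar> \<le> 2 * real (Suc a)" unfolding X2_def by (rule tr; rule S(3); use that in simp)
    qed
    have X12c: "continuous_on {0..} (\<lambda>u. X1 a u \<omega>)" "continuous_on {0..} (\<lambda>u. X2 a u \<omega>)" if w: "\<omega> \<in> space M" for a \<omega>
    proof -
      have z: "continuous_on {0..} (\<lambda>u. Z u \<omega>)" "continuous_on {0..} (\<lambda>u. I u \<omega>)"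
        using Zac Iac w by (auto simp: continuous_paths_def)
      show "continuous_on {0..} (\<lambda>u. X1 a u \<omega>)" unfolding X1_def
        by (rule continuous_on_compose2[OF z(1)]) (use S(1)[OF w] in \<open>auto intro!: continuous_intros\<close>)
      show "continuous_on {0..} (\<lambda>u. X2 a u \<omega>)" unfolding X2_def
        by (rule continuous_on_compose2[OF z(2)]) (use S(1)[OF w] in \<open>auto intro!: continuous_intros\<close>)
    qed
    have Dm: "D m a n k \<in> borel_measurable (F (g n (Suc k)))" for m a n k
      unfolding D_def using gS[of n k]
      by (intro borel_measurable_add borel_measurable_times borel_measurable_diff borel_measurable_const cum X1m X2m Nm g0) auto
    have DM: "D m a n k \<in> borel_measurable M" for m a n k by (rule measurable_F_M[OF Dm])
    have step1: "(\<integral>\<^sup>+\<omega>. indicator (B a) \<omega> * liminf (\<lambda>n. ennreal ((\<Sum>k<n. D m a n k \<omega>)\<^sup>2)) \<partial>M) \<le> ennreal (2 * c + 1)"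
      if path: "AE \<omega> in M. \<omega> \<in> B a \<longrightarrow> (\<forall>\<^sub>F n in sequentially. \<forall>k\<le>n. (\<Sum>j<k. (D m a n j \<omega>)\<^sup>2 - 2 * (U n j \<omega>)\<^sup>2) \<le> 1)" for m a
    proof -
      obtain KN where KN: "0 \<le> KN" "\<And>u \<omega>. 0 \<le> u \<Longrightarrow> u \<le> t \<Longrightarrow> \<omega> \<in> space M \<Longrightarrow> \<bar>N m u \<omega>\<bar> \<le> KN"
        using Nb[of m] by auto
      have Nd: "\<bar>N m (g n (Suc k)) \<omega> - N m (g n k) \<omega>\<bar> \<le> 2 * KN" if "k < n" "\<omega> \<in> space M" for n k \<omega>
        using KN(2)[OF g0 gt, of "Suc k" n \<omega>] KN(2)[OF g0 gt, of k n \<omega>] that by simp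
      have tri: "\<bar>x * A1 + 1 / 2 * A2 + z * A3\<bar> \<le> e1 + e2 + e3"
        if "\<bar>x\<bar> \<le> 1" "\<bar>z\<bar> \<le> 1" "\<bar>A1\<bar> \<le> e1" "\<bar>A2\<bar> \<le> e2" "\<bar>A3\<bar> \<le> e3" for x z A1 A2 A3 e1 e2 e3 :: real
      proof -
        have "\<bar>x * A1\<bar> \<le> 1 * e1" unfolding abs_mult using that by (intro mult_mono) auto
        moreover have "\<bar>z * A3\<bar> \<le> 1 * e3" unfolding abs_mult using that by (intro mult_mono) auto
        moreover have "\<bar>1 / 2 * A2\<bar> \<le> e2" using that(4) unfolding abs_mult by simp
        ultimately show ?thesis by linarith
      qed
      have cub: "\<bar>cu m n k \<omega> - 1 / 2\<bar> \<le> 1" "\<bar>1 - cu m n k \<omega>\<bar> \<le> 1" for n k \<omega>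
        using cu01[of m n k \<omega>] by (auto simp: abs_le_iff)
      show ?thesis
      proof (rule truncated_transform_bound[where s=g and U=U and K="2 * real (Suc a) + 2 * real (Suc a) + 2 * KN"])
        show "g n j \<le> g n k" if "j \<le> k" for n j k by (rule gmono[OF that])
        show "D m a n k \<in> borel_measurable (F (g n (Suc k)))" for n k by (rule Dm)
        show "U n k \<in> borel_measurable (F (g n (Suc k)))" for n k
          unfolding U_def using gS[of n k] by (intro borel_measurable_diff Y_comp_meas continuous_on_ramp g0) auto
        show "\<bar>D m a n k \<omega>\<bar> \<le> 2 * real (Suc a) + 2 * real (Suc a) + 2 * KN" if "k < n" "\<omega> \<in> space M" for n k \<omega>
          unfolding D_def by (intro tri cub Xb Nd that g0)
        show "(\<integral>\<omega>. \<eta> \<omega> * D m a n k \<omega> \<partial>M) = 0"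
          if k: "k < n" and \<eta>: "\<eta> \<in> borel_measurable (F (g n k))" "\<And>\<omega>. \<omega> \<in> space M \<Longrightarrow> \<bar>\<eta> \<omega>\<bar> \<le> K" for n k \<eta> K
        proof -
          have b1: "\<bar>\<eta> \<omega> * x\<bar> \<le> K" if "\<omega> \<in> space M" "\<bar>x\<bar> \<le> 1" for \<omega> x
          proof -
            have "\<bar>\<eta> \<omega>\<bar> * \<bar>x\<bar> \<le> K * 1" using \<eta>(2)[OF that(1)] that(2) by (intro mult_mono) auto
            then show ?thesis by (simp add: abs_mult)
          qed
          have m1: "(\<lambda>\<omega>. \<eta> \<omega> * (cu m n k \<omega> - 1 / 2)) \<in> borel_measurable (F (g n k))"
            "(\<lambda>\<omega>. \<eta> \<omega> * (1 / 2)) \<in> borel_measurable (F (g n k))"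
            "(\<lambda>\<omega>. \<eta> \<omega> * (1 - cu m n k \<omega>)) \<in> borel_measurable (F (g n k))"
            using \<eta>(1) by (auto intro!: borel_measurable_times borel_measurable_diff cum)
          have o1: "(\<integral>\<omega>. (\<eta> \<omega> * (cu m n k \<omega> - 1 / 2)) * (X1 a (g n (Suc k)) \<omega> - X1 a (g n k) \<omega>) \<partial>M) = 0"
            unfolding X1_def by (rule S(4)[OF _ g0 gS m1(1) b1[OF _ cub(1)]]) auto
          have o2: "(\<integral>\<omega>. (\<eta> \<omega> * (1 / 2)) * (X2 a (g n (Suc k)) \<omega> - X2 a (g n k) \<omega>) \<partial>M) = 0"
            unfolding X2_def by (rule S(4)[OF _ g0 gS m1(2) b1]) auto
          note o3 = martingale_increment[OF Nmart g0 gS m1(3) b1[OF _ cub(2)]]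
          have XM: "X1 a u \<in> borel_measurable M" "X2 a u \<in> borel_measurable M" if "0 \<le> u" for u
            using X1m[OF that order_refl] X2m[OF that order_refl] by (auto intro: measurable_F_M)
          have i1: "integrable M (\<lambda>\<omega>. (\<eta> \<omega> * (cu m n k \<omega> - 1 / 2)) * (X1 a (g n (Suc k)) \<omega> - X1 a (g n k) \<omega>))"
            by (rule integrable_bounded_mult[OF measurable_F_M[OF m1(1)] b1[OF _ cub(1)] integrable_bounded[OF _ Xb(1)[OF _ g0 g0]]])
               (auto intro!: borel_measurable_diff XM g0)
          have i2: "integrable M (\<lambda>\<omega>. (\<eta> \<omega> * (1 / 2)) * (X2 a (g n (Suc k)) \<omega> - X2 a (g n k) \<omega>))"
            by (rule integrable_bounded_mult[OF measurable_F_M[OF m1(2)] b1 integrable_bounded[OF _ Xb(2)[OF _ g0 g0]]])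
               (auto intro!: borel_measurable_diff XM g0)
          have "\<eta> \<omega> * D m a n k \<omega> = (\<eta> \<omega> * (cu m n k \<omega> - 1 / 2)) * (X1 a (g n (Suc k)) \<omega> - X1 a (g n k) \<omega>)
              + (\<eta> \<omega> * (1 / 2)) * (X2 a (g n (Suc k)) \<omega> - X2 a (g n k) \<omega>)
              + (\<eta> \<omega> * (1 - cu m n k \<omega>)) * (N m (g n (Suc k)) \<omega> - N m (g n k) \<omega>)" for \<omega>
            unfolding D_def by (simp only: distrib_left mult.assoc)
          then show ?thesis
            using Bochner_Integration.integral_add[OF Bochner_Integration.integrable_add[OF i1 i2] o3(1)]
              Bochner_Integration.integral_add[OF i1 i2] o1 o2 o3(2) by (simp only:)
        qed
        have UM: "U n k \<in> borel_measurable M" for n k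
          unfolding U_def by (intro borel_measurable_diff measurable_F_M[OF Y_comp_meas[OF continuous_on_ramp(1) g0 order_refl]])
        show "integrable M (\<lambda>\<omega>. (U n k \<omega>)\<^sup>2)" if "k < n" for n k
        proof (rule integrable_bounded[where K="l\<^sup>2"])
          fix \<omega> assume w: "\<omega> \<in> space M"
          have "\<bar>U n k \<omega>\<bar> \<le> l"
            using ramp_bounds[OF l Y_range[OF w g0[of n k]]] ramp_bounds[OF l Y_range[OF w g0[of n "Suc k"]]]
            by (auto simp: U_def abs_le_iff)
          then show "\<bar>(U n k \<omega>)\<^sup>2\<bar> \<le> l\<^sup>2" using abs_le_square_iff[of "U n k \<omega>" l] l by simp
        qed (use UM in auto)
        show "(\<Sum>k<n. \<integral>\<omega>. (U n k \<omega>)\<^sup>2 \<partial>M) \<le> c" for n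
        proof -
          have "(\<Sum>k<n. \<integral>\<omega>. (U n k \<omega>)\<^sup>2 \<partial>M) \<le> (\<Sum>k<n. C * (g n (Suc k) - g n k))"
            unfolding U_def by (intro sum_mono C(2) g0 gS)
          also have "\<dots> = C * (g n n - g n 0)" unfolding sum_distrib_left[symmetric] sum_lessThan_telescope ..
          also have "\<dots> \<le> C * t" using C(1) gt[of n n] g0[of n 0] by (intro mult_left_mono) auto
          finally show ?thesis by (simp add: c_def)
        qed
        show "\<forall>\<^sub>F n in sequentially. \<forall>k<n. \<bar>D m a n k \<omega>\<bar> \<le> \<epsilon>" if w: "\<omega> \<in> space M" and e: "0 < \<epsilon>" for \<omega> \<epsilon>
        proof -
          have e3: "0 < \<epsilon> / 3" using e by simp
          from grid_uniform[OF X12c(1)[OF w] t0 e3, of a] grid_uniform[OF X12c(2)[OF w] t0 e3, of a]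
            grid_uniform[OF Nc[OF w] t0 e3, of m]
          show ?thesis
          proof eventually_elim
            case (elim n)
            show ?case
            proof (intro allI impI)
              fix k assume k: "k < n"
              have u: "g n (Suc k) \<in> {g n k..g n (Suc k)}" using gS[of n k] by simp
              have "\<bar>D m a n k \<omega>\<bar> \<le> \<epsilon> / 3 + \<epsilon> / 3 + \<epsilon> / 3"
                unfolding D_def using elim k u by (intro tri cub) (auto simp: g_def)
              then show "\<bar>D m a n k \<omega>\<bar> \<le> \<epsilon>" by simp
            qed
          qed
        qed
      qed (rule path)
    qed
    \<comment> \<open>\<open>Rd m\<close> is the limit in the mesh at cutoff width
      \<open>d m\<close>. It is bound existentially because the Jordan pair is chosen path by path,
      and it does not depend on the localization.\<close>
    have "AE \<omega> in M. \<omega> \<in> space M" by (rule AE_space)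
    with J tanaka zero_time[OF t0] have paths: "AE \<omega> in M. \<exists>Rd.
        (\<forall>m a. \<omega> \<in> B a \<longrightarrow> (\<lambda>n. \<Sum>k<n. D m a n k \<omega>) \<longlonglongrightarrow> Rd m) \<and>
        (\<forall>m a. \<omega> \<in> B a \<longrightarrow> (\<forall>\<^sub>F n in sequentially. \<forall>k\<le>n. (\<Sum>j<k. (D m a n j \<omega>)\<^sup>2 - 2 * (U n j \<omega>)\<^sup>2) \<le> 1)) \<and>
        Rd \<longlonglongrightarrow> ramp l (Y t \<omega>) - ramp l (Y 0 \<omega>) - 1 / 2 * L t \<omega> - path_int ?R t \<omega>"
    proof eventually_elim
      case (elim \<omega>)
      then have w: "\<omega> \<in> space M" by simp
      have yr: "0 \<le> Y u \<omega>" "Y u \<omega> \<le> l" if "0 \<le> u" for u using Y_range[OF w that] by auto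
      from elim(1) obtain p q where pq: "jordan_pair (\<lambda>t. V t \<omega>) p q"
        and j: "\<And>u. 0 \<le> u \<Longrightarrow> set_integrable (interval_measure p) {0<..u} (\<lambda>s. sgn_left (Y s \<omega>)) \<and>
          set_integrable (interval_measure q) {0<..u} (\<lambda>s. sgn_left (Y s \<omega>)) \<and>
          J u \<omega> = (LINT s:{0<..u}|interval_measure p. sgn_left (Y s \<omega>)) - (LINT s:{0<..u}|interval_measure q. sgn_left (Y s \<omega>))"
        unfolding stieltjes_integral_def by auto
      have pq': "mono p" "continuous_on UNIV p" "mono q" "continuous_on UNIV q" "\<And>u. 0 \<le> u \<Longrightarrow> V u \<omega> = p u - q u"
        using pq by (auto simp: jordan_pair_def)
      have Lw: "mono_on {0..} (\<lambda>u. L u \<omega>)" "continuous_on {0..} (\<lambda>u. L u \<omega>)" "L 0 \<omega> = 0"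
        using L0 Lc w by (auto simp: continuous_paths_def)
      \<comment> \<open>While the path stays beyond \<open>d m\<close>, the corner and its
        derivatives vanish, so the drift of \<open>N m\<close> is that of the ramp.\<close>
      have Aeq: "path_int (?G m) u \<omega> - path_int (?G m) s \<omega> = (LINT r:{0..u}|lborel. ?R (Y r \<omega>)) - (LINT r:{0..s}|lborel. ?R (Y r \<omega>))"
        if su: "0 \<le> s" "s \<le> u" and far: "\<And>r. r \<in> {s..u} \<Longrightarrow> d m \<le> Y r \<omega>" for m s u
      proof -
        have "path_int (?G m) u \<omega> - path_int (?G m) s \<omega> = integral {s..u} (\<lambda>r. ?G m (Y r \<omega>))"
          unfolding path_int_def by (rule path_integral_diff(1)[OF Y_comp_cont[OF Gc w] su])
        also have "\<dots> = integral {s..u} (\<lambda>r. ?R (Y r \<omega>))"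
          by (rule Henstock_Kurzweil_Integration.integral_cong) (simp add: gen_def corner_far[OF d(1) far])
        also have "\<dots> = (LINT r:{0..u}|lborel. ?R (Y r \<omega>)) - (LINT r:{0..s}|lborel. ?R (Y r \<omega>))"
          by (rule path_integral_diff(1)[OF Y_comp_cont[OF Rc w] su, symmetric])
        finally show ?thesis .
      qed
      define Rd where "Rd m = ramp l (Y t \<omega>) - ramp l (Y 0 \<omega>)
        - ((LINT s:{0<..t}|interval_measure p. cutoff (d m) (Y s \<omega>)) - (LINT s:{0<..t}|interval_measure q. cutoff (d m) (Y s \<omega>)))
        + 1 / 2 * (V t \<omega> - V 0 \<omega> - J t \<omega>) - 1 / 2 * (L t \<omega> - L 0 \<omega>)
        - (LINT s:{0<..t}|lborel. (1 - cutoff (d m) (Y s \<omega>)) * ?R (Y s \<omega>))" for m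
      have yi: "Y u \<omega> = Y 0 \<omega> + I u \<omega> + J u \<omega> + L u \<omega>" if "0 \<le> u" for u
        using elim(2) that yr(1)[OF that] yr(1)[OF order_refl] by auto
      note ex = excursion_path[where y="\<lambda>u. Y u \<omega>" and z="\<lambda>u. Z u \<omega>" and v="\<lambda>u. V u \<omega>" and i="\<lambda>u. I u \<omega>"
          and j="\<lambda>u. J u \<omega>" and L="\<lambda>u. L u \<omega>" and r="\<lambda>u. ?R (Y u \<omega>)" and A="\<lambda>u. path_int (?G m) u \<omega>"
          and N="\<lambda>u. N m u \<omega>" and d="d m" and ystart="?f m (Y 0 \<omega>)" and C=CR and l=l and p=p and q=q and t=t for m]
      have ex1: "(\<lambda>n. \<Sum>k<n. D m a n k \<omega>) \<longlonglongrightarrow> Rd m"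
        "\<forall>\<^sub>F n in sequentially. \<forall>k\<le>n. (\<Sum>j<k. (D m a n j \<omega>)\<^sup>2 - 2 * (U n j \<omega>)\<^sup>2) \<le> 1" if B: "\<omega> \<in> B a" for m a
      proof -
        have tS: "t < S a \<omega>" using B by (simp add: B_def)
        define DE where "DE n k = (cutoff (d m) (Y (grid t n k) \<omega>) - 1 / 2) * (Z (grid t n (Suc k)) \<omega> - Z (grid t n k) \<omega>)
          + 1 / 2 * (I (grid t n (Suc k)) \<omega> - I (grid t n k) \<omega>)
          + (1 - cutoff (d m) (Y (grid t n k) \<omega>)) * (N m (grid t n (Suc k)) \<omega> - N m (grid t n k) \<omega>)" for n k
        have DE: "D m a n k \<omega> = DE n k" if "k < n" for n k
        proof -
          have "min (g n k) (S a \<omega>) = g n k" "min (g n (Suc k)) (S a \<omega>) = g n (Suc k)"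
            using gt[of k n] gt[of "Suc k" n] that tS by auto
          then show ?thesis by (simp add: D_def DE_def X1_def X2_def cu_def g_def)
        qed
        have e: "(\<lambda>n. \<Sum>k<n. DE n k) \<longlonglongrightarrow> Rd m"
          "\<forall>\<^sub>F n in sequentially. \<forall>k\<le>n. (\<Sum>j<k. (DE n j)\<^sup>2 - 2 * (ramp l (Y (grid t n (Suc j)) \<omega>) - ramp l (Y (grid t n j) \<omega>))\<^sup>2) \<le> 1"
          unfolding DE_def Rd_def
          by (rule ex[OF t d(1,2) Y_cont[OF w] _ yi pq j Lw(1,2) Y_comp_cont[OF Rc w] _ Aeq];
              use YZ w CR(2) yr in \<open>auto simp: N_def\<close>)+
        have "(\<Sum>k<n. D m a n k \<omega>) = (\<Sum>k<n. DE n k)" for n by (rule sum.cong) (auto simp: DE)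
        then show "(\<lambda>n. \<Sum>k<n. D m a n k \<omega>) \<longlonglongrightarrow> Rd m" using e(1) by simp
        from e(2) show "\<forall>\<^sub>F n in sequentially. \<forall>k\<le>n. (\<Sum>j<k. (D m a n j \<omega>)\<^sup>2 - 2 * (U n j \<omega>)\<^sup>2) \<le> 1"
        proof eventually_elim
          case (elim n)
          show ?case
          proof (intro allI impI)
            fix k assume k: "k \<le> n"
            have "(\<Sum>j<k. (D m a n j \<omega>)\<^sup>2 - 2 * (U n j \<omega>)\<^sup>2) = (\<Sum>j<k. (DE n j)\<^sup>2 - 2 * (ramp l (Y (grid t n (Suc j)) \<omega>) - ramp l (Y (grid t n j) \<omega>))\<^sup>2)"
              using k by (intro sum.cong) (auto simp: DE U_def g_def)
            then show "(\<Sum>j<k. (D m a n j \<omega>)\<^sup>2 - 2 * (U n j \<omega>)\<^sup>2) \<le> 1" using elim k by simp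
          qed
        qed
      qed
      have lim_p: "(\<lambda>m. LINT s:{0<..t}|interval_measure p. cutoff (d m) (Y s \<omega>)) \<longlonglongrightarrow>
          1 / 2 * (p t - p 0 - (LINT s:{0<..t}|interval_measure p. sgn_left (Y s \<omega>)))"
        by (rule cutoff_interval_limit[OF d(1) dlim Y_cont[OF w] yr(1) pq'(1,2) t0]) (use j[OF t0] in auto)
      have lim_q: "(\<lambda>m. LINT s:{0<..t}|interval_measure q. cutoff (d m) (Y s \<omega>)) \<longlonglongrightarrow>
          1 / 2 * (q t - q 0 - (LINT s:{0<..t}|interval_measure q. sgn_left (Y s \<omega>)))"
        by (rule cutoff_interval_limit[OF d(1) dlim Y_cont[OF w] yr(1) pq'(3,4) t0]) (use j[OF t0] in auto)
      have lim_R: "(\<lambda>m. LINT s:{0<..t}|lborel. (1 - cutoff (d m) (Y s \<omega>)) * ?R (Y s \<omega>)) \<longlonglongrightarrow> path_int ?R t \<omega>"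
      proof -
        have hc: "continuous_on {0..l} (\<lambda>x. (1 - cutoff (d m) x) * ?R x)" for m
          using d(1)[of m] by (intro continuous_intros Rc continuous_on_cutoff) auto
        let ?h = "\<lambda>m x. indicator {0..l} x * ((1 - cutoff (d m) x) * ?R x)"
        \<comment> \<open>At \<open>0\<close> every weight \<open>1 - cutoff\<close> is
          \<open>0\<close>, so the limit loses the value \<open>?R 0\<close> there;
          \<open>zero_time\<close> makes this loss harmless.\<close>
        let ?h' = "\<lambda>x. indicator {0..l} x * ?R x - ?R 0 * indicator {0} x"
        have "(\<lambda>m. path_int (?h m) t \<omega>) \<longlonglongrightarrow> path_int ?h' t \<omega>"
        proof (rule path_int_dominated[OF _ _ w, where K=CR])
          show "?h m \<in> borel_measurable borel" for m by (rule borel_measurable_truncated[OF hc])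
          show "?h' \<in> borel_measurable borel"
            by (intro borel_measurable_diff borel_measurable_truncated[OF Rc] borel_measurable_times borel_measurable_const borel_measurable_indicator) simp
          show "\<bar>?h m x\<bar> \<le> CR" if "x \<in> {0..l}" for m x
          proof -
            have "\<bar>1 - cutoff (d m) x\<bar> * \<bar>?R x\<bar> \<le> 1 * CR"
              using cutoff_bounds[of "d m" x] CR that by (intro mult_mono) auto
            then show ?thesis using that by (simp add: abs_mult)
          qed
          show "(\<lambda>m. ?h m x) \<longlonglongrightarrow> ?h' x" if x: "x \<in> {0..l}" for x
          proof -
            have "(\<lambda>m. (1 - cutoff (d m) x) * ?R x) \<longlonglongrightarrow> (1 - indicator {0} x) * ?R x"
              using x by (intro tendsto_intros cutoff_tendsto d dlim) auto
            moreover have "(1 - indicator {0} x) * ?R x = ?h' x" using x by (auto simp: indicator_def)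
            ultimately show ?thesis using x by simp
          qed
        qed
        moreover have "path_int (?h m) t \<omega> = (LINT s:{0<..t}|lborel. (1 - cutoff (d m) (Y s \<omega>)) * ?R (Y s \<omega>))" for m
          unfolding path_int_Ioc[OF hc w t0] by (rule path_int_cong[OF w]) simp
        moreover have "path_int ?h' t \<omega> = path_int ?R t \<omega>"
        proof -
          have ri: "set_integrable lborel {0..t} (\<lambda>s. ?R (Y s \<omega>))"
            by (intro borel_integrable_atLeastAtMost' continuous_on_subset[OF Y_comp_cont[OF Rc w]]) auto
          have ii: "set_integrable lborel {0..t} (\<lambda>s. ?R 0 * indicator {0} (Y s \<omega>))"
            by (intro set_integrable_mult_right path_set_integrable[OF _ w, where K=1]) auto
          have "path_int ?h' t \<omega> = path_int (\<lambda>x. ?R x - ?R 0 * indicator {0} x) t \<omega>"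
            by (rule path_int_cong[OF w]) simp
          also have "\<dots> = path_int ?R t \<omega> - ?R 0 * path_int (indicator {0}) t \<omega>"
            unfolding path_int_def using set_integral_diff(2)[OF ri ii] by simp
          finally show ?thesis using elim(3) by simp
        qed
        ultimately show ?thesis by simp
      qed
      have "Rd \<longlonglongrightarrow> ramp l (Y t \<omega>) - ramp l (Y 0 \<omega>)
        - (1 / 2 * (p t - p 0 - (LINT s:{0<..t}|interval_measure p. sgn_left (Y s \<omega>)))
          - 1 / 2 * (q t - q 0 - (LINT s:{0<..t}|interval_measure q. sgn_left (Y s \<omega>))))
        + 1 / 2 * (V t \<omega> - V 0 \<omega> - J t \<omega>) - 1 / 2 * (L t \<omega> - L 0 \<omega>) - path_int ?R t \<omega>"
        unfolding Rd_def by (intro tendsto_intros lim_p lim_q lim_R)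
      \<comment> \<open>The cutoff integrals contribute minus half of \<open>V - V 0 - J\<close>, by
        the splitting of \<open>V\<close> and \<open>J\<close> along \<open>p\<close> and
        \<open>q\<close>. This cancels the explicit half, and only half of the local time
        remains.\<close>
      also have "ramp l (Y t \<omega>) - ramp l (Y 0 \<omega>)
        - (1 / 2 * (p t - p 0 - (LINT s:{0<..t}|interval_measure p. sgn_left (Y s \<omega>)))
          - 1 / 2 * (q t - q 0 - (LINT s:{0<..t}|interval_measure q. sgn_left (Y s \<omega>))))
        + 1 / 2 * (V t \<omega> - V 0 \<omega> - J t \<omega>) - 1 / 2 * (L t \<omega> - L 0 \<omega>) - path_int ?R t \<omega>
        = ramp l (Y t \<omega>) - ramp l (Y 0 \<omega>) - 1 / 2 * L t \<omega> - path_int ?R t \<omega>"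
        using pq'(5)[OF t0] pq'(5)[OF order_refl] j[OF t0] Lw(3) by (simp add: field_simps)
      finally show ?case using ex1 by blast
    qed
    let ?X = "\<lambda>\<omega>. ramp l (Y t \<omega>) - ramp l (Y 0 \<omega>) - 1 / 2 * L t \<omega> - path_int ?R t \<omega>"
    have XM: "?X \<in> borel_measurable M"
    proof -
      have "L t \<in> borel_measurable M" using La t0 by (auto simp: adapted_process_def intro: measurable_F_M)
      then show ?thesis
        by (intro borel_measurable_diff borel_measurable_times borel_measurable_const path_int_meas[OF Rc t]
            measurable_F_M[OF Y_comp_meas[OF continuous_on_ramp(1) _ order_refl]] t0 order_refl)
    qed
    let ?W = "\<lambda>m a \<omega>. indicator (B a) \<omega> * liminf (\<lambda>n. ennreal ((\<Sum>k<n. D m a n k \<omega>)\<^sup>2))"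
    have W: "(\<integral>\<^sup>+\<omega>. ?W m a \<omega> \<partial>M) \<le> ennreal (2 * c + 1)" for m a
      by (rule step1) (use paths in \<open>eventually_elim, blast\<close>)
    have WM: "?W m a \<in> borel_measurable M" for m a
      using BM[of a] DM by measurable
    have Ba: "(\<integral>\<^sup>+\<omega>. indicator (B a) \<omega> * ennreal ((?X \<omega>)\<^sup>2) \<partial>M) \<le> ennreal (2 * c + 1)" for a
    proof -
      have "(\<integral>\<^sup>+\<omega>. indicator (B a) \<omega> * ennreal ((?X \<omega>)\<^sup>2) \<partial>M) \<le> (\<integral>\<^sup>+\<omega>. liminf (\<lambda>m. ?W m a \<omega>) \<partial>M)"
      proof (rule nn_integral_mono_AE, use paths in eventually_elim)
        case (elim \<omega>)
        then obtain Rd where Rd: "\<And>m a. \<omega> \<in> B a \<Longrightarrow> (\<lambda>n. \<Sum>k<n. D m a n k \<omega>) \<longlonglongrightarrow> Rd m" "Rd \<longlonglongrightarrow> ?X \<omega>" by blast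
        show ?case
        proof (cases "\<omega> \<in> B a")
          case True
          have "liminf (\<lambda>n. ennreal ((\<Sum>k<n. D m a n k \<omega>)\<^sup>2)) = ennreal ((Rd m)\<^sup>2)" for m
            by (intro lim_imp_Liminf tendsto_ennrealI tendsto_power Rd(1) True) simp
          then have "liminf (\<lambda>m. ?W m a \<omega>) = liminf (\<lambda>m. ennreal ((Rd m)\<^sup>2))" using True by simp
          also have "\<dots> = ennreal ((?X \<omega>)\<^sup>2)"
            by (intro lim_imp_Liminf tendsto_ennrealI tendsto_power Rd(2)) simp
          finally show ?thesis using True by simp
        qed simp
      qed
      also have "\<dots> \<le> liminf (\<lambda>m. \<integral>\<^sup>+\<omega>. ?W m a \<omega> \<partial>M)" by (rule nn_integral_liminf[OF WM])
      also have "\<dots> \<le> liminf (\<lambda>m::nat. ennreal (2 * c + 1))" using W by (intro Liminf_mono always_eventually) auto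
      also have "\<dots> = ennreal (2 * c + 1)" by (simp add: Liminf_const)
      finally show ?thesis .
    qed
    \<comment> \<open>Almost every path lies in \<open>B a\<close> for all large \<open>a\<close>,
      so the liminf of the squares restricted to \<open>B a\<close> dominates the full
      square.\<close>
    have "AE \<omega> in M. \<omega> \<in> space M" by (rule AE_space)
    with S(5) have "AE \<omega> in M. ennreal ((?X \<omega>)\<^sup>2) \<le> liminf (\<lambda>a. indicator (B a) \<omega> * ennreal ((?X \<omega>)\<^sup>2))"
    proof eventually_elim
      case (elim \<omega>)
      then have "\<forall>\<^sub>F a in sequentially. t < S a \<omega>" using t0 by blast
      then have "\<forall>\<^sub>F a in sequentially. ennreal ((?X \<omega>)\<^sup>2) \<le> indicator (B a) \<omega> * ennreal ((?X \<omega>)\<^sup>2)"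
        by eventually_elim (use elim(2) in \<open>simp add: B_def\<close>)
      then show ?case by (rule Liminf_bounded)
    qed
    then have "(\<integral>\<^sup>+\<omega>. ennreal ((?X \<omega>)\<^sup>2) \<partial>M) \<le> (\<integral>\<^sup>+\<omega>. liminf (\<lambda>a. indicator (B a) \<omega> * ennreal ((?X \<omega>)\<^sup>2)) \<partial>M)"
      by (rule nn_integral_mono_AE)
    also have "\<dots> \<le> liminf (\<lambda>a. \<integral>\<^sup>+\<omega>. indicator (B a) \<omega> * ennreal ((?X \<omega>)\<^sup>2) \<partial>M)"
      by (rule nn_integral_liminf) (use BM XM in measurable)
    also have "\<dots> \<le> liminf (\<lambda>a::nat. ennreal (2 * c + 1))" using Ba by (intro Liminf_mono always_eventually) auto
    also have "\<dots> = ennreal (2 * c + 1)" by (simp add: Liminf_const)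
    finally show "(\<integral>\<^sup>+\<omega>. ennreal ((?X \<omega>)\<^sup>2) \<partial>M) \<le> ennreal (2 * (C * t) + 1)" by (simp add: c_def)
  qed
qed

end

section \<open>The strong law for the local time\<close>

text \<open>Monotonicity encloses \<open>L t / t\<close> between the averages at the neighbouring
  squares, up to the ratio of these squares, which tends to \<open>1\<close>.\<close>

lemma mono_average_from_squares:
  fixes L :: "real \<Rightarrow> real"
  assumes mono: "mono_on {0..} L" and L0: "L 0 = 0"
    and lim: "(\<lambda>n. L ((real (Suc n))\<^sup>2) / (real (Suc n))\<^sup>2) \<longlonglongrightarrow> c"
  shows "((\<lambda>t. L t / t) \<longlongrightarrow> c) at_top"
proof -
  \<comment> \<open>Subtracting \<open>1\<close> makes \<open>Suc (k t)\<close> the integer part of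
    \<open>sqrt t\<close> for \<open>t \<ge> 1\<close>, in line with the indexing of the squares by
    \<open>Suc n\<close>.\<close>
  define k where "k t = nat (\<lfloor>sqrt t\<rfloor> - 1)" for t
  define a where "a n = L ((real (Suc n))\<^sup>2) / (real (Suc n))\<^sup>2" for n
  define \<rho> where "\<rho> n = (real (Suc (Suc n)) / real (Suc n))\<^sup>2" for n
  have Lnn: "0 \<le> L t" if "0 \<le> t" for t using mono_onD[OF mono, of 0 t] that L0 by simp
  have kinf: "filterlim k at_top at_top"
    unfolding filterlim_at_top
  proof
    fix Z :: nat
    show "\<forall>\<^sub>F t in at_top. Z \<le> k t"
      using eventually_ge_at_top[of "(real Z + 1)\<^sup>2"]
    proof eventually_elim
      case (elim t)
      then have "of_int (int Z + 1) \<le> sqrt t" by (simp add: real_le_rsqrt)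
      then have "int Z + 1 \<le> \<lfloor>sqrt t\<rfloor>" by (simp only: le_floor_iff)
      then show ?case by (simp add: k_def)
    qed
  qed
  have between: "(real (Suc (k t)))\<^sup>2 \<le> t" "t \<le> (real (Suc (Suc (k t))))\<^sup>2" if t: "1 \<le> t" for t
  proof -
    have s1: "1 \<le> sqrt t" using t by simp
    then have "1 \<le> \<lfloor>sqrt t\<rfloor>" by (simp add: le_floor_iff)
    then have kk: "real (Suc (k t)) = of_int \<lfloor>sqrt t\<rfloor>" by (simp add: k_def)
    have sq: "(sqrt t)\<^sup>2 = t" using t by simp
    have "real (Suc (k t)) \<le> sqrt t" unfolding kk by (rule of_int_floor_le)
    then have "(real (Suc (k t)))\<^sup>2 \<le> (sqrt t)\<^sup>2" by (intro power_mono) auto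
    then show "(real (Suc (k t)))\<^sup>2 \<le> t" unfolding sq .
    have "sqrt t \<le> real (Suc (Suc (k t)))" using kk by linarith
    then have "(sqrt t)\<^sup>2 \<le> (real (Suc (Suc (k t))))\<^sup>2" using s1 by (intro power_mono) auto
    then show "t \<le> (real (Suc (Suc (k t))))\<^sup>2" unfolding sq .
  qed
  have "(\<lambda>n. 1 + 1 / real (Suc n)) \<longlonglongrightarrow> 1 + 0"
    by (intro tendsto_add tendsto_const LIMSEQ_Suc[OF lim_const_over_n])
  then have "(\<lambda>n. (1 + 1 / real (Suc n))\<^sup>2) \<longlonglongrightarrow> (1 + 0)\<^sup>2" by (rule tendsto_power)
  moreover have "(1 + 1 / real (Suc n))\<^sup>2 = \<rho> n" for n by (simp add: \<rho>_def add_divide_distrib[symmetric] add.commute field_simps)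
  ultimately have \<rho>: "\<rho> \<longlonglongrightarrow> 1" by simp
  have \<rho>pos: "0 < \<rho> n" for n by (simp add: \<rho>_def)
  have a: "a \<longlonglongrightarrow> c" using lim by (simp add: a_def [abs_def])
  have lo: "(\<lambda>n. a n / \<rho> n) \<longlonglongrightarrow> c" using tendsto_divide[OF a \<rho>] by simp
  have up: "(\<lambda>n. a (Suc n) * \<rho> n) \<longlonglongrightarrow> c" using tendsto_mult[OF LIMSEQ_Suc[OF a] \<rho>] by simp
  show ?thesis
  proof (rule tendsto_sandwich)
    show "((\<lambda>t. a (k t) / \<rho> (k t)) \<longlongrightarrow> c) at_top" by (rule filterlim_compose[OF lo kinf])
    show "((\<lambda>t. a (Suc (k t)) * \<rho> (k t)) \<longlongrightarrow> c) at_top" by (rule filterlim_compose[OF up kinf])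
    show "\<forall>\<^sub>F t in at_top. a (k t) / \<rho> (k t) \<le> L t / t"
      using eventually_ge_at_top[of "1::real"]
    proof eventually_elim
      case (elim t)
      note b = between[OF elim]
      have "a (k t) / \<rho> (k t) = L ((real (Suc (k t)))\<^sup>2) / (real (Suc (Suc (k t))))\<^sup>2"
        by (simp add: a_def \<rho>_def power_divide del: of_nat_Suc)
      also have "\<dots> \<le> L t / t"
        using elim b Lnn mono_onD[OF mono, of "(real (Suc (k t)))\<^sup>2" t] by (intro frac_le) auto
      finally show ?case .
    qed
    show "\<forall>\<^sub>F t in at_top. L t / t \<le> a (Suc (k t)) * \<rho> (k t)"
      using eventually_ge_at_top[of "1::real"]
    proof eventually_elim
      case (elim t)
      note b = between[OF elim]
      have "L t / t \<le> L ((real (Suc (Suc (k t))))\<^sup>2) / (real (Suc (k t)))\<^sup>2"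
        using elim b Lnn mono_onD[OF mono, of t "(real (Suc (Suc (k t))))\<^sup>2"] by (intro frac_le) auto
      also have "\<dots> = a (Suc (k t)) * \<rho> (k t)"
        by (simp add: a_def \<rho>_def power_divide del: of_nat_Suc)
      finally show ?case .
    qed
  qed
qed

context reflected_diffusion
begin

text \<open>After division by \<open>T n\<close> the bounded ramp and the remainder
  \<open>X n\<close> vanish, and minus the average of the generator contributes the inverse of the
  speed mass. The factor \<open>2\<close> undoes the weight \<open>1 / 2\<close> of the local
  time.\<close>

lemma local_time_average:
  assumes lt: "semimartingale_local_time M F Y 0 L"
  shows "AE \<omega> in M. ((\<lambda>t. L t \<omega> / t) \<longlongrightarrow> 2 / speed_mass \<sigma> b l) at_top"
proof -
  let ?R = "gen (ramp1 l) (ramp2 l)" and ?m = "speed_mass \<sigma> b l"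
  obtain C where C: "0 \<le> C"
    "\<And>t. 0 < t \<Longrightarrow> (\<integral>\<^sup>+\<omega>. ennreal ((ramp l (Y t \<omega>) - ramp l (Y 0 \<omega>) - 1 / 2 * L t \<omega> - path_int ?R t \<omega>)\<^sup>2) \<partial>M) \<le> ennreal (2 * (C * t) + 1)"
    using ramp_local_time_moment[OF lt] by blast
  define T where "T n = (real (Suc n))\<^sup>2" for n
  have T1: "1 \<le> T n" for n by (simp add: T_def)
  have T0: "0 < T n" for n using T1[of n] by simp
  define X where "X n \<omega> = ramp l (Y (T n) \<omega>) - ramp l (Y 0 \<omega>) - 1 / 2 * L (T n) \<omega> - path_int ?R (T n) \<omega>" for n \<omega>
  have Rc: "continuous_on {0..l} ?R" by (intro gen_cont continuous_on_ramp)
  have lim: "AE \<omega> in M. (\<lambda>n. X n \<omega> / (real (Suc n))\<^sup>2) \<longlonglongrightarrow> 0"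
  proof (rule second_moment_subsequence[where C="2 * C + 1"])
    show "X n \<in> borel_measurable M" for n
    proof -
      have "L (T n) \<in> borel_measurable (F (T n))"
        using lt T0[of n] by (simp add: semimartingale_local_time_def adapted_process_def)
      then have "L (T n) \<in> borel_measurable M" by (rule measurable_F_M)
      then show ?thesis unfolding X_def
        by (intro borel_measurable_diff borel_measurable_times borel_measurable_const path_int_meas[OF Rc T0]
            measurable_F_M[OF Y_comp_meas[OF continuous_on_ramp(1) _ order_refl]] less_imp_le[OF T0] order_refl)
    qed
    show "(\<integral>\<^sup>+\<omega>. ennreal ((X n \<omega>)\<^sup>2) \<partial>M) \<le> ennreal ((2 * C + 1) * (real (Suc n))\<^sup>2)" for n
    proof -
      \<comment> \<open>As \<open>T n \<ge> 1\<close>, the additive tolerance is absorbed into the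
        linear growth.\<close>
      have "2 * (C * T n) + 1 \<le> (2 * C + 1) * T n" using T1[of n] by (simp add: algebra_simps)
      then show ?thesis using order_trans[OF C(2)[OF T0[of n]] ennreal_leI] unfolding X_def T_def by blast
    qed
  qed (use C in simp)
  have "AE \<omega> in M. \<omega> \<in> space M" by (rule AE_space)
  with lim ramp_average(2) show ?thesis
  proof eventually_elim
    case (elim \<omega>)
    then have w: "\<omega> \<in> space M" by simp
    have ramp0: "(\<lambda>n. (ramp l (Y (T n) \<omega>) - ramp l (Y 0 \<omega>)) / T n) \<longlonglongrightarrow> 0"
    proof (rule tendsto_0_le[where K=1])
      have Tinf: "filterlim T at_top sequentially" unfolding T_def
        by (intro filterlim_pow_at_top filterlim_compose[OF filterlim_real_sequentially filterlim_Suc]) simp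
      show "(\<lambda>n. l / T n) \<longlonglongrightarrow> 0"
        by (intro tendsto_divide_0[OF tendsto_const] filterlim_at_top_imp_at_infinity Tinf)
      have "\<bar>ramp l (Y (T n) \<omega>) - ramp l (Y 0 \<omega>)\<bar> \<le> l" for n
        using ramp_bounds[OF l Y_range[OF w less_imp_le[OF T0[of n]]]] ramp_bounds[OF l Y_range[OF w order_refl]]
        by (simp add: abs_le_iff)
      then show "\<forall>\<^sub>F n in sequentially. norm ((ramp l (Y (T n) \<omega>) - ramp l (Y 0 \<omega>)) / T n) \<le> norm (l / T n) * 1"
        using T0 l by (intro always_eventually allI) (auto simp: abs_divide intro!: divide_right_mono less_imp_le[OF T0])
    qed
    have "(\<lambda>n. 2 * ((ramp l (Y (T n) \<omega>) - ramp l (Y 0 \<omega>)) / T n - path_int ?R (T n) \<omega> / T n - X n \<omega> / T n))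
        \<longlonglongrightarrow> 2 * (0 - (- 1 / ?m) - 0)"
      by (intro tendsto_mult tendsto_const tendsto_diff ramp0 elim(1)[folded T_def] elim(2)[folded T_def])
    moreover have "2 * ((ramp l (Y (T n) \<omega>) - ramp l (Y 0 \<omega>)) / T n - path_int ?R (T n) \<omega> / T n - X n \<omega> / T n) = L (T n) \<omega> / T n" for n
      unfolding X_def diff_divide_distrib by simp
    ultimately have "(\<lambda>n. L (T n) \<omega> / T n) \<longlonglongrightarrow> 2 / ?m" by simp
    moreover have "mono_on {0..} (\<lambda>t. L t \<omega>)" "L 0 \<omega> = 0"
      using lt w by (auto simp: semimartingale_local_time_def)
    ultimately show ?case unfolding T_def by (intro mono_average_from_squares)
  qed
qed

end

section \<open>Assembling the edges of the star\<close>

theorem corollary3p1: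
  fixes M :: "'a measure"
    and F :: "nat \<Rightarrow> real \<Rightarrow> 'a measure"
    and N :: nat
    and v x0 :: "'p :: metric_space"
    and e :: "nat \<Rightarrow> 'p set"
    and C :: "nat \<Rightarrow> 'p \<Rightarrow> real"
    and len \<alpha> :: "nat \<Rightarrow> real"
    and b \<sigma> :: "nat \<Rightarrow> real \<Rightarrow> real"
    and Y L :: "nat \<Rightarrow> real \<Rightarrow> 'a \<Rightarrow> real"
    and i :: nat
  assumes graph: "star_graph N len v e C"
    and start: "x0 \<in> (\<Union>j\<in>{1..N}. e j)"
    and bounded_coeffs: "\<And>j. j \<in> {1..N} \<Longrightarrow> bounded (b j ` {0..len j}) \<and> bounded (\<sigma> j ` {0..len j})"
    and lipschitz_coeffs: "\<And>j. j \<in> {1..N} \<Longrightarrow>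
      (\<exists>K. K-lipschitz_on {0..len j} (b j)) \<and> (\<exists>K. K-lipschitz_on {0..len j} (\<sigma> j))"
    and elliptic: "\<exists>c>0. \<forall>j\<in>{1..N}. \<forall>x\<in>{0..len j}. c \<le> (\<sigma> j x)\<^sup>2"
    and weights_pos: "\<And>j. j \<in> {1..N} \<Longrightarrow> 0 < \<alpha> j"
    and weights_sum: "(\<Sum>j=1..N. \<alpha> j) = 1"
    and prob: "prob_space M"
    and filtrations: "\<And>j. j \<in> {1..N} \<Longrightarrow> usual_filtration M (F j)"
    and diffusions: "\<And>j. j \<in> {1..N} \<Longrightarrow>
      reflecting_diffusion M (F j) (\<sigma> j) (b j) (len j) (edge_start (e j) (C j) x0) (Y j)"
    and independent: "independent_processes M Y {1..N}"
    and local_times: "\<And>j. j \<in> {1..N} \<Longrightarrow> semimartingale_local_time M (F j) (Y j) 0 (L j)"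
    and i: "i \<in> {1..N}"
  shows "AE \<omega> in M.
    ((\<lambda>t. occupation_time N \<alpha> (\<lambda>j s. L j s \<omega>) i t / t) \<longlongrightarrow>
       \<alpha> i * speed_mass (\<sigma> i) (b i) (len i) /
         (\<Sum>j=1..N. \<alpha> j * speed_mass (\<sigma> j) (b j) (len j))) at_top"
proof -
  let ?m = "\<lambda>j. speed_mass (\<sigma> j) (b j) (len j)"
  from elliptic obtain c where c: "0 < c" "\<And>j x. j \<in> {1..N} \<Longrightarrow> x \<in> {0..len j} \<Longrightarrow> c \<le> (\<sigma> j x)\<^sup>2" by blast
  have diff: "reflected_diffusion M (F j) (\<sigma> j) (b j) (len j) (edge_start (e j) (C j) x0) c (Y j)"
    if j: "j \<in> {1..N}" for j
  proof -
    have "usual_prob_space M (F j)"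
      using prob filtrations[OF j] by (simp add: usual_prob_space_def usual_prob_space_axioms_def)
    moreover have "reflected_diffusion_axioms M (F j) (\<sigma> j) (b j) (len j) (edge_start (e j) (C j) x0) c (Y j)"
    proof
      show "0 < len j" using graph j by (auto simp: star_graph_def)
      show "continuous_on {0..len j} (\<sigma> j)" "continuous_on {0..len j} (b j)"
        using lipschitz_coeffs[OF j] lipschitz_on_continuous_on by blast+
    qed (use c j diffusions in auto)
    ultimately show ?thesis by (rule reflected_diffusion.intro)
  qed
  have mpos: "0 < ?m j" if "j \<in> {1..N}" for j by (rule reflected_diffusion.ramp_average(1)[OF diff[OF that]])
  \<comment> \<open>Each edge is treated in its own filtration. Finitely many null sets are
    discarded, so that a single path has the right rate on all edges at once.\<close>
  have "AE \<omega> in M. \<forall>j\<in>{1..N}. ((\<lambda>t. L j t \<omega> / t) \<longlongrightarrow> 2 / ?m j) at_top"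
    by (intro AE_finite_allI reflected_diffusion.local_time_average[OF diff local_times]) auto
  moreover have "AE \<omega> in M. \<omega> \<in> space M" by (rule AE_space)
  ultimately show ?thesis
  proof eventually_elim
    case (elim \<omega>)
    have "((\<lambda>t. occupation_time N \<alpha> (\<lambda>j s. L j s \<omega>) i t / t) \<longlongrightarrow>
        (\<alpha> i / (2 / ?m i)) / (\<Sum>j=1..N. \<alpha> j / (2 / ?m j))) at_top"
    proof (rule occupation_time_asymp)
      show "mono_on {0..} (\<lambda>s. L j s \<omega>)" if "j \<in> {1..N}" for j
        using local_times[OF that] elim(2) by (simp add: semimartingale_local_time_def)
    qed (use elim(1) weights_pos mpos i in auto)
    \<comment> \<open>The rates \<open>2 / m\<close> put a factor \<open>1 / 2\<close> into the
      numerator and into every summand of the denominator, where it cancels.\<close>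
    also have "(\<alpha> i / (2 / ?m i)) / (\<Sum>j=1..N. \<alpha> j / (2 / ?m j)) = \<alpha> i * ?m i / (\<Sum>j=1..N. \<alpha> j * ?m j)"
      by (simp add: sum_divide_distrib[symmetric])
    finally show ?case .
  qed
qed

end
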